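(* Let $\mathbf{S}_1,\dots,\mathbf{S}_n$ be independent random self-adjoint $d\times d$ matrices (real or complex), let $\mathbf{X}=\sum_{i=1}^n \mathbf{S}_i$, and let $\mathbf{Z}$ be a Gaussian self-adjoint $d\times d$ matrix with $\mathbb{E}[\mathbf{Z}]=\mathbb{E}[\mathbf{X}]$ and $\mathrm{Var}_{\otimes}[\mathbf{Z}]=\mathrm{Var}_{\otimes}[\mathbf{X}]$. For each natural number $p\ge 1$, $$\big|\,\|\mathbf{X}\|_{2p}-\|\mathbf{Z}\|_{2p}\,\big| \le \big(16\,p^2\,\sigma^2(\mathbf{X})\,L(\mathbf{X})\big)^{1/3}+16\,p\,L(\mathbf{X}).$$ Furthermore, when $p\,L^2(\mathbf{X})\le \sigma^2(\mathbf{X})$, $$\big|\,\|\mathbf{X}\|_{2p}-\|\mathbf{Z}\|_{2p}\,\big| \le 32\,p^2\,L(\mathbf{X}).$$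
   Context: A random self-adjoint matrix $\mathbf{Z}$ is Gaussian when the real and imaginary parts of its entries form a jointly Gaussian family of real random variables. The variance tensor of a random self-adjoint matrix $\mathbf{Y}$ is $\mathrm{Var}_{\otimes}[\mathbf{Y}]=\mathbb{E}[(\mathbf{Y}-\mathbb{E}\mathbf{Y})\otimes(\mathbf{Y}-\mathbb{E}\mathbf{Y})]$, with $\otimes$ the Kronecker product; together with the entrywise expectation it determines the law of a Gaussian self-adjoint matrix. Write $\|\cdot\|$ (no subscript) for the spectral norm, $\mathrm{tr}[\mathbf{A}]=d^{-1}\sum_{i} a_{ii}$ for the normalized trace, and $|\mathbf{A}|=(\mathbf{A}^*\mathbf{A})^{1/2}$. For a random matrix $\mathbf{Y}$ and $q>0$, $\|\mathbf{Y}\|_q=(\mathbb{E}\,\mathrm{tr}|\mathbf{Y}|^q)^{1/q}$. Matrix variance: $\sigma^2(\mathbf{X})=\|\mathbb{E}[(\mathbf{X}-\mathbb{E}\mathbf{X})^2]\|=\big\|\sum_{i=1}^n\mathbb{E}[(\mathbf{S}_i-\mathbb{E}\mathbf{S}_i)^2]\big\|$. Uniform bound statistic (depends on the decomposition into summands): $L(\mathbf{X})=\sup\max_i\|\mathbf{S}_i-\mathbb{E}\mathbf{S}_i\|$, where $\sup$ is the (essential) supremum over the randomness. All expectations involved are tacitly assumed to be defined and finite. *)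

theory Defs
  imports "HOL-Probability.Probability"
begin

definition cadjoint :: "complex ^ 'n ^ 'm \<Rightarrow> complex ^ 'm ^ 'n" where
  "cadjoint A = (\<chi> i j. cnj (A $ j $ i))"

definition self_adjoint :: "complex ^ 'd ^ 'd \<Rightarrow> bool" where
  "self_adjoint A \<longleftrightarrow> cadjoint A = A"

definition unitary_matrix :: "complex ^ 'd ^ 'd \<Rightarrow> bool" where
  "unitary_matrix U \<longleftrightarrow> cadjoint U ** U = mat 1 \<and> U ** cadjoint U = mat 1"

definition diag_matrix :: "real ^ 'd \<Rightarrow> complex ^ 'd ^ 'd" where
  "diag_matrix w = (\<chi> i j. if i = j then complex_of_real (w $ i) else 0)"

text \<open>Functional calculus for a self-adjoint matrix: apply \<open>f\<close> to the eigenvalues in a unitary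
  diagonalization. The result does not depend on the diagonalization; the value is unspecified if
  \<open>A\<close> is not self-adjoint.\<close>

definition hermitian_fun :: "(real \<Rightarrow> real) \<Rightarrow> complex ^ 'd ^ 'd \<Rightarrow> complex ^ 'd ^ 'd" where
  "hermitian_fun f A = (THE B. \<exists>U w. unitary_matrix U \<and>
     A = U ** diag_matrix w ** cadjoint U \<and>
     B = U ** diag_matrix (\<chi> i. f (w $ i)) ** cadjoint U)"

definition matrix_abs :: "complex ^ 'd ^ 'd \<Rightarrow> complex ^ 'd ^ 'd" where
  "matrix_abs A = hermitian_fun sqrt (cadjoint A ** A)"

definition matrix_abs_powr :: "complex ^ 'd ^ 'd \<Rightarrow> real \<Rightarrow> complex ^ 'd ^ 'd" where
  "matrix_abs_powr A q = hermitian_fun (\<lambda>x. x powr q) (matrix_abs A)"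

definition ntrace :: "complex ^ 'd ^ 'd \<Rightarrow> complex" where
  "ntrace A = trace A / of_nat CARD('d)"

text \<open>Operator norm with respect to the Euclidean norm on complex vectors.\<close>

definition spectral_norm :: "complex ^ 'd ^ 'd \<Rightarrow> real" where
  "spectral_norm A = onorm (\<lambda>v. A *v v)"

definition kronecker :: "complex ^ 'd ^ 'd \<Rightarrow> complex ^ 'e ^ 'e \<Rightarrow> complex ^ ('d \<times> 'e) ^ ('d \<times> 'e)" where
  "kronecker A B = (\<chi> r c. A $ fst r $ fst c * B $ snd r $ snd c)"

text \<open>The trace of a power of \<open>|Y|\<close> is real; \<open>Re\<close> only changes its type.\<close>

definition random_matrix_norm :: "'a measure \<Rightarrow> real \<Rightarrow> ('a \<Rightarrow> complex ^ 'd ^ 'd) \<Rightarrow> real" where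
  "random_matrix_norm M q Y =
     (\<integral>\<omega>. Re (ntrace (matrix_abs_powr (Y \<omega>) q)) \<partial>M) powr (1 / q)"

definition var_tensor :: "'a measure \<Rightarrow> ('a \<Rightarrow> complex ^ 'd ^ 'd) \<Rightarrow> complex ^ ('d \<times> 'd) ^ ('d \<times> 'd)" where
  "var_tensor M Y =
     (\<integral>\<omega>. kronecker (Y \<omega> - (\<integral>\<eta>. Y \<eta> \<partial>M)) (Y \<omega> - (\<integral>\<eta>. Y \<eta> \<partial>M)) \<partial>M)"

definition matrix_variance :: "'a measure \<Rightarrow> ('a \<Rightarrow> complex ^ 'd ^ 'd) \<Rightarrow> real" where
  "matrix_variance M Y =
     spectral_norm (\<integral>\<omega>. (Y \<omega> - (\<integral>\<eta>. Y \<eta> \<partial>M)) ** (Y \<omega> - (\<integral>\<eta>. Y \<eta> \<partial>M)) \<partial>M)"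

text \<open>Values in \<^typ>\<open>ennreal\<close>, as the summands need not be bounded.\<close>

definition uniform_bound :: "'a measure \<Rightarrow> nat \<Rightarrow> (nat \<Rightarrow> 'a \<Rightarrow> complex ^ 'd ^ 'd) \<Rightarrow> ennreal" where
  "uniform_bound M n S =
     esssup M (\<lambda>\<omega>. MAX i\<in>{1..n}. ennreal (spectral_norm (S i \<omega> - (\<integral>\<eta>. S i \<eta> \<partial>M))))"

text \<open>Degenerate (almost surely constant) variables count as Gaussian.\<close>

definition gaussian_rv :: "'a measure \<Rightarrow> ('a \<Rightarrow> real) \<Rightarrow> bool" where
  "gaussian_rv M Y \<longleftrightarrow> Y \<in> borel_measurable M \<and>
     ((\<exists>\<mu>. AE \<omega> in M. Y \<omega> = \<mu>) \<or>
      (\<exists>\<mu> s. s > 0 \<and> distributed M lborel Y (normal_density \<mu> s)))"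

definition jointly_gaussian :: "'a measure \<Rightarrow> 'i set \<Rightarrow> ('i \<Rightarrow> 'a \<Rightarrow> real) \<Rightarrow> bool" where
  "jointly_gaussian M I Y \<longleftrightarrow>
     (\<forall>J c. finite J \<and> J \<subseteq> I \<longrightarrow> gaussian_rv M (\<lambda>\<omega>. \<Sum>i\<in>J. c i * Y i \<omega>))"

definition gaussian_matrix :: "'a measure \<Rightarrow> ('a \<Rightarrow> complex ^ 'd ^ 'd) \<Rightarrow> bool" where
  "gaussian_matrix M Z \<longleftrightarrow>
     jointly_gaussian M (UNIV :: ('d \<times> 'd + 'd \<times> 'd) set)
       (case_sum (\<lambda>(i, j) \<omega>. Re (Z \<omega> $ i $ j)) (\<lambda>(i, j) \<omega>. Im (Z \<omega> $ i $ j)))"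

text \<open>Powers of extended nonnegative reals, meant for positive exponents.\<close>

definition ennreal_powr :: "ennreal \<Rightarrow> real \<Rightarrow> ennreal" where
  "ennreal_powr x a = (if x = \<infinity> then \<infinity> else ennreal (enn2real x powr a))"

end

theory Submission
  imports Defs
begin

text \<open>
  After centring, write \<open>X = A + S\<close> and \<open>Z = A + G\<close>, and interpolate by
  \<open>X \<theta> = A + sin \<theta> S + cos \<theta> G\<close>. The moments are regularized: with \<open>g = 16 p l\<close> one studies
  \<open>f \<theta> = E tr (X\<^sup>2 + g\<^sup>2)\<^sup>p\<close>, whose \<open>2p\<close>-th root \<open>H\<close> differs from the Schatten norm by at most
  \<open>g\<close>. Since \<open>X\<^sup>2 + g\<^sup>2 = (X + ig)(X - ig)\<close>, all derivatives are sums of traces of words in the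
  commuting matrices \<open>X \<plusminus> ig\<close>, which have modulus at least \<open>g\<close>.

  In \<open>f'\<close> the Gaussian term is integrated by parts, and the term of each summand is expanded to
  second order in the exchange of that summand for an independent copy; the covariances agree, so
  only words with three letters remain. Each is bounded by the operator norm \<open>l\<close> of one letter
  times two Hilbert--Schmidt norms. Moving the weights to a matrix that is independent of the
  letters costs a constant factor, because \<open>l / g = 1 / (16 p)\<close>.

  The result is \<open>|(H\<^sup>3)'| \<le> 48 p\<^sup>2 l c cos \<theta> sin\<^sup>2 \<theta>\<close>, where \<open>c\<close> may be the matrix variance or,
  because \<open>E (A + G)\<^sup>2\<close> dominates it, \<open>(H 0)\<^sup>2\<close>. Integrating gives
  \<open>|H(\<pi>/2)\<^sup>3 - H(0)\<^sup>3| \<le> 16 p\<^sup>2 l c\<close>; the two choices of \<open>c\<close> yield the two bounds.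
\<close>

subsection \<open>Hermitian matrices\<close>

text \<open>A word with three letters keeps 2p - 3 of the 2p factors, an odd number, while the
  moments control only powers of X^2 + g^2. Splitting that matrix into X + ig and X - ig keeps words
  of every length polynomial in X, so no absolute value is ever differentiated. Odd weights return
  to even ones by the lower bound g, or by the arithmetic-geometric mean where a factor 1/g would be
  too expensive.

  Since sin^2 + cos^2 = 1, the covariance of the interpolating matrix does not move. Hence the
  two-letter terms of the exchange and of Gaussian integration by parts carry the same factor sin
  cos with opposite signs and cancel exactly.

  Of the three lost factors one is paid for by l and two by c, so |f'| <= const p^3 l c cos sin^2
  f^(1 - 3/(2p)). This is a differential inequality for f^(3/(2p)) = H^3, the origin of the cube
  root in the first bound.

  The sum and the Gaussian may live on different probability spaces. The product space makes them
  independent, which is harmless because each norm depends on one law only.\<close>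

lemma cadjoint_nth [simp]: "cadjoint A $ i $ j = cnj (A $ j $ i)"
  by (simp add: cadjoint_def)

lemma cadjoint_cadjoint [simp]: "cadjoint (cadjoint A) = A"
  by (simp add: vec_eq_iff)

lemma cadjoint_mult: "cadjoint (A ** B) = cadjoint B ** cadjoint A"
  by (simp add: vec_eq_iff matrix_matrix_mult_def mult.commute)

lemma cadjoint_add: "cadjoint (A + B) = cadjoint A + cadjoint B"
  and cadjoint_diff: "cadjoint (A - B) = cadjoint A - cadjoint B"
  and cadjoint_scaleR: "cadjoint (r *\<^sub>R A) = r *\<^sub>R cadjoint A"
  and cadjoint_zero [simp]: "cadjoint 0 = 0"
  by (simp_all add: vec_eq_iff)

lemma cadjoint_sum: "cadjoint (sum f I) = (\<Sum>i\<in>I. cadjoint (f i))"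
  by (simp add: vec_eq_iff)

lemma bounded_linear_cadjoint: "bounded_linear (cadjoint :: complex ^ 'n ^ 'm \<Rightarrow> _)"
  by (rule linear_conv_bounded_linear[THEN iffD1])
     (auto intro!: linearI simp: cadjoint_add cadjoint_scaleR)

lemma self_adjointD: "self_adjoint A \<Longrightarrow> cnj (A $ i $ j) = A $ j $ i"
  unfolding self_adjoint_def by (metis cadjoint_nth)

lemma trace_add': "trace (A + B) = trace A + trace (B :: complex ^ 'n ^ 'n)"
  and trace_diff': "trace (A - B) = trace A - trace B"
  and trace_scaleR: "trace (r *\<^sub>R A) = r *\<^sub>R trace A"
  by (simp_all add: trace_def sum.distrib sum_subtractf scaleR_sum_right)

lemma trace_zero [simp]: "trace (0 :: complex ^ 'n ^ 'n) = 0"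
  by (simp add: trace_def)

lemma bounded_linear_trace: "bounded_linear (trace :: complex ^ 'n ^ 'n \<Rightarrow> complex)"
  by (rule linear_conv_bounded_linear[THEN iffD1])
     (auto intro!: linearI simp: trace_add' trace_scaleR)

lemma trace_commute: "trace (A ** B) = trace (B ** (A :: complex ^ 'n ^ 'm))"
  unfolding trace_def matrix_matrix_mult_def
  by simp (subst sum.swap, simp add: mult.commute)

lemma matrix_mult_distribs:
  fixes A B C :: "complex ^ 'n ^ 'n"
  shows "(A + B) ** C = A ** C + B ** C" "C ** (A + B) = C ** A + C ** B"
    "(A - B) ** C = A ** C - B ** C" "C ** (A - B) = C ** A - C ** B"
    "(r *\<^sub>R A) ** C = r *\<^sub>R (A ** C)" "C ** (r *\<^sub>R A) = r *\<^sub>R (C ** A)"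
    "0 ** C = 0" "C ** 0 = 0"
  by (simp_all add: vec_eq_iff matrix_matrix_mult_def sum.distrib sum_subtractf algebra_simps
      scaleR_sum_right)

text \<open>The norm on nested vectors is the Hilbert-Schmidt norm. It is written
  \<open>norm\<close> throughout, while operator norms enter through \<open>op_le\<close>.\<close>

lemma norm_matrix_sq:
  fixes A :: "complex ^ 'n ^ 'm"
  shows "(norm A)\<^sup>2 = (\<Sum>i\<in>UNIV. \<Sum>j\<in>UNIV. (cmod (A $ i $ j))\<^sup>2)"
  by (simp add: norm_vec_def L2_set_def sum_nonneg)

lemma norm_cadjoint [simp]:
  fixes A :: "complex ^ 'n ^ 'n"
  shows "norm (cadjoint A) = norm A"
proof -
  have "(norm (cadjoint A))\<^sup>2 = (norm A)\<^sup>2"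
    unfolding norm_matrix_sq by simp (rule sum.swap)
  then show ?thesis by simp
qed

lemma cmod_trace_mult_le:
  fixes A B :: "complex ^ 'n ^ 'n"
  shows "cmod (trace (A ** B)) \<le> norm A * norm B"
proof -
  have "cmod (trace (A ** B)) \<le> (\<Sum>(i,k)\<in>UNIV \<times> UNIV. cmod (A $ i $ k) * cmod (B $ k $ i))"
    unfolding trace_def matrix_matrix_mult_def sum.cartesian_product[symmetric]
    by simp (intro norm_sum[THEN order_trans] sum_mono, simp add: norm_mult)
  also have "\<dots> \<le> L2_set (\<lambda>(i,k). cmod (A $ i $ k)) (UNIV \<times> UNIV) *
      L2_set (\<lambda>(i,k). cmod (B $ k $ i)) (UNIV \<times> UNIV)"
    by (rule order_trans[OF _ L2_set_mult_ineq], rule sum_mono) auto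
  also have "L2_set (\<lambda>(i,k). cmod (A $ i $ k)) (UNIV \<times> UNIV) = norm A"
    unfolding L2_set_def using norm_matrix_sq[of A]
    by (simp add: sum.cartesian_product case_prod_unfold real_sqrt_unique)
  also have "L2_set (\<lambda>(i,k). cmod (B $ k $ i)) (UNIV \<times> UNIV) = norm (cadjoint B)"
    unfolding L2_set_def using norm_matrix_sq[of "cadjoint B"]
    by (simp add: sum.cartesian_product case_prod_unfold real_sqrt_unique)
  finally show ?thesis by simp
qed

text \<open>An upper bound on the operator norm, kept as a predicate: it is a closed condition on
  \<open>A\<close>, it survives multiplication by unitaries, and it applies to vectors without a
  detour through \<open>onorm\<close>.\<close>

definition op_le :: "real \<Rightarrow> complex ^ 'n ^ 'm \<Rightarrow> bool" where
  "op_le l A \<longleftrightarrow> (\<forall>v. norm (A *v v) \<le> l * norm v)"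

lemma norm_matrix_columns:
  fixes A :: "complex ^ 'n ^ 'm"
  shows "(norm A)\<^sup>2 = (\<Sum>j\<in>UNIV. (norm (column j A))\<^sup>2)"
  unfolding norm_matrix_sq
  by (subst sum.swap) (simp add: norm_vec_def L2_set_def sum_nonneg column_def)

text \<open>\<open>A\<close> acts on the columns of \<open>B\<close> one by one, and the squared
  Hilbert-Schmidt norm is the sum of the squared column norms.\<close>

lemma op_le_norm_mult:
  fixes A B :: "complex ^ 'n ^ 'n"
  assumes "op_le l A" "0 \<le> l"
  shows "norm (A ** B) \<le> l * norm B"
proof -
  have "(norm (A ** B))\<^sup>2 = (\<Sum>j\<in>UNIV. (norm (A *v column j B))\<^sup>2)"
    unfolding norm_matrix_columns
    by (intro sum.cong refl arg_cong[where f="\<lambda>v. (norm v)\<^sup>2"])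
       (simp add: column_def vec_eq_iff matrix_matrix_mult_def matrix_vector_mult_def)
  also have "\<dots> \<le> (\<Sum>j\<in>UNIV. (l * norm (column j B))\<^sup>2)"
    using assms by (intro sum_mono power_mono) (auto simp: op_le_def)
  also have "\<dots> = (l * norm B)\<^sup>2"
    by (simp add: power_mult_distrib norm_matrix_columns sum_distrib_left)
  finally show ?thesis
    by (rule power2_le_imp_le) (use assms in auto)
qed

lemma op_le_norm: "op_le (norm A) (A :: complex ^ 'n ^ 'n)"
  unfolding op_le_def
proof
  fix v :: "complex ^ 'n"
  have "(norm (A *v v))\<^sup>2 = (\<Sum>i\<in>UNIV. (cmod (\<Sum>j\<in>UNIV. A $ i $ j * v $ j))\<^sup>2)"
    by (simp add: norm_vec_def L2_set_def sum_nonneg matrix_vector_mult_def)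
  also have "\<dots> \<le> (\<Sum>i\<in>UNIV. (norm (A $ i) * norm v)\<^sup>2)"
  proof (intro sum_mono power_mono)
    fix i
    have "cmod (\<Sum>j\<in>UNIV. A $ i $ j * v $ j) \<le> (\<Sum>j\<in>UNIV. \<bar>cmod (A $ i $ j)\<bar> * \<bar>cmod (v $ j)\<bar>)"
      by (rule norm_sum[THEN order_trans]) (simp add: norm_mult)
    also have "\<dots> \<le> norm (A $ i) * norm v"
      unfolding norm_vec_def by (rule L2_set_mult_ineq)
    finally show "cmod (\<Sum>j\<in>UNIV. A $ i $ j * v $ j) \<le> norm (A $ i) * norm v" .
  qed auto
  also have "\<dots> = (norm A * norm v)\<^sup>2"
    by (simp add: power_mult_distrib sum_distrib_right norm_vec_def[of A] L2_set_def sum_nonneg)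
  finally show "norm (A *v v) \<le> norm A * norm v"
    by (rule power2_le_imp_le) auto
qed

lemma norm_matrix_mult_le: "norm (A ** B) \<le> norm (A :: complex ^ 'n ^ 'n) * norm (B :: complex ^ 'n ^ 'n)"
  by (rule op_le_norm_mult[OF op_le_norm]) simp

lemma bounded_bilinear_matrix_mult:
  "bounded_bilinear ((**) :: complex ^ 'n ^ 'n \<Rightarrow> complex ^ 'n ^ 'n \<Rightarrow> complex ^ 'n ^ 'n)"
  by (rule bounded_bilinear.intro)
     (auto simp: matrix_mult_distribs intro!: exI[of _ 1] norm_matrix_mult_le)

lemma op_le_spectral_norm: "op_le (spectral_norm A) A"
  unfolding op_le_def spectral_norm_def
  by (intro allI onorm) simp

lemma op_le_mono: "op_le l A \<Longrightarrow> l \<le> l' \<Longrightarrow> op_le l' A"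
  unfolding op_le_def by (meson mult_right_mono norm_ge_zero order_trans)

lemma op_le_diff: "op_le l A \<Longrightarrow> op_le l' B \<Longrightarrow> op_le (l + l') (A - B)"
  unfolding op_le_def matrix_vector_mult_diff_rdistrib
  by (metis (no_types, opaque_lifting) norm_triangle_le_diff add_mono distrib_right)

lemma spectral_norm_nonneg: "0 \<le> spectral_norm A"
  unfolding spectral_norm_def by (rule onorm_pos_le) simp

subsection \<open>Unitary diagonalization\<close>

lemma unitary_matrixD:
  assumes "unitary_matrix U"
  shows "cadjoint U ** U = mat 1" "U ** cadjoint U = mat 1"
  using assms by (auto simp: unitary_matrix_def)

lemma unitary_cadjoint: "unitary_matrix U \<Longrightarrow> unitary_matrix (cadjoint U)"
  by (simp add: unitary_matrix_def)

lemma unitary_mult: "unitary_matrix U \<Longrightarrow> unitary_matrix V \<Longrightarrow> unitary_matrix (U ** V)"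
  unfolding unitary_matrix_def cadjoint_mult
  by (metis matrix_mul_assoc matrix_mul_rid)

lemma unitary_norm_vec:
  assumes "unitary_matrix (U :: complex ^ 'n ^ 'n)"
  shows "norm (U *v v) = norm v"
proof -
  have *: "of_real ((norm v)\<^sup>2) = (\<Sum>i\<in>UNIV. cnj (v $ i) * v $ i)" for v :: "complex ^ 'n"
    by (simp add: norm_vec_def L2_set_def sum_nonneg complex_norm_square mult.commute del: of_real_power)
  have "of_real ((norm (U *v v))\<^sup>2) = (\<Sum>i\<in>UNIV. \<Sum>k\<in>UNIV. \<Sum>j\<in>UNIV. cnj (v $ k) * (cnj (U $ i $ k) * U $ i $ j) *
      v $ j)"
    unfolding * by (simp add: matrix_vector_mult_def sum_product) (simp add: mult_ac)
  also have "\<dots> = (\<Sum>k\<in>UNIV. \<Sum>j\<in>UNIV. cnj (v $ k) * (\<Sum>i\<in>UNIV. cnj (U $ i $ k) * U $ i $ j) * v $ j)"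
    by (simp add: sum_distrib_left sum_distrib_right)
       (subst sum.swap, rule sum.cong, simp, rule sum.swap)
  also have "\<dots> = (\<Sum>k\<in>UNIV. \<Sum>j\<in>UNIV. cnj (v $ k) * (cadjoint U ** U) $ k $ j * v $ j)"
    by (simp add: matrix_matrix_mult_def)
  also have "\<dots> = of_real ((norm v)\<^sup>2)"
    unfolding * unitary_matrixD[OF assms]
    by (simp add: mat_def if_distrib[of "\<lambda>x. _ * x"] if_distrib[of "\<lambda>x. x * _"] cong: if_cong)
  finally have "(norm (U *v v))\<^sup>2 = (norm v)\<^sup>2"
    by (metis of_real_eq_iff)
  then show ?thesis by simp
qed

lemma op_le_unitary_conj:
  assumes "unitary_matrix (U :: complex ^ 'n ^ 'n)" "unitary_matrix V" "op_le l A"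
  shows "op_le l (U ** A ** V)"
  using assms(3) unfolding op_le_def
  by (metis matrix_vector_mul_assoc unitary_norm_vec[OF assms(1)] unitary_norm_vec[OF assms(2)])

text \<open>The real inner product on \<open>complex ^ 'n\<close> is the real part of the Hermitian
  one. Working over the reals makes compactness, subspaces and dimension available for the spectral
  theorem.\<close>

lemma self_adjoint_real_inner:
  fixes H :: "complex ^ 'n ^ 'n"
  assumes "self_adjoint H"
  shows "(H *v u) \<bullet> v = u \<bullet> (H *v v)"
proof -
  have *: "u \<bullet> v = Re (\<Sum>i\<in>UNIV. cnj (u $ i) * v $ i)" for u v :: "complex ^ 'n"
    by (simp add: inner_vec_def inner_complex_def)
  have "(\<Sum>i\<in>UNIV. cnj ((H *v u) $ i) * v $ i) = (\<Sum>i\<in>UNIV. \<Sum>j\<in>UNIV. H $ j $ i * cnj (u $ j) * v $ i)"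
    by (simp add: matrix_vector_mult_def sum_distrib_right self_adjointD[OF assms])
  also have "\<dots> = (\<Sum>j\<in>UNIV. cnj (u $ j) * (H *v v) $ j)"
    by (subst sum.swap) (simp add: matrix_vector_mult_def sum_distrib_left mult_ac)
  finally show ?thesis unfolding * by simp
qed

text \<open>Hermitian orthogonality to \<open>u\<close> is thus real orthogonality to both
  \<open>u\<close> and \<open>\<i> *s u\<close>.\<close>

lemma cinner_real_inner:
  fixes u v :: "complex ^ 'n"
  shows "(\<Sum>i\<in>UNIV. cnj (u $ i) * v $ i) = Complex (u \<bullet> v) ((\<i> *s u) \<bullet> v)"
  by (simp add: complex_eq_iff inner_vec_def inner_complex_def)

lemma matrix_vector_mult_vsmult: "A *v (c *s v) = c *s (A *v (v :: complex ^ 'n))"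
  by (simp add: vec_eq_iff matrix_vector_mult_def sum_distrib_left mult_ac)

lemma matrix_vector_scaleR: "A *v (r *\<^sub>R v) = r *\<^sub>R (A *v (v :: complex ^ 'n))"
  by (simp add: vec_eq_iff matrix_vector_mult_def scaleR_sum_right)

text \<open>A maximizer of the quadratic form on the unit sphere of an invariant subspace is an eigenvector.\<close>

lemma self_adjoint_eigenvector_in_subspace:
  fixes H :: "complex ^ 'n ^ 'n"
  assumes H: "self_adjoint H" and S: "subspace S" and inv: "\<And>v. v \<in> S \<Longrightarrow> H *v v \<in> S"
    and v0: "v0 \<in> S" "v0 \<noteq> 0"
  shows "\<exists>u \<in> S. \<exists>l. norm u = 1 \<and> H *v u = l *\<^sub>R u"
proof -
  let ?K = "sphere 0 1 \<inter> S"
  have K: "compact ?K"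
    by (intro compact_Int_closed closed_subspace S compact_sphere)
  have "v0 /\<^sub>R norm v0 \<in> ?K"
    using v0 S by (simp add: subspace_scale)
  then have "?K \<noteq> {}" by blast
  moreover have "continuous_on ?K (\<lambda>v. v \<bullet> (H *v v))"
    by (intro continuous_intros linear_continuous_on matrix_vector_mul_bounded_linear)
  ultimately obtain u where u: "u \<in> ?K" and max: "\<And>v. v \<in> ?K \<Longrightarrow> v \<bullet> (H *v v) \<le> u \<bullet> (H *v u)"
    using continuous_attains_sup[OF K, of "\<lambda>v. v \<bullet> (H *v v)"] by blast
  define l where "l = u \<bullet> (H *v u)"
  have q: "v \<bullet> (H *v v) \<le> l * (v \<bullet> v)" if "v \<in> S" for v
  proof (cases "v = 0")
    case False
    have "v /\<^sub>R norm v \<in> ?K"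
      using that S False by (simp add: subspace_scale)
    from max[OF this] have "(v \<bullet> (H *v v)) / (norm v)\<^sup>2 \<le> l"
      by (simp add: l_def matrix_vector_scaleR power2_eq_square field_simps)
    then show ?thesis
      using False by (simp add: divide_simps power2_norm_eq_inner)
  qed simp
  define v where "v = l *\<^sub>R u - H *v u"
  have vS: "v \<in> S"
    unfolding v_def using u S inv by (auto intro: subspace_diff subspace_scale)
  have uu: "u \<bullet> u = 1" using u by (simp add: norm_eq_1)
  \<comment> \<open>The gap in \<open>q\<close> at \<open>u + t *\<^sub>R v\<close>, with the
    residual \<open>v\<close> as direction: it has no constant term, and its linear coefficient is
    \<open>2 * (v \<bullet> v)\<close>.\<close>
  have "0 \<le> 2 * t * (v \<bullet> v) + t\<^sup>2 * (l * (v \<bullet> v) - v \<bullet> (H *v v))" for t :: real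
  proof -
    have "u + t *\<^sub>R v \<in> S" using u vS S by (auto intro: subspace_add subspace_scale)
    from q[OF this] have "0 \<le> l * ((u + t *\<^sub>R v) \<bullet> (u + t *\<^sub>R v)) - (u + t *\<^sub>R v) \<bullet> (H *v (u + t *\<^sub>R v))"
      by simp
    also have "\<dots> = (l * (u \<bullet> u) - l) + 2 * t * (v \<bullet> (l *\<^sub>R u - H *v u)) + t\<^sup>2 * (l * (v \<bullet> v) - v \<bullet> (H *v v))"
      using self_adjoint_real_inner[OF H, of v u]
      by (simp add: l_def inner_add_left inner_add_right inner_diff_right matrix_vector_right_distrib
        matrix_vector_scaleR algebra_simps power2_eq_square inner_commute)
    finally show ?thesis by (simp add: uu v_def)
  qed
  note nonneg = this
  have "v \<bullet> v = 0"
  proof (rule ccontr)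
    assume "v \<bullet> v \<noteq> 0"
    then have pos: "v \<bullet> v > 0" by simp
    define c where "c = l * (v \<bullet> v) - v \<bullet> (H *v v)"
    \<comment> \<open>Negative, so that the linear term has the wrong sign, and so small that the
      quadratic term is at most half of the linear one.\<close>
    define t where "t = - (v \<bullet> v) / (\<bar>c\<bar> + 1)"
    have "0 \<le> t * (2 * (v \<bullet> v) + t * c)"
      using nonneg[of t] by (simp add: c_def power2_eq_square algebra_simps)
    moreover have "t < 0" using pos by (simp add: t_def field_simps)
    ultimately have "2 * (v \<bullet> v) + t * c \<le> 0"
      by (simp add: zero_le_mult_iff)
    moreover have "\<bar>t * c\<bar> \<le> v \<bullet> v"
      using pos by (simp add: t_def abs_mult field_simps)
    ultimately show False using pos by linarith
  qed
  then have "H *v u = l *\<^sub>R u" by (simp add: v_def)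
  then show ?thesis using u by auto
qed

lemma self_adjoint_orthonormal_eigenvectors:
  fixes H :: "complex ^ 'n ^ 'n"
  assumes H: "self_adjoint H" and "k \<le> CARD('n)"
  shows "\<exists>B. finite B \<and> card B = k \<and> (\<forall>u\<in>B. norm u = 1 \<and> (\<exists>l. H *v u = l *\<^sub>R u)) \<and>
           (\<forall>u\<in>B. \<forall>v\<in>B. u \<noteq> v \<longrightarrow> (\<Sum>i\<in>UNIV. cnj (u $ i) * v $ i) = 0)"
  using assms(2)
proof (induction k)
  case 0
  then show ?case by (intro exI[of _ "{}"]) auto
next
  case (Suc k)
  then obtain B where B: "finite B" "card B = k"
     "\<And>u. u \<in> B \<Longrightarrow> norm u = 1" "\<And>u. u \<in> B \<Longrightarrow> \<exists>l. H *v u = l *\<^sub>R u"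
     "\<And>u v. u \<in> B \<Longrightarrow> v \<in> B \<Longrightarrow> u \<noteq> v \<Longrightarrow> (\<Sum>i\<in>UNIV. cnj (u $ i) * v $ i) = 0"
    by auto
  \<comment> \<open>Adjoining \<open>\<i> *s u\<close> makes the real orthogonal complement a
    complex one. At most \<open>2 * k\<close> vectors cannot span a space of real dimension
    \<open>2 * CARD('n)\<close>, so a nonzero vector remains.\<close>
  define C where "C = B \<union> (\<lambda>u. \<i> *s u) ` B"
  define S where "S = {v. \<forall>u\<in>C. u \<bullet> v = 0}"
  have "card C \<le> 2 * k"
    unfolding C_def using card_Un_le[of B "(\<lambda>u. \<i> *s u) ` B"] card_image_le[OF B(1), of "\<lambda>u. \<i> *s u"] B(2)
    by linarith
  then have "dim C < DIM(complex ^ 'n)"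
    using dim_le_card'[of C] Suc.prems B(1) by (simp add: C_def)
  then obtain v0 where v0: "v0 \<noteq> 0" "\<And>y. y \<in> span C \<Longrightarrow> orthogonal v0 y"
    using orthogonal_to_subspace_exists by blast
  have "v0 \<in> S"
    using v0(2) by (auto simp: S_def orthogonal_def inner_commute intro: span_base)
  have "subspace S"
    unfolding S_def by (auto simp: subspace_def inner_add_right)
  have inv: "H *v v \<in> S" if "v \<in> S" for v
  proof -
    have "u \<bullet> (H *v v) = 0 \<and> (\<i> *s u) \<bullet> (H *v v) = 0" if u: "u \<in> B" for u
    proof -
      obtain l where l: "H *v u = l *\<^sub>R u" using B(4) u by blast
      have "H *v (\<i> *s u) = l *\<^sub>R (\<i> *s u)"
        unfolding matrix_vector_mult_vsmult l by (simp add: vec_eq_iff)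
      moreover have "u \<bullet> v = 0" "(\<i> *s u) \<bullet> v = 0"
        using \<open>v \<in> S\<close> u by (auto simp: S_def C_def)
      ultimately show ?thesis
        using l by (simp add: self_adjoint_real_inner[OF H, symmetric])
    qed
    then show ?thesis by (auto simp: S_def C_def)
  qed
  obtain u l where u: "u \<in> S" "norm u = 1" "H *v u = l *\<^sub>R u"
    using self_adjoint_eigenvector_in_subspace[OF H \<open>subspace S\<close> inv \<open>v0 \<in> S\<close> v0(1)] by blast
  have orth: "(\<Sum>i\<in>UNIV. cnj (v $ i) * u $ i) = 0" if "v \<in> B" for v
    using u(1) that by (auto simp: cinner_real_inner S_def C_def complex_eq_iff)
  have orth': "(\<Sum>i\<in>UNIV. cnj (u $ i) * v $ i) = 0" if "v \<in> B" for v
  proof -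
    have "(\<Sum>i\<in>UNIV. cnj (u $ i) * v $ i) = cnj (\<Sum>i\<in>UNIV. cnj (v $ i) * u $ i)"
      by (simp add: mult.commute)
    then show ?thesis using orth[OF that] by simp
  qed
  have "u \<notin> B"
  proof
    assume "u \<in> B"
    then have "u \<bullet> u = 0" using u(1) by (auto simp: S_def C_def)
    with u(2) show False by simp
  qed
  then show ?case
    using B u orth orth'
    by (intro exI[of _ "insert u B"]) auto
qed

lemma self_adjoint_diagonalization:
  fixes H :: "complex ^ 'n ^ 'n"
  assumes "self_adjoint H"
  shows "\<exists>U w. unitary_matrix U \<and> H = U ** diag_matrix w ** cadjoint U"
proof -
  obtain B where B: "finite B" "card B = CARD('n)"
     "\<And>u. u \<in> B \<Longrightarrow> norm u = 1" "\<And>u. u \<in> B \<Longrightarrow> \<exists>l. H *v u = l *\<^sub>R u"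
     "\<And>u v. u \<in> B \<Longrightarrow> v \<in> B \<Longrightarrow> u \<noteq> v \<Longrightarrow> (\<Sum>i\<in>UNIV. cnj (u $ i) * v $ i) = 0"
    using self_adjoint_orthonormal_eigenvectors[OF assms order_refl] by auto
  obtain e :: "'n \<Rightarrow> complex ^ 'n" where e: "bij_betw e UNIV B"
    using finite_same_card_bij[OF finite B(1)] B(2) by auto
  then have eB: "e j \<in> B" for j by (auto simp: bij_betw_def)
  obtain w where w: "\<And>j. H *v e j = w j *\<^sub>R e j"
    using B(4)[OF eB] by metis
  define U :: "complex ^ 'n ^ 'n" where "U = (\<chi> i j. e j $ i)"
  have "(\<Sum>i\<in>UNIV. cnj (e j $ i) * e j $ i) = 1" for j
    unfolding cinner_real_inner using B(3)[OF eB[of j]]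
    by (simp add: norm_eq_1 complex_eq_iff inner_vec_def inner_complex_def)
  moreover have "(\<Sum>i\<in>UNIV. cnj (e j $ i) * e k $ i) = 0" if "j \<noteq> k" for j k
    using e that by (intro B(5) eB) (auto simp: bij_betw_def inj_on_def)
  ultimately have 1: "cadjoint U ** U = mat 1"
    by (auto simp: vec_eq_iff matrix_matrix_mult_def U_def mat_def)
  then have U: "unitary_matrix U"
    by (simp add: unitary_matrix_def matrix_left_right_inverse)
  have "H ** U = U ** diag_matrix (\<chi> j. w j)"
  proof -
    have "(\<Sum>k\<in>UNIV. H $ i $ k * e j $ k) = e j $ i * of_real (w j)" for i j
      using arg_cong[OF w[of j], of "\<lambda>v. v $ i"]
      by (simp add: matrix_vector_mult_def) (simp add: scaleR_conv_of_real mult.commute)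
    then show ?thesis
      by (simp add: vec_eq_iff matrix_matrix_mult_def U_def diag_matrix_def
        if_distrib[of "\<lambda>x. _ * x"] cong: if_cong)
  qed
  then have "H = U ** diag_matrix (\<chi> j. w j) ** cadjoint U"
    by (metis U matrix_mul_assoc matrix_mul_rid unitary_matrixD(2))
  with U show ?thesis by blast
qed

subsection \<open>Products of shifted copies of a matrix\<close>

text \<open>Lists of shifts instead of powers: a derivative cuts a product at an arbitrary place,
  and the pieces are again words of this kind, obtained by \<open>take\<close> and
  \<open>drop\<close>.\<close>

primrec shift_prod :: "complex list \<Rightarrow> complex ^ 'n ^ 'n \<Rightarrow> complex ^ 'n ^ 'n" where
  "shift_prod [] x = mat 1"
| "shift_prod (c # cs) x = (x + mat c) ** shift_prod cs x"

text \<open>The derivative of \<open>shift_prod cs\<close> at \<open>x\<close> along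
  \<open>H\<close>. The order of the factors is kept, as \<open>H\<close> need not commute with
  \<open>x\<close>.\<close>

primrec shift_deriv :: "complex list \<Rightarrow> complex ^ 'n ^ 'n \<Rightarrow> complex ^ 'n ^ 'n \<Rightarrow> complex ^ 'n ^ 'n" where
  "shift_deriv [] x H = 0"
| "shift_deriv (c # cs) x H = H ** shift_prod cs x + (x + mat c) ** shift_deriv cs x H"

text \<open>The factors of \<open>(x\<^sup>2 + g\<^sup>2)\<^sup>m\<close>, split over the complex numbers.\<close>

definition resolvent_shifts :: "real \<Rightarrow> nat \<Rightarrow> complex list" where
  "resolvent_shifts g m = replicate m (\<i> * of_real g) @ replicate m (- \<i> * of_real g)"

definition pm_shifts :: "real \<Rightarrow> complex list \<Rightarrow> bool" where
  "pm_shifts g cs \<longleftrightarrow> set cs \<subseteq> {\<i> * of_real g, - \<i> * of_real g}"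

lemma length_resolvent_shifts [simp]: "length (resolvent_shifts g m) = 2 * m"
  by (simp add: resolvent_shifts_def)

lemma pm_shifts_resolvent [simp]: "pm_shifts g (resolvent_shifts g m)"
  by (auto simp: pm_shifts_def resolvent_shifts_def)

lemma pm_shifts_simps [simp]:
  "pm_shifts g []" "pm_shifts g (c # cs) \<longleftrightarrow> c \<in> {\<i> * of_real g, - \<i> * of_real g} \<and> pm_shifts g cs"
  "pm_shifts g (cs @ ds) \<longleftrightarrow> pm_shifts g cs \<and> pm_shifts g ds"
  by (auto simp: pm_shifts_def)

lemma pm_shifts_take_drop:
  "pm_shifts g cs \<Longrightarrow> pm_shifts g (take k cs)" "pm_shifts g cs \<Longrightarrow> pm_shifts g (drop k cs)"
  by (auto simp: pm_shifts_def dest: in_set_takeD in_set_dropD)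

lemma shift_prod_append: "shift_prod (as @ bs) x = shift_prod as x ** shift_prod bs x"
  by (induction as) (simp_all add: matrix_mul_assoc)

lemma trace_sum: "trace (sum f I) = (\<Sum>i\<in>I. trace (f i :: complex ^ 'n ^ 'n))"
  by (induction I rule: infinite_finite_induct) (simp_all add: trace_add')

lemma matrix_mult_sum:
  fixes M :: "complex ^ 'n ^ 'n"
  shows "M ** sum f I = (\<Sum>k\<in>I. M ** f k)" "sum f I ** M = (\<Sum>k\<in>I. f k ** M)"
  by (induction I rule: infinite_finite_induct) (simp_all add: matrix_mult_distribs)

lemma shift_deriv_eq_sum:
  "shift_deriv cs x H =
     (\<Sum>k<length cs. shift_prod (take k cs) x ** H ** shift_prod (drop (Suc k) cs) x)"
proof (induction cs)
  case (Cons c cs)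
  show ?case
    by (simp add: Cons sum.lessThan_Suc_shift matrix_mult_sum matrix_mul_assoc del: sum.lessThan_Suc)
qed simp

lemma shift_deriv_add: "shift_deriv cs x (H + K) = shift_deriv cs x H + shift_deriv cs x K"
  by (induction cs) (simp_all add: matrix_mult_distribs)

lemma shift_deriv_scaleR: "shift_deriv cs x (r *\<^sub>R H) = r *\<^sub>R shift_deriv cs x H"
  by (induction cs) (simp_all add: matrix_mult_distribs scaleR_add_right)

lemma shift_deriv_diff: "shift_deriv cs x (H - K) = shift_deriv cs x H - shift_deriv cs x K"
  using shift_deriv_add[of cs x "H - K" K] by (simp add: eq_diff_eq)

text \<open>By cyclicity the pieces on both sides of \<open>H\<close> merge into one word, shorter
  by one than \<open>cs\<close>.\<close>

lemma trace_shift_deriv: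
  "trace (shift_deriv cs x H) =
     (\<Sum>k<length cs. trace (shift_prod (drop (Suc k) cs @ take k cs) x ** H))"
proof -
  have "trace (shift_prod (take k cs) x ** H ** shift_prod (drop (Suc k) cs) x)
      = trace (shift_prod (drop (Suc k) cs @ take k cs) x ** H)" for k
    by (subst trace_commute) (simp add: shift_prod_append matrix_mul_assoc)
  then show ?thesis
    by (simp add: shift_deriv_eq_sum trace_sum)
qed

text \<open>An exact telescoping sum: factors to the left of the letter are still at
  \<open>x\<close>, those to the right already at \<open>x'\<close>.\<close>

lemma shift_prod_diff:
  "shift_prod cs x' - shift_prod cs x =
     (\<Sum>k<length cs. shift_prod (take k cs) x ** (x' - x) ** shift_prod (drop (Suc k) cs) x')"
proof (induction cs)
  case (Cons c cs)
  have "shift_prod (c # cs) x' - shift_prod (c # cs) x =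
      (x' - x) ** shift_prod cs x' + (x + mat c) ** (shift_prod cs x' - shift_prod cs x)"
    by (simp add: matrix_mult_distribs)
  also have "\<dots> = (\<Sum>k<length (c # cs). shift_prod (take k (c # cs)) x ** (x' - x)
      ** shift_prod (drop (Suc k) (c # cs)) x')"
    unfolding Cons
    by (simp add: sum.lessThan_Suc_shift matrix_mult_sum matrix_mul_assoc del: sum.lessThan_Suc)
  finally show ?case .
qed simp

text \<open>The telescoping sum differs from the derivative only in the base point to the right of
  the letter; telescoping that part once more yields words with two letters.\<close>

lemma shift_prod_taylor2:
  "shift_prod cs x' - shift_prod cs x - shift_deriv cs x (x' - x) =
     (\<Sum>l<length cs. \<Sum>k<length cs - Suc l.
        shift_prod (take l cs) x ** (x' - x) **
        shift_prod (take k (drop (Suc l) cs)) x ** (x' - x) **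
        shift_prod (drop (Suc k) (drop (Suc l) cs)) x')"
proof -
  have "shift_prod cs x' - shift_prod cs x - shift_deriv cs x (x' - x) =
    (\<Sum>l<length cs. shift_prod (take l cs) x ** (x' - x) **
       (shift_prod (drop (Suc l) cs) x' - shift_prod (drop (Suc l) cs) x))"
    unfolding shift_deriv_eq_sum shift_prod_diff[of cs]
    by (simp add: sum_subtractf matrix_mult_distribs)
  also have "\<dots> = (\<Sum>l<length cs. \<Sum>k<length cs - Suc l.
        shift_prod (take l cs) x ** (x' - x) **
        shift_prod (take k (drop (Suc l) cs)) x ** (x' - x) **
        shift_prod (drop (Suc k) (drop (Suc l) cs)) x')"
    unfolding shift_prod_diff by (simp add: matrix_mult_sum matrix_mul_assoc)
  finally show ?thesis .
qed

section \<open>Words and weights in an eigenbasis\<close>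

definition cdiag :: "complex ^ 'n \<Rightarrow> complex ^ 'n ^ 'n" where
  "cdiag v = (\<chi> i j. if i = j then v $ i else 0)"

lemma diag_matrix_eq_cdiag: "diag_matrix w = cdiag (\<chi> i. of_real (w $ i))"
  by (simp add: diag_matrix_def cdiag_def vec_eq_iff)

lemma cdiag_mult_left: "(cdiag v ** A) $ i $ j = v $ i * A $ i $ j"
  by (simp add: cdiag_def matrix_matrix_mult_def if_distrib[of "\<lambda>x. x * _"] cong: if_cong)

lemma cdiag_mult_right: "(A ** cdiag v) $ i $ j = A $ i $ j * v $ j"
  by (simp add: cdiag_def matrix_matrix_mult_def if_distrib[of "\<lambda>x. _ * x"] cong: if_cong)

lemma cdiag_mult_cdiag: "cdiag u ** cdiag v = cdiag (\<chi> i. u $ i * v $ i)"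
  by (simp add: vec_eq_iff cdiag_mult_left) (simp add: cdiag_def)

lemma mat_mult_commute: "A ** mat c = mat c ** (A :: complex ^ 'n ^ 'n)"
proof -
  have *: "mat c = (cdiag (\<chi> i. c) :: complex ^ 'n ^ 'n)" by (simp add: mat_def cdiag_def vec_eq_iff)
  show ?thesis unfolding * by (simp add: vec_eq_iff cdiag_mult_left cdiag_mult_right mult.commute)
qed

definition diagonalizes :: "complex ^ 'n ^ 'n \<Rightarrow> real ^ 'n \<Rightarrow> complex ^ 'n ^ 'n \<Rightarrow> bool" where
  "diagonalizes U w x \<longleftrightarrow> unitary_matrix U \<and> x = U ** diag_matrix w ** cadjoint U"

lemma unitary_sandwich:
  assumes "unitary_matrix U"
  shows "(U ** A ** cadjoint U) ** (U ** B ** cadjoint U) = U ** (A ** B) ** cadjoint U"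
  by (metis assms matrix_mul_assoc matrix_mul_lid unitary_matrixD(1))

lemma shift_prod_diagonal:
  fixes x :: "complex ^ 'n ^ 'n"
  assumes "diagonalizes U w x"
  shows "shift_prod cs x = U ** cdiag (\<chi> i. \<Prod>c\<leftarrow>cs. of_real (w $ i) + c) ** cadjoint U"
proof (induction cs)
  case Nil
  have "cdiag (\<chi> i. 1) = (mat 1 :: complex ^ 'n ^ 'n)" by (simp add: cdiag_def mat_def vec_eq_iff)
  then show ?case
    using assms by (simp add: diagonalizes_def unitary_matrixD)
next
  case (Cons c cs)
  have U: "unitary_matrix U" using assms by (simp add: diagonalizes_def)
  have "U ** mat c ** cadjoint U = mat c ** (U ** cadjoint U)"
    by (simp add: mat_mult_commute matrix_mul_assoc)
  then have "U ** mat c ** cadjoint U = mat c"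
    by (simp add: unitary_matrixD(2)[OF U])
  then have "x + mat c = U ** (diag_matrix w + mat c) ** cadjoint U"
    using assms by (simp add: diagonalizes_def matrix_mult_distribs)
  also have "diag_matrix w + mat c = cdiag (\<chi> i. of_real (w $ i) + c)"
    by (simp add: vec_eq_iff diag_matrix_def mat_def cdiag_def)
  finally show ?case
    by (simp add: Cons unitary_sandwich[OF U] cdiag_mult_cdiag)
qed

lemma cmod_pm_shift:
  assumes "pm_shifts g cs"
  shows "cmod (\<Prod>c\<leftarrow>cs. of_real w + c) = sqrt (w\<^sup>2 + g\<^sup>2) ^ length cs"
  using assms
proof (induction cs)
  case (Cons c cs)
  then have "c = \<i> * of_real g \<or> c = - \<i> * of_real g" by (auto simp: pm_shifts_def)
  then have "cmod (of_real w + c) = sqrt (w\<^sup>2 + g\<^sup>2)" by (auto simp: cmod_def)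
  then show ?case using Cons by (simp add: norm_mult)
qed simp

lemma prod_resolvent_shifts:
  "(\<Prod>c\<leftarrow>resolvent_shifts g m. of_real w + c) = of_real ((w\<^sup>2 + g\<^sup>2) ^ m)"
proof -
  have "(of_real w + \<i> * of_real g) * (of_real w - \<i> * of_real g) = of_real (w\<^sup>2 + g\<^sup>2)"
    by (simp add: complex_eq_iff power2_eq_square)
  then show ?thesis
    by (simp add: resolvent_shifts_def prod_list_replicate power_mult_distrib[symmetric] del: of_real_add)
qed

text \<open>For self-adjoint \<open>H\<close> and positive \<open>T\<close> this is the squared
  Hilbert-Schmidt norm of T^(1/2) H, the quantity in which all word bounds are expressed.\<close>

definition quad_trace :: "complex ^ 'n ^ 'n \<Rightarrow> complex ^ 'n ^ 'n \<Rightarrow> real" where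
  "quad_trace H T = Re (trace (H ** H ** T))"

text \<open>The unitary \<open>V\<close> is free: a change of basis on the side of \<open>H\<close>
  away from the weight preserves sums of squares. With it, weights in two different eigenbases are
  expanded in the same array of entries.\<close>

lemma quad_trace_eq:
  fixes H :: "complex ^ 'n ^ 'n"
  assumes U: "unitary_matrix U" and V: "unitary_matrix V" and H: "self_adjoint H"
  shows "quad_trace H (U ** cdiag (\<chi> i. of_real (t i)) ** cadjoint U) =
     (\<Sum>i\<in>UNIV. \<Sum>j\<in>UNIV. (cmod ((cadjoint U ** H ** V) $ i $ j))\<^sup>2 * t i)"
proof -
  define K where "K = cadjoint U ** H ** V"
  define D where "D = cdiag (\<chi> i. (of_real (t i) :: complex))"
  have "H ** H ** (U ** D ** cadjoint U) = H ** (V ** cadjoint V) ** H ** (U ** D ** cadjoint U)"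
    by (simp add: unitary_matrixD[OF V])
  also have "trace \<dots> = trace (cadjoint U ** (H ** (V ** cadjoint V) ** H ** U ** D))"
    by (subst trace_commute) (simp add: matrix_mul_assoc trace_commute[of "cadjoint U"])
  also have "cadjoint U ** (H ** (V ** cadjoint V) ** H ** U ** D) = K ** cadjoint K ** D"
    using H by (simp add: K_def cadjoint_mult matrix_mul_assoc self_adjoint_def)
  also have "trace \<dots> = (\<Sum>i\<in>UNIV. \<Sum>j\<in>UNIV. of_real ((cmod (K $ i $ j))\<^sup>2 * t i))"
    unfolding trace_def D_def cdiag_mult_right
    by (simp add: matrix_matrix_mult_def sum_distrib_right complex_norm_square del: of_real_power)
  finally show ?thesis by (simp add: quad_trace_def K_def D_def)
qed

text \<open>The weight \<open>T\<close> shares an eigenbasis with \<open>x\<close>. A majorant is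
  used in place of the power itself, since \<open>r\<close> is odd in the applications and only even
  orders are resolvent powers.\<close>

definition dominates :: "real \<Rightarrow> nat \<Rightarrow> complex ^ 'n ^ 'n \<Rightarrow> complex ^ 'n ^ 'n \<Rightarrow> bool" where
  "dominates g r T x \<longleftrightarrow> (\<exists>U w t. diagonalizes U w x \<and> T = U ** cdiag (\<chi> i. of_real (t i)) ** cadjoint U \<and>
     (\<forall>i. sqrt ((w $ i)\<^sup>2 + g\<^sup>2) ^ r \<le> t i))"

text \<open>The larger base takes over the whole product. Applied entry by entry, this separates two
  weights that belong to different eigenbases.\<close>

lemma power_mult_le_add:
  fixes a b :: real
  assumes "0 \<le> a" "0 \<le> b"
  shows "a ^ m * b ^ n \<le> a ^ (m + n) + b ^ (m + n)"
proof (cases "a \<le> b")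
  case True
  then have "a ^ m * b ^ n \<le> b ^ m * b ^ n" using assms by (intro mult_right_mono power_mono) auto
  then show ?thesis using assms by (simp add: power_add add_increasing)
next
  case False
  then have "a ^ m * b ^ n \<le> a ^ m * a ^ n" using assms by (intro mult_left_mono power_mono) auto
  then show ?thesis using assms by (simp add: power_add add_increasing2)
qed

text \<open>The longest product is split between its two neighbours so that, after Cauchy--Schwarz, each
  Hilbert--Schmidt factor carries total weight exactly \<open>r\<close>; the letter opposite to it is estimated
  in operator norm.\<close>

lemma trace_word_bound:
  fixes x1 x2 x3 H1 H2 H3 :: "complex ^ 'n ^ 'n"
  assumes g: "0 < g"
    and cs: "pm_shifts g cs1" "pm_shifts g cs2" "pm_shifts g cs3"
    and r: "r = length cs1 + length cs2 + length cs3" "2 * length cs2 \<le> r" "2 * length cs3 \<le> r"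
    and dom: "dominates g r T1 x1" "dominates g r T2 x2" "dominates g r T3 x3"
    and H: "self_adjoint H1" "self_adjoint H3" and l: "op_le l H2" "0 \<le> l"
  shows "cmod (trace (shift_prod cs1 x1 ** H1 ** shift_prod cs2 x2 ** H2 ** shift_prod cs3 x3 ** H3))
     \<le> l / 2 * (quad_trace H1 T1 + quad_trace H1 T2 + quad_trace H3 T3 + quad_trace H3 T1)"
proof -
  obtain U1 w1 t1 where 1: "diagonalizes U1 w1 x1" "T1 = U1 ** cdiag (\<chi> i. of_real (t1 i)) ** cadjoint U1"
     "\<And>i. sqrt ((w1 $ i)\<^sup>2 + g\<^sup>2) ^ r \<le> t1 i"
    using dom(1) unfolding dominates_def by blast
  obtain U2 w2 t2 where 2: "diagonalizes U2 w2 x2" "T2 = U2 ** cdiag (\<chi> i. of_real (t2 i)) ** cadjoint U2"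
     "\<And>i. sqrt ((w2 $ i)\<^sup>2 + g\<^sup>2) ^ r \<le> t2 i"
    using dom(2) unfolding dominates_def by blast
  obtain U3 w3 t3 where 3: "diagonalizes U3 w3 x3" "T3 = U3 ** cdiag (\<chi> i. of_real (t3 i)) ** cadjoint U3"
     "\<And>i. sqrt ((w3 $ i)\<^sup>2 + g\<^sup>2) ^ r \<le> t3 i"
    using dom(3) unfolding dominates_def by blast
  note U = 1(1)[unfolded diagonalizes_def, THEN conjunct1] 2(1)[unfolded diagonalizes_def, THEN conjunct1]
    3(1)[unfolded diagonalizes_def, THEN conjunct1]
  define a where "a w i = sqrt ((w $ i)\<^sup>2 + g\<^sup>2)" for w :: "real ^ 'n" and i
  have a: "0 < a w i" for w i using g by (simp add: a_def add_nonneg_pos)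
  define p where "p cs w = (\<chi> i. \<Prod>c\<leftarrow>cs. (of_real (w $ i) + c :: complex))" for cs and w :: "real ^ 'n"
  have p: "cmod (p cs w $ i) = a w i ^ length cs" if "pm_shifts g cs" for cs w i
    using cmod_pm_shift[OF that] by (simp add: p_def a_def)
  \<comment> \<open>A square root, since the exponent may be odd. The square of
    \<open>\<alpha>\<close> has exponent \<open>r - 2 * length cs2\<close>, which is what the
    squared factor of \<open>cs2\<close> lacks to reach \<open>r\<close>. By the length identity for
    \<open>r\<close>, the remainder \<open>\<beta>\<close> then has the exponent that
    \<open>cs3\<close> lacks.\<close>
  define \<alpha> :: "complex ^ 'n" where "\<alpha> = (\<chi> i. of_real (sqrt (a w1 i) ^ (r - 2 * length cs2)))"
  define \<beta> where "\<beta> = (\<chi> i. p cs1 w1 $ i / \<alpha> $ i)"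
  have \<alpha>0: "\<alpha> $ i \<noteq> 0" for i using a[of w1 i] by (simp add: \<alpha>_def)
  have \<alpha>: "(cmod (\<alpha> $ i))\<^sup>2 = a w1 i ^ (r - 2 * length cs2)" for i
    using a[of w1 i] by (simp add: \<alpha>_def norm_power power_mult[symmetric] mult.commute[of _ 2])
      (simp add: power_mult)
  have \<beta>: "(cmod (\<beta> $ i))\<^sup>2 = a w1 i ^ (r - 2 * length cs3)" for i
  proof -
    have "(cmod (\<beta> $ i))\<^sup>2 * a w1 i ^ (r - 2 * length cs2) = (a w1 i ^ length cs1)\<^sup>2"
      unfolding \<alpha>[symmetric] using \<alpha>0[of i] by (simp add: \<beta>_def norm_divide p[OF cs(1)] power_divide)
    also have "\<dots> = a w1 i ^ ((r - 2 * length cs3) + (r - 2 * length cs2))"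
      using r by (simp add: power_mult[symmetric]) (rule arg_cong[where f="\<lambda>n. _ ^ n"], simp)
    finally show ?thesis using a[of w1 i] by (simp add: power_add)
  qed
  have \<alpha>\<beta>: "cdiag (p cs1 w1) = cdiag \<beta> ** cdiag \<alpha>"
    using \<alpha>0 by (simp add: cdiag_mult_cdiag \<beta>_def)
  define K1 where "K1 = cadjoint U1 ** H1 ** U2"
  define K2 where "K2 = cadjoint U2 ** H2 ** U3"
  define K3 where "K3 = cadjoint U3 ** H3 ** U1"
  define B where "B = cdiag \<alpha> ** K1 ** cdiag (p cs2 w2)"
  define C where "C = cdiag (p cs3 w3) ** K3 ** cdiag \<beta>"
  note P = shift_prod_diagonal[OF 1(1), of cs1, folded p_def] shift_prod_diagonal[OF 2(1), of cs2, folded p_def]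
    shift_prod_diagonal[OF 3(1), of cs3, folded p_def]
  have "trace (shift_prod cs1 x1 ** H1 ** shift_prod cs2 x2 ** H2 ** shift_prod cs3 x3 ** H3)
      = trace (U1 ** cdiag \<beta> ** (cdiag \<alpha> ** K1 ** cdiag (p cs2 w2) ** K2 ** cdiag (p cs3 w3) ** cadjoint U3 ** H3))"
    unfolding P \<alpha>\<beta> K1_def K2_def by (simp only: matrix_mul_assoc)
  also have "\<dots> = trace (B ** (K2 ** C))"
    by (subst trace_commute) (simp only: matrix_mul_assoc B_def C_def K3_def)
  also have "cmod \<dots> \<le> norm B * norm (K2 ** C)" by (rule cmod_trace_mult_le)
  also have "\<dots> \<le> norm B * (l * norm C)"
    unfolding K2_def by (intro mult_left_mono op_le_norm_mult op_le_unitary_conj unitary_cadjoint U l) auto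
  also have "\<dots> = l * (norm B * norm C)" by simp
  also have "\<dots> \<le> l * (((norm B)\<^sup>2 + (norm C)\<^sup>2) / 2)"
    using sum_squares_bound[of "norm B" "norm C"] l(2) by (intro mult_left_mono) auto
  also have "(norm B)\<^sup>2 \<le> quad_trace H1 T1 + quad_trace H1 T2"
  proof -
    have K: "cmod ((cadjoint U2 ** H1 ** U1) $ j $ i) = cmod (K1 $ i $ j)" for i j
    proof -
      have "cadjoint U2 ** H1 ** U1 = cadjoint K1"
        using H(1) by (simp add: K1_def cadjoint_mult self_adjoint_def matrix_mul_assoc)
      then show ?thesis by simp
    qed
    have "(norm B)\<^sup>2 = (\<Sum>i\<in>UNIV. \<Sum>j\<in>UNIV. (cmod (K1 $ i $ j))\<^sup>2 * (a w1 i ^ (r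
        - 2 * length cs2) * a w2 j ^ (2 * length cs2)))"
      by (simp add: norm_matrix_sq B_def cdiag_mult_left cdiag_mult_right norm_mult power_mult_distrib \<alpha> p cs
        power_mult[symmetric] mult_ac)
    also have "\<dots> \<le> (\<Sum>i\<in>UNIV. \<Sum>j\<in>UNIV. (cmod (K1 $ i $ j))\<^sup>2 * (t1 i + t2 j))"
    proof (intro sum_mono mult_left_mono)
      fix i j
      have "a w1 i ^ (r - 2 * length cs2) * a w2 j ^ (2 * length cs2) \<le> a w1 i ^ r + a w2 j ^ r"
        using power_mult_le_add[of "a w1 i" "a w2 j" "r - 2 * length cs2" "2 * length cs2"] a r(2)
        by (simp add: less_imp_le)
      also have "\<dots> \<le> t1 i + t2 j" using 1(3) 2(3) by (intro add_mono) (auto simp: a_def)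
      finally show "a w1 i ^ (r - 2 * length cs2) * a w2 j ^ (2 * length cs2) \<le> t1 i + t2 j" .
    qed auto
    also have "\<dots> = quad_trace H1 T1 + quad_trace H1 T2"
      unfolding 1(2) 2(2) quad_trace_eq[OF U(1,2) H(1)] quad_trace_eq[OF U(2,1) H(1)] K K1_def[symmetric]
      by (subst (3) sum.swap) (simp add: sum.distrib distrib_left)
    finally show ?thesis .
  qed
  also have "(norm C)\<^sup>2 \<le> quad_trace H3 T3 + quad_trace H3 T1"
  proof -
    have K: "cmod ((cadjoint U1 ** H3 ** U3) $ j $ i) = cmod (K3 $ i $ j)" for i j
    proof -
      have "cadjoint U1 ** H3 ** U3 = cadjoint K3"
        using H(2) by (simp add: K3_def cadjoint_mult self_adjoint_def matrix_mul_assoc)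
      then show ?thesis by simp
    qed
    have "(norm C)\<^sup>2 = (\<Sum>i\<in>UNIV. \<Sum>j\<in>UNIV. (cmod (K3 $ i $ j))\<^sup>2 * (a w1 j ^ (r
        - 2 * length cs3) * a w3 i ^ (2 * length cs3)))"
      by (simp add: norm_matrix_sq C_def cdiag_mult_left cdiag_mult_right norm_mult power_mult_distrib \<beta> p cs
        power_mult[symmetric] mult_ac)
    also have "\<dots> \<le> (\<Sum>i\<in>UNIV. \<Sum>j\<in>UNIV. (cmod (K3 $ i $ j))\<^sup>2 * (t3 i + t1 j))"
    proof (intro sum_mono mult_left_mono)
      fix i j
      have "a w1 j ^ (r - 2 * length cs3) * a w3 i ^ (2 * length cs3) \<le> a w1 j ^ r + a w3 i ^ r"
        using power_mult_le_add[of "a w1 j" "a w3 i" "r - 2 * length cs3" "2 * length cs3"] a r(3)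
        by (simp add: less_imp_le)
      also have "\<dots> \<le> t3 i + t1 j" using 1(3)[of j] 3(3)[of i] by (simp add: a_def)
      finally show "a w1 j ^ (r - 2 * length cs3) * a w3 i ^ (2 * length cs3) \<le> t3 i + t1 j" .
    qed auto
    also have "\<dots> = quad_trace H3 T3 + quad_trace H3 T1"
      unfolding 1(2) 3(2) quad_trace_eq[OF U(3,1) H(2)] quad_trace_eq[OF U(1,3) H(2)] K K3_def[symmetric]
      by (subst (3) sum.swap) (simp add: sum.distrib distrib_left)
    finally show ?thesis .
  qed
  finally show ?thesis using l(2) by (simp add: mult_left_mono add.assoc)
qed

subsection \<open>Random variables with all moments\<close>

text \<open>A class closed under sums, products and linear maps that contains bounded matrices and
  Gaussian ones. Integrability of every word then follows by introduction rules.\<close>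

definition all_moments :: "'a measure \<Rightarrow> ('a \<Rightarrow> 'b::{banach, second_countable_topology}) \<Rightarrow> bool" where
  "all_moments M f \<longleftrightarrow> f \<in> borel_measurable M \<and> (\<forall>k::nat. integrable M (\<lambda>x. norm (f x) ^ k))"

lemma all_moments_measurable: "all_moments M f \<Longrightarrow> f \<in> borel_measurable M"
  by (simp add: all_moments_def)

lemma all_moments_integrable: "all_moments M f \<Longrightarrow> integrable M f"
  using integrable_norm_iff[of f M] by (auto simp: all_moments_def dest: spec[of _ 1])

lemma all_moments_dominated:
  assumes "all_moments M g" "f \<in> borel_measurable M" "\<And>x. x \<in> space M \<Longrightarrow> norm (f x) \<le> norm (g x)"
  shows "all_moments M f"
  unfolding all_moments_def
proof (intro conjI allI)
  fix k
  show "integrable M (\<lambda>x. norm (f x) ^ k)"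
  proof (rule Bochner_Integration.integrable_bound)
    show "integrable M (\<lambda>x. norm (g x) ^ k)" using assms(1) by (simp add: all_moments_def)
  qed (use assms(2,3) in \<open>auto intro!: power_mono\<close>)
qed (fact assms(2))

lemma all_moments_norm: "all_moments M f \<Longrightarrow> all_moments M (\<lambda>x. norm (f x))"
  by (auto simp: all_moments_def intro: borel_measurable_norm)

lemma all_moments_bounded:
  assumes "finite_measure M" "f \<in> borel_measurable M" "\<And>x. x \<in> space M \<Longrightarrow> norm (f x) \<le> c"
  shows "all_moments M f"
  unfolding all_moments_def
proof (intro conjI allI)
  interpret finite_measure M by fact
  fix k
  show "integrable M (\<lambda>x. norm (f x) ^ k)"
    using assms(2,3) by (intro integrable_const_bound[where B="c ^ k"]) (auto intro!: power_mono)
qed (fact assms(2))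

lemma all_moments_const: "finite_measure M \<Longrightarrow> all_moments M (\<lambda>x. c)"
  by (rule all_moments_bounded[where c="norm c"]) auto

lemma all_moments_mult_real:
  fixes f g :: "'a \<Rightarrow> real"
  assumes "all_moments M f" "all_moments M g"
  shows "all_moments M (\<lambda>x. f x * g x)"
  unfolding all_moments_def
proof (intro conjI allI)
  have [measurable]: "f \<in> borel_measurable M" "g \<in> borel_measurable M"
    using assms by (auto simp: all_moments_def)
  show "(\<lambda>x. f x * g x) \<in> borel_measurable M" by simp
  fix k
  show "integrable M (\<lambda>x. norm (f x * g x) ^ k)"
  proof (rule Bochner_Integration.integrable_bound)
    show "integrable M (\<lambda>x. norm (f x) ^ (2 * k) + norm (g x) ^ (2 * k))"
      using assms by (intro Bochner_Integration.integrable_add) (auto simp: all_moments_def)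
    have "\<bar>f x\<bar> ^ k * \<bar>g x\<bar> ^ k \<le> \<bar>f x\<bar> ^ (2 * k) + \<bar>g x\<bar> ^ (2 * k)" for x
      using power_mult_le_add[of "\<bar>f x\<bar>" "\<bar>g x\<bar>" k k] by (simp add: mult_2)
    then show "AE x in M. norm (norm (f x * g x) ^ k) \<le> norm (norm (f x) ^ (2 * k) + norm (g x) ^ (2 * k))"
      by (intro AE_I2) (simp add: abs_mult power_mult_distrib)
  qed simp
qed

lemma all_moments_add_real:
  fixes f g :: "'a \<Rightarrow> real"
  assumes "all_moments M f" "all_moments M g"
  shows "all_moments M (\<lambda>x. f x + g x)"
  unfolding all_moments_def
proof (intro conjI allI)
  have [measurable]: "f \<in> borel_measurable M" "g \<in> borel_measurable M"
    using assms by (auto simp: all_moments_def)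
  show "(\<lambda>x. f x + g x) \<in> borel_measurable M" by simp
  fix k
  show "integrable M (\<lambda>x. norm (f x + g x) ^ k)"
  proof (rule Bochner_Integration.integrable_bound)
    show "integrable M (\<lambda>x. 2 ^ k * (norm (f x) ^ k + norm (g x) ^ k))"
      using assms by (intro integrable_mult_right Bochner_Integration.integrable_add) (auto simp: all_moments_def)
    have "\<bar>f x + g x\<bar> ^ k \<le> 2 ^ k * (\<bar>f x\<bar> ^ k + \<bar>g x\<bar> ^ k)" for x
    proof -
      have "\<bar>f x + g x\<bar> ^ k \<le> (2 * max \<bar>f x\<bar> \<bar>g x\<bar>) ^ k" by (intro power_mono) auto
      also have "\<dots> \<le> 2 ^ k * (\<bar>f x\<bar> ^ k + \<bar>g x\<bar> ^ k)"
        unfolding power_mult_distrib by (intro mult_left_mono) (auto simp: max_def)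
      finally show ?thesis .
    qed
    then show "AE x in M. norm (norm (f x + g x) ^ k) \<le> norm (2 ^ k * (norm (f x) ^ k + norm (g x) ^ k))"
      by (intro AE_I2) (simp add: power_abs[symmetric] abs_mult)
  qed simp
qed

lemma all_moments_add:
  assumes "all_moments M f" "all_moments M g"
  shows "all_moments M (\<lambda>x. f x + g x)"
proof (rule all_moments_dominated)
  show "all_moments M (\<lambda>x. norm (f x) + norm (g x))"
    by (intro all_moments_add_real all_moments_norm assms)
  show "(\<lambda>x. f x + g x) \<in> borel_measurable M"
    using assms by (auto simp: all_moments_def)
qed (auto simp: norm_triangle_ineq)

lemma all_moments_linear:
  assumes "bounded_linear h" "all_moments M f"
  shows "all_moments M (\<lambda>x. h (f x))"
proof -
  interpret bounded_linear h by fact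
  obtain K where K: "\<And>a. norm (h a) \<le> norm a * K" "K > 0" using pos_bounded by blast
  have f: "f \<in> borel_measurable M" using assms(2) by (rule all_moments_measurable)
  have int: "integrable M (\<lambda>x. K ^ k * norm (f x) ^ k)" for k
    using assms(2) by (intro integrable_mult_right) (auto simp: all_moments_def)
  show ?thesis
    unfolding all_moments_def
  proof (intro conjI allI)
    show m: "(\<lambda>x. h (f x)) \<in> borel_measurable M"
      by (rule borel_measurable_continuous_on[OF _ f]) (rule linear_continuous_on[OF assms(1)])
    show "integrable M (\<lambda>x. norm (h (f x)) ^ k)" for k
    proof (rule Bochner_Integration.integrable_bound[OF int[of k]])
      have "norm (h (f x)) ^ k \<le> (K * norm (f x)) ^ k" for x
        using K(1)[of "f x"] by (intro power_mono) (auto simp: mult.commute)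
      then show "AE x in M. norm (norm (h (f x)) ^ k) \<le> norm (K ^ k * norm (f x) ^ k)"
        using K(2) by (intro AE_I2) (simp add: power_mult_distrib abs_mult)
    qed (use m in simp)
  qed
qed

lemma all_moments_bilinear:
  assumes "bounded_bilinear h" "all_moments M f" "all_moments M g"
  shows "all_moments M (\<lambda>x. h (f x) (g x))"
proof -
  interpret bounded_bilinear h by fact
  obtain K where K: "\<And>a b. norm (h a b) \<le> norm a * norm b * K" "K > 0" using pos_bounded by blast
  have [measurable]: "f \<in> borel_measurable M" "g \<in> borel_measurable M"
    using assms by (auto simp: all_moments_def)
  show ?thesis
  proof (rule all_moments_dominated)
    show "all_moments M (\<lambda>x. (norm (f x) * norm (g x)) * K)"
      using assms(2,3)
      by (intro all_moments_linear[OF bounded_linear_mult_left] all_moments_mult_real all_moments_norm)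
    show "(\<lambda>x. h (f x) (g x)) \<in> borel_measurable M"
      by (rule borel_measurable_continuous_Pair)
         (auto intro!: continuous_on continuous_intros)
  qed (use K in \<open>auto simp: abs_mult\<close>)
qed

lemma all_moments_scaleR: "all_moments M f \<Longrightarrow> all_moments M (\<lambda>x. r *\<^sub>R f x)"
  by (rule all_moments_linear[OF bounded_linear_scaleR_right])

lemma all_moments_diff:
  assumes "all_moments M f" "all_moments M g"
  shows "all_moments M (\<lambda>x. f x - g x)"
  using all_moments_add[OF assms(1) all_moments_scaleR[OF assms(2), of "-1"]] by simp

lemma all_moments_sum:
  assumes "finite_measure M" "\<And>i. i \<in> I \<Longrightarrow> all_moments M (f i)"
  shows "all_moments M (\<lambda>x. \<Sum>i\<in>I. f i x)"
  using assms(2)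
  by (induction I rule: infinite_finite_induct) (auto intro: all_moments_const all_moments_add assms(1))

lemma all_moments_matrix_mult:
  fixes f g :: "'a \<Rightarrow> complex ^ 'n ^ 'n"
  shows "all_moments M f \<Longrightarrow> all_moments M g \<Longrightarrow> all_moments M (\<lambda>x. f x ** g x)"
  by (rule all_moments_bilinear[OF bounded_bilinear_matrix_mult])

lemma all_moments_trace:
  fixes f :: "'a \<Rightarrow> complex ^ 'n ^ 'n"
  shows "all_moments M f \<Longrightarrow> all_moments M (\<lambda>x. trace (f x))"
  by (rule all_moments_linear[OF bounded_linear_trace])

lemma all_moments_Re: "all_moments M f \<Longrightarrow> all_moments M (\<lambda>x. Re (f x))"
  by (rule all_moments_linear[OF bounded_linear_Re])

lemma all_moments_shift_prod:
  assumes "finite_measure M" "all_moments M x"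
  shows "all_moments M (\<lambda>a. shift_prod cs (x a))"
  by (induction cs) (auto intro!: all_moments_matrix_mult all_moments_add all_moments_const assms)

lemma all_moments_shift_deriv:
  assumes "finite_measure M" "all_moments M x" "all_moments M H"
  shows "all_moments M (\<lambda>a. shift_deriv cs (x a) (H a))"
  by (induction cs)
     (auto intro!: all_moments_matrix_mult all_moments_add all_moments_const all_moments_shift_prod assms)

lemma all_moments_quad_trace:
  fixes f g :: "'a \<Rightarrow> complex ^ 'n ^ 'n"
  shows "all_moments M f \<Longrightarrow> all_moments M g \<Longrightarrow> all_moments M (\<lambda>x. quad_trace (f x) (g x))"
  unfolding quad_trace_def by (intro all_moments_Re all_moments_trace all_moments_matrix_mult)

lemmas all_moments_intros =
  all_moments_quad_trace all_moments_shift_deriv all_moments_shift_prod all_moments_Re all_moments_trace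
  all_moments_matrix_mult all_moments_diff all_moments_add all_moments_scaleR

lemma all_moments_fst:
  assumes "prob_space N" "all_moments M f"
  shows "all_moments (M \<Otimes>\<^sub>M N) (\<lambda>z. f (fst z))"
proof -
  interpret N: prob_space N by fact
  have f[measurable]: "f \<in> borel_measurable M" using assms by (simp add: all_moments_def)
  have "integrable (distr (M \<Otimes>\<^sub>M N) M fst) (\<lambda>x. norm (f x) ^ k)" for k
    unfolding N.distr_pair_fst using assms by (simp add: all_moments_def)
  then show ?thesis
    unfolding all_moments_def by (auto simp: integrable_distr_eq)
qed

lemma all_moments_snd:
  assumes "prob_space M" "prob_space N" "all_moments N f"
  shows "all_moments (M \<Otimes>\<^sub>M N) (\<lambda>z. f (snd z))"
proof -
  interpret M: prob_space M by fact
  interpret N: prob_space N by fact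
  interpret pair_sigma_finite N M ..
  have f[measurable]: "f \<in> borel_measurable N" using assms by (simp add: all_moments_def)
  have "integrable (N \<Otimes>\<^sub>M M) (\<lambda>z. norm (f (fst z)) ^ k)" for k
    using all_moments_fst[OF assms(1,3)] by (simp add: all_moments_def)
  from integrable_product_swap[OF this] show ?thesis
    unfolding all_moments_def by (auto simp: case_prod_unfold)
qed

subsection \<open>Resolvent weights\<close>

lemma self_adjoint_add: "self_adjoint A \<Longrightarrow> self_adjoint B \<Longrightarrow> self_adjoint (A + B)"
  and self_adjoint_diff: "self_adjoint A \<Longrightarrow> self_adjoint B \<Longrightarrow> self_adjoint (A - B)"
  and self_adjoint_scaleR: "self_adjoint A \<Longrightarrow> self_adjoint (r *\<^sub>R A)"
  by (simp_all add: self_adjoint_def cadjoint_add cadjoint_diff cadjoint_scaleR)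

abbreviation resolvent_pow :: "real \<Rightarrow> nat \<Rightarrow> complex ^ 'n ^ 'n \<Rightarrow> complex ^ 'n ^ 'n" where
  "resolvent_pow g m x \<equiv> shift_prod (resolvent_shifts g m) x"

definition real_conj :: "complex ^ 'n ^ 'n \<Rightarrow> ('n \<Rightarrow> real) \<Rightarrow> complex ^ 'n ^ 'n" where
  "real_conj U t = U ** cdiag (\<chi> i. of_real (t i)) ** cadjoint U"

lemma real_conj_add: "real_conj U s + real_conj U t = real_conj U (\<lambda>i. s i + t i)"
proof -
  have "cdiag (\<chi> i. of_real (s i + t i)) = cdiag (\<chi> i. of_real (s i)) + cdiag (\<chi> i. of_real (t i))"
    by (simp add: cdiag_def vec_eq_iff)
  then show ?thesis by (simp add: real_conj_def matrix_mult_distribs)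
qed

lemma real_conj_scaleR: "r *\<^sub>R real_conj U t = real_conj U (\<lambda>i. r * t i)"
proof -
  have "cdiag (\<chi> i. of_real (r * t i)) = r *\<^sub>R cdiag (\<chi> i. of_real (t i))"
    by (simp add: cdiag_def vec_eq_iff) (simp add: scaleR_conv_of_real)
  then show ?thesis by (simp add: real_conj_def matrix_mult_distribs)
qed

lemma resolvent_pow_diagonal:
  "diagonalizes U w x \<Longrightarrow> resolvent_pow g m x = real_conj U (\<lambda>i. ((w $ i)\<^sup>2 + g\<^sup>2) ^ m)"
  unfolding real_conj_def by (simp add: shift_prod_diagonal prod_resolvent_shifts)

text \<open>Each factor has modulus at least \<open>g\<close>, so raising an odd order by one costs
  \<open>1 / g\<close>.\<close>

lemma dominates_resolvent_odd:
  assumes "self_adjoint x" "0 < g" "0 < m"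
  shows "dominates g (2 * m - 1) ((1 / g) *\<^sub>R resolvent_pow g m x) x"
proof -
  obtain U w where U: "diagonalizes U w x"
    using self_adjoint_diagonalization[OF assms(1)] by (auto simp: diagonalizes_def)
  have bnd: "sqrt ((w $ i)\<^sup>2 + g\<^sup>2) ^ (2 * m - 1) \<le> (1 / g) * ((w $ i)\<^sup>2 + g\<^sup>2) ^ m" for i
  proof -
    define a where "a = sqrt ((w $ i)\<^sup>2 + g\<^sup>2)"
    have a: "g \<le> a" using assms(2) by (auto simp: a_def intro!: real_le_rsqrt)
    have "a\<^sup>2 = (w $ i)\<^sup>2 + g\<^sup>2" by (simp add: a_def)
    then have "((w $ i)\<^sup>2 + g\<^sup>2) ^ m = a ^ (2 * m)" by (metis power_mult)
    also have "\<dots> = a * a ^ (2 * m - 1)" using assms(3) by (subst power_Suc[symmetric]) simp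
    also have "\<dots> \<ge> g * a ^ (2 * m - 1)" using a assms(2) by (intro mult_right_mono) auto
    finally show ?thesis using assms(2) by (simp add: a_def field_simps)
  qed
  show ?thesis
    unfolding dominates_def resolvent_pow_diagonal[OF U] real_conj_scaleR
    by (intro exI conjI, rule U, rule real_conj_def, rule allI, rule bnd)
qed

text \<open>From 2 h a <= a^2 + h^2: the odd order \<open>2 * p - 3\<close> lies between its even
  neighbours. The parameter \<open>h\<close> is later the regularized norm itself, where the bounds
  for the two terms balance.\<close>

lemma dominates_resolvent_mean:
  assumes "self_adjoint x" "0 < h" "2 \<le> p"
  shows "dominates g (2 * p - 3)
    ((1 / (2 * h)) *\<^sub>R resolvent_pow g (p - 1) x + (h / 2) *\<^sub>R resolvent_pow g (p - 2) x) x"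
proof -
  obtain U w where U: "diagonalizes U w x"
    using self_adjoint_diagonalization[OF assms(1)] by (auto simp: diagonalizes_def)
  have bnd: "sqrt ((w $ i)\<^sup>2 + g\<^sup>2) ^ (2 * p - 3)
      \<le> (1 / (2 * h)) * ((w $ i)\<^sup>2 + g\<^sup>2) ^ (p - 1) + (h / 2) * ((w $ i)\<^sup>2 + g\<^sup>2) ^ (p - 2)" for i
  proof -
    define a where "a = sqrt ((w $ i)\<^sup>2 + g\<^sup>2)"
    have a0: "\<bar>a\<bar> = a" by (simp add: a_def)
    have a2: "a\<^sup>2 = (w $ i)\<^sup>2 + g\<^sup>2" by (simp add: a_def)
    obtain k where k: "p = k + 2" using assms(3) by (metis le_Suc_ex add.commute)
    have "2 * h * a ^ (2 * p - 3) = a ^ (2 * k) * (2 * h * a)"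
      by (simp add: k)
    also have "\<dots> \<le> a ^ (2 * k) * (a\<^sup>2 + h\<^sup>2)"
      using sum_squares_bound[of h a] by (intro mult_left_mono) (auto simp: a_def)
    also have "\<dots> = a ^ (2 * (k + 1)) + h\<^sup>2 * a ^ (2 * k)"
      by (simp add: algebra_simps power2_eq_square)
    finally show ?thesis
      unfolding a2[symmetric] power_mult[symmetric] a_def[symmetric]
      using assms(2) by (simp add: k field_simps power2_eq_square a0)
  qed
  show ?thesis
    unfolding dominates_def resolvent_pow_diagonal[OF U] real_conj_scaleR real_conj_add
    by (intro exI conjI, rule U, rule real_conj_def, rule allI, rule bnd)
qed

lemma quad_trace_resolvent_nonneg:
  assumes "self_adjoint x" "self_adjoint H"
  shows "0 \<le> quad_trace H (resolvent_pow g m x)"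
proof -
  obtain U w where U: "diagonalizes U w x"
    using self_adjoint_diagonalization[OF assms(1)] by (auto simp: diagonalizes_def)
  then have "unitary_matrix U" by (simp add: diagonalizes_def)
  then show ?thesis
    unfolding resolvent_pow_diagonal[OF U] real_conj_def quad_trace_eq[OF \<open>unitary_matrix U\<close> \<open>unitary_matrix U\<close> assms(2)]
    by (intro sum_nonneg mult_nonneg_nonneg) auto
qed

lemma quad_trace_add_right: "quad_trace H (S + T) = quad_trace H S + quad_trace H T"
  and quad_trace_scaleR_right: "quad_trace H (r *\<^sub>R T) = r * quad_trace H T"
  and quad_trace_diff_right: "quad_trace H (S - T) = quad_trace H S - quad_trace H T"
  by (simp_all add: quad_trace_def matrix_mult_distribs trace_add' trace_scaleR trace_diff')

subsection \<open>Exchanging one summand for an independent copy\<close>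

lemma integral_trace_mult_right:
  fixes f :: "'a \<Rightarrow> complex ^ 'n ^ 'n"
  assumes "integrable M f"
  shows "(\<integral>x. trace (C ** f x) \<partial>M) = trace (C ** (\<integral>x. f x \<partial>M))"
  by (rule integral_bounded_linear[OF _ assms])
     (intro bounded_linear_compose[OF bounded_linear_trace] bounded_bilinear.bounded_linear_right
       bounded_bilinear_matrix_mult)

text \<open>\<open>ya\<close> and \<open>yb\<close> are independent copies of \<open>y\<close>, independent of \<open>w\<close>; \<open>xa\<close> and \<open>xb\<close> differ only in
  the copy that is used, so \<open>yb\<close> is independent of \<open>xa\<close>.\<close>

locale exchange =
  A: prob_space A + B: prob_space B for A :: "'a measure" and B :: "'b measure" +
  fixes w :: "'a \<Rightarrow> complex ^ 'n ^ 'n" and y :: "'b \<Rightarrow> complex ^ 'n ^ 'n" and s l g :: real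
  assumes w: "all_moments A w" "\<And>a. a \<in> space A \<Longrightarrow> self_adjoint (w a)"
    and y: "y \<in> borel_measurable B" "\<And>b. b \<in> space B \<Longrightarrow> self_adjoint (y b)"
      "\<And>b. b \<in> space B \<Longrightarrow> op_le l (y b)" "(\<integral>b. y b \<partial>B) = 0"
    and pos: "0 \<le> s" "s \<le> 1" "0 \<le> l" "0 < g"
begin

definition T :: "('a \<times> 'b \<times> 'b) measure" where "T = A \<Otimes>\<^sub>M (B \<Otimes>\<^sub>M B)"

definition ya :: "'a \<times> 'b \<times> 'b \<Rightarrow> complex ^ 'n ^ 'n" where "ya z = y (fst (snd z))"
definition yb :: "'a \<times> 'b \<times> 'b \<Rightarrow> complex ^ 'n ^ 'n" where "yb z = y (snd (snd z))"
definition xa :: "'a \<times> 'b \<times> 'b \<Rightarrow> complex ^ 'n ^ 'n" where "xa z = w (fst z) + s *\<^sub>R ya z"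
definition xb :: "'a \<times> 'b \<times> 'b \<Rightarrow> complex ^ 'n ^ 'n" where "xb z = w (fst z) + s *\<^sub>R yb z"
definition dl :: "'a \<times> 'b \<times> 'b \<Rightarrow> complex ^ 'n ^ 'n" where "dl z = yb z - ya z"

sublocale BB: pair_prob_space B B ..
sublocale ABB: pair_prob_space A "B \<Otimes>\<^sub>M B" ..

lemma BB_prob: "prob_space (B \<Otimes>\<^sub>M B)" by unfold_locales

lemma T_prob: "prob_space T" unfolding T_def by unfold_locales
lemma T_fin: "finite_measure T" using T_prob by (simp add: prob_space_def)

lemma am_y: "all_moments B y"
proof (rule all_moments_bounded)
  show "norm (y b) \<le> l * norm (mat 1 :: complex ^ 'n ^ 'n)" if "b \<in> space B" for b
    using op_le_norm_mult[OF y(3)[OF that] pos(3), of "mat 1"] by simp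
qed (use y(1) in \<open>auto intro: B.finite_measure_axioms\<close>)

lemma am_w: "all_moments T (\<lambda>z. w (fst z))"
  unfolding T_def by (intro all_moments_fst w BB_prob)

lemma am_ya: "all_moments T ya"
  unfolding T_def ya_def
  by (intro all_moments_snd[where f="\<lambda>b. y (fst b)"] all_moments_fst am_y BB_prob
      A.prob_space_axioms B.prob_space_axioms)

lemma am_yb: "all_moments T yb"
  unfolding T_def yb_def
  by (intro all_moments_snd[where f="\<lambda>b. y (snd b)"] all_moments_snd am_y BB_prob
      A.prob_space_axioms B.prob_space_axioms)

lemma am_xa: "all_moments T xa" and am_xb: "all_moments T xb" and am_dl: "all_moments T dl"
  unfolding xa_def xb_def dl_def by (intro all_moments_intros am_w am_ya am_yb)+

lemmas am = all_moments_intros am_ya am_yb am_xa am_xb am_dl T_fin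

lemma space_T: "z \<in> space T \<Longrightarrow> fst z \<in> space A \<and> fst (snd z) \<in> space B \<and> snd (snd z) \<in> space B"
  by (auto simp: T_def space_pair_measure)

lemma sa:
  assumes "z \<in> space T"
  shows "self_adjoint (ya z)" "self_adjoint (yb z)" "self_adjoint (xa z)" "self_adjoint (xb z)" "self_adjoint (dl z)"
  using space_T[OF assms]
  by (auto simp: ya_def yb_def xa_def xb_def dl_def intro!: self_adjoint_add self_adjoint_diff
      self_adjoint_scaleR w y)

lemma opl:
  assumes "z \<in> space T"
  shows "op_le l (yb z)" "op_le (2 * l) (dl z)"
proof -
  have "op_le l (y (fst (snd z)))" "op_le l (y (snd (snd z)))"
    using space_T[OF assms] by (auto intro: y(3))
  then show "op_le l (yb z)" "op_le (2 * l) (dl z)"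
    using op_le_diff[of l "y (snd (snd z))" l "y (fst (snd z))"] by (simp_all add: yb_def dl_def ya_def)
qed

text \<open>The swap of the two copies preserves the measure; it is used because it interchanges
  \<open>xa\<close> with \<open>xb\<close>.\<close>

lemma integral_swap:
  fixes f :: "'a \<times> 'b \<times> 'b \<Rightarrow> 'c::{banach, second_countable_topology}"
  assumes "integrable T f"
  shows "(\<integral>z. f (fst z, snd (snd z), fst (snd z)) \<partial>T) = (\<integral>z. f z \<partial>T)"
proof -
  have [measurable]: "f \<in> borel_measurable (A \<Otimes>\<^sub>M (B \<Otimes>\<^sub>M B))"
    using assms by (auto simp: T_def)
  define \<tau> :: "'a \<times> 'b \<times> 'b \<Rightarrow> 'a \<times> 'b \<times> 'b" where "\<tau> = (\<lambda>z. (fst z, snd (snd z), fst (snd z)))"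
  have \<tau>: "\<tau> \<in> measurable T T" unfolding \<tau>_def T_def by measurable
  have "distr T T \<tau> = T"
  proof -
    have *: "distr (A \<Otimes>\<^sub>M (B \<Otimes>\<^sub>M B)) (A \<Otimes>\<^sub>M (B \<Otimes>\<^sub>M B)) (\<lambda>(x, y). (x, (\<lambda>(u, v). (v, u)) y))
      = distr A A (\<lambda>x. x) \<Otimes>\<^sub>M distr (B \<Otimes>\<^sub>M B) (B \<Otimes>\<^sub>M B) (\<lambda>(u, v). (v, u))"
      by (rule pair_measure_distr[symmetric])
         (auto simp: BB.distr_pair_swap[symmetric] intro: prob_space_imp_sigma_finite BB_prob)
    have "\<tau> = (\<lambda>(x, y). (x, (\<lambda>(u, v). (v, u)) y))" by (auto simp: \<tau>_def)
    then show ?thesis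
      unfolding T_def using * BB.distr_pair_swap by (simp add: distr_id2)
  qed
  then have "(\<integral>z. f z \<partial>T) = (\<integral>z. f z \<partial>(distr T T \<tau>))" by simp
  also have "\<dots> = (\<integral>z. f (\<tau> z) \<partial>T)"
    by (rule integral_distr[OF \<tau>]) (simp add: T_def)
  finally show ?thesis by (simp add: \<tau>_def)
qed

text \<open>The second copy is integrated first. Since \<open>Q\<close> does not involve it, only
  its mean enters.\<close>

lemma integral_linear_yb:
  assumes "all_moments T (\<lambda>z. Q (fst z) (fst (snd z)))"
  shows "(\<integral>z. trace (Q (fst z) (fst (snd z)) ** yb z) \<partial>T) = 0"
proof -
  define f where "f z = trace (Q (fst z) (fst (snd z)) ** yb z)" for z
  have int: "integrable (A \<Otimes>\<^sub>M (B \<Otimes>\<^sub>M B)) f"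
    unfolding f_def T_def[symmetric] by (intro all_moments_integrable am assms)
  have "(\<integral>z. f z \<partial>T) = (\<integral>a. (\<integral>c. f (a, c) \<partial>(B \<Otimes>\<^sub>M B)) \<partial>A)"
    unfolding T_def by (rule ABB.integral_fst'[OF int, symmetric])
  also have "\<dots> = (\<integral>a. 0 \<partial>A)"
  proof (rule integral_cong_AE)
    show "(\<lambda>a. \<integral>c. f (a, c) \<partial>(B \<Otimes>\<^sub>M B)) \<in> borel_measurable A"
      using ABB.integrable_fst'[OF int] by simp
    show "AE a in A. (\<integral>c. f (a, c) \<partial>(B \<Otimes>\<^sub>M B)) = 0"
      using ABB.AE_integrable_fst'[OF int]
    proof eventually_elim
      case (elim a)
      have "(\<integral>c. f (a, c) \<partial>(B \<Otimes>\<^sub>M B)) = (\<integral>b. (\<integral>b'. f (a, b, b') \<partial>B) \<partial>B)"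
        by (rule BB.integral_fst'[OF elim, symmetric])
      also have "\<dots> = (\<integral>b. 0 \<partial>B)"
        unfolding f_def yb_def using y(4)
        by (simp add: integral_trace_mult_right[OF all_moments_integrable[OF am_y]])
      finally show ?case by simp
    qed
  qed simp
  finally show ?thesis by (simp add: f_def)
qed

text \<open>In \<open>q\<close> the letter also occurs inside the weight; in \<open>q'\<close> it is
  independent of the weight. Only in \<open>q'\<close> does the letter enter through its second
  moments alone, so all bounds have to end in \<open>q'\<close>.\<close>

definition q :: "nat \<Rightarrow> real" where "q m = (\<integral>z. quad_trace (ya z) (resolvent_pow g m (xa z)) \<partial>T)"
definition q' :: "nat \<Rightarrow> real" where "q' m = (\<integral>z. quad_trace (yb z) (resolvent_pow g m (xa z)) \<partial>T)"

lemma q_nonneg: "0 \<le> q m" "0 \<le> q' m"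
  unfolding q_def q'_def by (auto intro!: integral_nonneg_AE quad_trace_resolvent_nonneg sa)

lemma q_swap:
  "(\<integral>z. quad_trace (yb z) (resolvent_pow g m (xb z)) \<partial>T) = q m"
  "(\<integral>z. quad_trace (ya z) (resolvent_pow g m (xb z)) \<partial>T) = q' m"
proof -
  have eq: "yb z = ya (fst z, snd (snd z), fst (snd z))" "ya z = yb (fst z, snd (snd z), fst (snd z))"
     "xb z = xa (fst z, snd (snd z), fst (snd z))" for z
    by (simp_all add: ya_def yb_def xa_def xb_def)
  show "(\<integral>z. quad_trace (yb z) (resolvent_pow g m (xb z)) \<partial>T) = q m"
    unfolding q_def eq(1,3) 
    by (rule integral_swap[where f="\<lambda>z. quad_trace (ya z) (resolvent_pow g m (xa z))"])
       (intro all_moments_integrable am)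
  show "(\<integral>z. quad_trace (ya z) (resolvent_pow g m (xb z)) \<partial>T) = q' m"
    unfolding q'_def eq(2,3)
    by (rule integral_swap[where f="\<lambda>z. quad_trace (yb z) (resolvent_pow g m (xa z))"])
       (intro all_moments_integrable am)
qed

lemma quad_trace_diff:
  "quad_trace (H - K) S = quad_trace H S + quad_trace K S - Re (trace (K ** S ** H)) - Re (trace (S ** K ** H))"
proof -
  have "trace (H ** K ** S) = trace (K ** S ** H)" "trace (K ** H ** S) = trace (S ** K ** H)"
    using trace_commute[of H "K ** S"] trace_commute[of "K ** H" S] trace_commute[of "S ** K" H]
      trace_commute[of K "H ** S"] trace_commute[of "K" "S ** H"] trace_commute[of S "K ** H"]
    by (simp_all add: matrix_mul_assoc)
  then show ?thesis
    by (simp add: quad_trace_def matrix_mult_distribs trace_diff')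
qed

text \<open>The cross terms of the square are linear in \<open>yb\<close> with a weight at
  \<open>xa\<close>, so they integrate to zero. The weight at \<open>xb\<close> follows by the swap,
  which only changes the sign of \<open>dl\<close>.\<close>

lemma q_dl:
  "(\<integral>z. quad_trace (dl z) (resolvent_pow g m (xa z)) \<partial>T) = q m + q' m"
  "(\<integral>z. quad_trace (dl z) (resolvent_pow g m (xb z)) \<partial>T) = q m + q' m"
proof -
  have 1: "(\<integral>z. trace (ya z ** resolvent_pow g m (xa z) ** yb z) \<partial>T) = 0"
    unfolding xa_def ya_def
    by (rule integral_linear_yb) (unfold ya_def[symmetric] xa_def[symmetric], intro am)
  have 2: "(\<integral>z. trace (resolvent_pow g m (xa z) ** ya z ** yb z) \<partial>T) = 0"
    unfolding xa_def ya_def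
    by (rule integral_linear_yb) (unfold ya_def[symmetric] xa_def[symmetric], intro am)
  have Re: "(\<integral>z. Re (f z) \<partial>T) = Re (\<integral>z. f z \<partial>T)" if "all_moments T f" for f
    by (rule integral_Re[OF all_moments_integrable[OF that]])
  show *: "(\<integral>z. quad_trace (dl z) (resolvent_pow g m (xa z)) \<partial>T) = q m + q' m"
    unfolding dl_def quad_trace_diff
    by (subst Bochner_Integration.integral_diff Bochner_Integration.integral_add,
        (intro all_moments_integrable am)+)+
       (simp add: Re am 1 2 q_def q'_def)
  have eq: "quad_trace (dl z) S = quad_trace (dl (fst z, snd (snd z), fst (snd z))) S" for z S
    by (simp add: dl_def ya_def yb_def quad_trace_def matrix_mult_distribs trace_diff' algebra_simps)
  have eq': "xb z = xa (fst z, snd (snd z), fst (snd z))" for z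
    by (simp add: ya_def yb_def xa_def xb_def)
  show "(\<integral>z. quad_trace (dl z) (resolvent_pow g m (xb z)) \<partial>T) = q m + q' m"
    using integral_swap[where f="\<lambda>z. quad_trace (dl z) (resolvent_pow g m (xa z))"]
    by (simp only: * eq' eq[symmetric] all_moments_integrable am)
qed

end

section \<open>Bounds for expected words\<close>

context exchange
begin

text \<open>Two resolvent powers in \<open>\<Theta>\<close> cover both kinds of weight in use. At
  \<open>xb\<close> the letter \<open>yb\<close> sits inside the weight and yields \<open>Q\<close>;
  at \<open>xa\<close> it is independent and yields \<open>Q'\<close>; \<open>dl\<close> yields
  their sum at either point.\<close>

lemma integral_word_bound:
  fixes \<alpha> \<beta> :: real and m1 m2 :: nat
  defines "\<Theta> \<equiv> (\<lambda>x :: complex ^ 'n ^ 'n. \<alpha> *\<^sub>R resolvent_pow g m1 x + \<beta> *\<^sub>R resolvent_pow g m2 x)"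
  defines "Q \<equiv> \<alpha> * q m1 + \<beta> * q m2" and "Q' \<equiv> \<alpha> * q' m1 + \<beta> * q' m2"
  assumes f: "all_moments T f"
    and le: "\<And>z. z \<in> space T \<Longrightarrow> cmod (f z) \<le> c1 * quad_trace (dl z) (\<Theta> (xa z)) + c2 * quad_trace (dl z) (\<Theta> (xb z))
        + c3 * quad_trace (yb z) (\<Theta> (xa z)) + c4 * quad_trace (yb z) (\<Theta> (xb z))"
  shows "cmod (\<integral>z. f z \<partial>T) \<le> (c1 + c2) * (Q + Q') + c3 * Q' + c4 * Q"
proof -
  have int: "integrable T (\<lambda>z. quad_trace (dl z) (\<Theta> (xa z)))" "integrable T (\<lambda>z. quad_trace (dl z) (\<Theta> (xb z)))"
     "integrable T (\<lambda>z. quad_trace (yb z) (\<Theta> (xa z)))" "integrable T (\<lambda>z. quad_trace (yb z) (\<Theta> (xb z)))"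
    unfolding \<Theta>_def by (intro all_moments_integrable am)+
  have sp: "(\<integral>z. quad_trace (H z) (\<Theta> (x z)) \<partial>T) =
      \<alpha> * (\<integral>z. quad_trace (H z) (resolvent_pow g m1 (x z)) \<partial>T)
          + \<beta> * (\<integral>z. quad_trace (H z) (resolvent_pow g m2 (x z)) \<partial>T)"
    if "all_moments T H" "all_moments T x" for H x
    unfolding \<Theta>_def quad_trace_add_right quad_trace_scaleR_right
    by (subst Bochner_Integration.integral_add)
       (auto intro!: integrable_mult_right all_moments_integrable am that)
  have "cmod (\<integral>z. f z \<partial>T) \<le> (\<integral>z. cmod (f z) \<partial>T)" by (rule integral_norm_bound)
  also have "\<dots> \<le> (\<integral>z. c1 * quad_trace (dl z) (\<Theta> (xa z)) + c2 * quad_trace (dl z) (\<Theta> (xb z))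
        + c3 * quad_trace (yb z) (\<Theta> (xa z)) + c4 * quad_trace (yb z) (\<Theta> (xb z)) \<partial>T)"
    by (intro integral_mono le Bochner_Integration.integrable_add integrable_mult_right int
      all_moments_integrable[OF all_moments_norm[OF f]])
  also have "\<dots> = c1 * (\<integral>z. quad_trace (dl z) (\<Theta> (xa z)) \<partial>T) + c2 * (\<integral>z. quad_trace (dl z) (\<Theta> (xb z)) \<partial>T)
        + c3 * (\<integral>z. quad_trace (yb z) (\<Theta> (xa z)) \<partial>T) + c4 * (\<integral>z. quad_trace (yb z) (\<Theta> (xb z)) \<partial>T)"
    by (simp add: int)
  also have "(\<integral>z. quad_trace (dl z) (\<Theta> (xa z)) \<partial>T) = Q + Q'"
    by (simp add: sp am q_dl Q_def Q'_def distrib_left)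
  also have "(\<integral>z. quad_trace (dl z) (\<Theta> (xb z)) \<partial>T) = Q + Q'"
    by (simp add: sp am q_dl Q_def Q'_def distrib_left)
  also have "(\<integral>z. quad_trace (yb z) (\<Theta> (xa z)) \<partial>T) = Q'"
    by (simp add: sp am q'_def Q'_def)
  also have "(\<integral>z. quad_trace (yb z) (\<Theta> (xb z)) \<partial>T) = Q"
    by (simp add: sp am q_swap Q_def)
  finally show ?thesis by (simp add: algebra_simps)
qed

lemma diff_x: "xb z - xa z = s *\<^sub>R dl z"
  by (simp add: xa_def xb_def dl_def scaleR_diff_right)

text \<open>After a swap both numbers have the letter \<open>yb\<close>, and they differ only by
  \<open>xb\<close> or \<open>xa\<close> in the weight. Telescoping gives \<open>2 * m\<close> words
  with the letters \<open>yb\<close>, \<open>yb\<close>, \<open>dl\<close>, each at most 3/2 l/g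
  times the sum.\<close>

lemma q_diff_bound:
  shows "\<bar>q m - q' m\<bar> \<le> 3 * real m * l / g * (q m + q' m)"
proof (cases "m = 0")
  case True
  have "quad_trace (yb z) (resolvent_pow g 0 (xa z)) = quad_trace (yb z) (resolvent_pow g 0 (xb z))" for z
    by (simp add: resolvent_shifts_def)
  then have "q' 0 = q 0" unfolding q'_def q_swap(1)[symmetric] by simp
  with True show ?thesis by simp
next
  case False
  define cs where "cs = resolvent_shifts g m"
  define W where "W k z = trace (yb z ** yb z ** (shift_prod (take k cs) (xa z) ** dl z
      ** shift_prod (drop (Suc k) cs) (xb z)))" for k z
  have amW: "all_moments T (W k)" for k unfolding W_def by (intro am)
  have W: "cmod (\<integral>z. W k z \<partial>T) \<le> 3 / 2 * l / g * (q m + q' m)" if k: "k < 2 * m" for k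
  proof -
    \<comment> \<open>The zero coefficient fits the odd weight into the two-term form of
      \<open>integral_word_bound\<close>.\<close>
    define \<Theta> where "\<Theta> = (\<lambda>x :: complex ^ 'n ^ 'n. (1 / g) *\<^sub>R resolvent_pow g m x + 0 *\<^sub>R resolvent_pow g 0 x)"
    have len: "length (take k cs) = k" "length (drop (Suc k) cs) = 2 * m - Suc k"
      using k by (auto simp: cs_def)
    have pm: "pm_shifts g (take k cs)" "pm_shifts g (drop (Suc k) cs)" "pm_shifts g []"
      by (auto simp: cs_def intro: pm_shifts_take_drop)
    have "cmod (W k z) \<le> l / 2 * quad_trace (dl z) (\<Theta> (xa z)) + l / 2 * quad_trace (dl z) (\<Theta> (xb z))
        + l / 2 * quad_trace (yb z) (\<Theta> (xa z)) + l / 2 * quad_trace (yb z) (\<Theta> (xb z))"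
      if z: "z \<in> space T" for z
    proof -
      have dom: "dominates g (2 * m - 1) (\<Theta> (xa z)) (xa z)" "dominates g (2 * m - 1) (\<Theta> (xb z)) (xb z)"
        using dominates_resolvent_odd[OF sa(3)[OF z] pos(4), of m] dominates_resolvent_odd[OF sa(4)[OF z]
            pos(4), of m] False
        by (auto simp: \<Theta>_def)
      \<comment> \<open>The longer of the two pieces is rotated to the front; the empty word between
        the two letters \<open>yb\<close> is always short.\<close>
      show ?thesis
      proof (cases "2 * k \<le> 2 * m - 1")
        case True
        \<comment> \<open>The empty word may be placed at either base point. Taking
          \<open>xa\<close> here and \<open>xb\<close> in the other case produces the same four
          terms.\<close>
        have W_eq: "W k z = trace (shift_prod (drop (Suc k) cs) (xb z) ** yb z ** shift_prod [] (xa z) ** yb z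
            ** shift_prod (take k cs) (xa z) ** dl z)"
          unfolding W_def
          using trace_commute[of "yb z ** yb z ** shift_prod (take k cs) (xa z)
              ** dl z" "shift_prod (drop (Suc k) cs) (xb z)"]
          by (simp add: matrix_mul_assoc)
        have "cmod (W k z) \<le> l / 2 * (quad_trace (yb z) (\<Theta> (xb z)) + quad_trace (yb z) (\<Theta> (xa z))
            + quad_trace (dl z) (\<Theta> (xa z)) + quad_trace (dl z) (\<Theta> (xb z)))"
          unfolding W_eq
          by (rule trace_word_bound[OF pos(4) pm(2,3,1) _ _ _ dom(2,1,1) sa(2,5)[OF z] opl(1)[OF z] pos(3)],
              unfold len list.size)
             (use True k in auto)
        then show ?thesis by (simp add: algebra_simps)
      next
        case False
        have W_eq: "W k z = trace (shift_prod (take k cs) (xa z) ** dl z ** shift_prod (drop (Suc k) cs) (xb z)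
            ** yb z ** shift_prod [] (xb z) ** yb z)"
          unfolding W_def
          using trace_commute[of "yb z ** yb z" "shift_prod (take k cs) (xa z) ** dl z
              ** shift_prod (drop (Suc k) cs) (xb z)"]
          by (simp add: matrix_mul_assoc)
        have "cmod (W k z) \<le> l / 2 * (quad_trace (dl z) (\<Theta> (xa z)) + quad_trace (dl z) (\<Theta> (xb z))
            + quad_trace (yb z) (\<Theta> (xb z)) + quad_trace (yb z) (\<Theta> (xa z)))"
          unfolding W_eq
          by (rule trace_word_bound[OF pos(4) pm(1,2,3) _ _ _ dom(1,2,2) sa(5,2)[OF z] opl(1)[OF z] pos(3)],
              unfold len list.size)
             (use False k in auto)
        then show ?thesis by (simp add: algebra_simps)
      qed
    qed
    from integral_word_bound[OF amW this[unfolded \<Theta>_def]]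
    show ?thesis using pos by (simp add: field_simps)
  qed
  have "q m - q' m = (\<integral>z. quad_trace (yb z) (resolvent_pow g m (xb z) - resolvent_pow g m (xa z)) \<partial>T)"
    unfolding quad_trace_diff_right q'_def q_swap(1)[symmetric]
    by (rule Bochner_Integration.integral_diff[symmetric]) (intro all_moments_integrable am)+
  also have "\<dots> = (\<integral>z. (\<Sum>k<2 * m. s * Re (W k z)) \<partial>T)"
    unfolding quad_trace_def shift_prod_diff diff_x
    by (simp add: W_def cs_def matrix_mult_sum trace_sum matrix_mult_distribs trace_scaleR)
  also have "\<dots> = (\<Sum>k<2 * m. s * Re (\<integral>z. W k z \<partial>T))"
    by (subst Bochner_Integration.integral_sum)
       (auto intro!: integrable_mult_right all_moments_integrable all_moments_Re amW
         simp: integral_Re all_moments_integrable[OF amW])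
  also have "\<bar>\<dots>\<bar> \<le> (\<Sum>k<2 * m. 3 / 2 * l / g * (q m + q' m))"
  proof (rule order_trans[OF sum_abs], rule sum_mono)
    fix k assume "k \<in> {..<2 * m}"
    then have "\<bar>Re (\<integral>z. W k z \<partial>T)\<bar> \<le> 3 / 2 * l / g * (q m + q' m)"
      using W[of k] abs_Re_le_cmod[of "\<integral>z. W k z \<partial>T"] by simp
    then have "s * \<bar>Re (\<integral>z. W k z \<partial>T)\<bar> \<le> 1 * (3 / 2 * l / g * (q m + q' m))"
      by (intro mult_mono) (use pos q_nonneg in auto)
    then show "\<bar>s * Re (\<integral>z. W k z \<partial>T)\<bar> \<le> 3 / 2 * l / g * (q m + q' m)"
      using pos by (simp add: abs_mult)
  qed
  also have "\<dots> = 3 * real m * l / g * (q m + q' m)" by simp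
  finally show ?thesis .
qed

text \<open>Here the size of \<open>g\<close> is used: the factor in \<open>q_diff_bound\<close> is
  at most 3/16, rounded up to 1/4, and then \<open>q m\<close> is at most 5/3 of
  \<open>q' m\<close>.\<close>

lemma q_le_q':
  assumes "16 * real p * l \<le> g" "m \<le> p"
  shows "q m + q' m \<le> 8 / 3 * q' m"
proof -
  have "16 * real m * l \<le> 16 * real p * l"
    using assms(2) pos by (intro mult_right_mono) auto
  with assms(1) have *: "16 * real m * l \<le> g" by linarith
  have "3 * real m * l / g \<le> 1 / 4"
    using * pos by (simp add: field_simps)
  then have "3 * real m * l / g * (q m + q' m) \<le> 1 / 4 * (q m + q' m)"
    using q_nonneg by (intro mult_right_mono) (auto simp: add_nonneg_nonneg)
  with q_diff_bound[of m] show ?thesis by (simp add: abs_le_iff)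
qed

text \<open>Of three lengths at most one exceeds half of their sum; rotating the trace puts that
  word first. The middle letter after rotation is estimated in operator norm, at worst a difference
  \<open>dl\<close> with bound \<open>2 * l\<close>. Each case gives at most 3 l (Q + Q'), and
  \<open>q_le_q'\<close> turns 3 into 3 * 8/3 = 8.\<close>

lemma word_bound:
  assumes pm: "pm_shifts g as" "pm_shifts g bs" "pm_shifts g cs"
    and len: "length as + length bs + length cs = 2 * p - 3" and p: "2 \<le> p"
    and h: "0 < h" and gl: "16 * real p * l \<le> g"
  shows "cmod (\<integral>z. trace (shift_prod as (xa z) ** dl z ** shift_prod bs (xa z) ** dl z ** shift_prod cs (xb z)
      ** yb z) \<partial>T)
    \<le> 8 * l * (q' (p - 1) / (2 * h) + h / 2 * q' (p - 2))"
proof -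
  define \<Theta> where "\<Theta> = (\<lambda>x :: complex ^ 'n ^ 'n. (1 / (2 * h)) *\<^sub>R resolvent_pow g (p - 1) x
      + (h / 2) *\<^sub>R resolvent_pow g (p - 2) x)"
  define Q where "Q = (1 / (2 * h)) * q (p - 1) + (h / 2) * q (p - 2)"
  define Q' where "Q' = (1 / (2 * h)) * q' (p - 1) + (h / 2) * q' (p - 2)"
  define W where "W z = trace (shift_prod as (xa z) ** dl z ** shift_prod bs (xa z) ** dl z
      ** shift_prod cs (xb z) ** yb z)" for z
  have W2: "W z = trace (shift_prod bs (xa z) ** dl z ** shift_prod cs (xb z) ** yb z ** shift_prod as (xa z)
      ** dl z)" for z
    unfolding W_def using trace_commute[of "shift_prod as (xa z) ** dl z" "shift_prod bs (xa z) ** dl z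
        ** shift_prod cs (xb z) ** yb z"]
    by (simp add: matrix_mul_assoc)
  have W3: "W z = trace (shift_prod cs (xb z) ** yb z ** shift_prod as (xa z) ** dl z ** shift_prod bs (xa z)
      ** dl z)" for z
    unfolding W_def using trace_commute[of "shift_prod as (xa z) ** dl z ** shift_prod bs (xa z)
        ** dl z" "shift_prod cs (xb z) ** yb z"]
    by (simp add: matrix_mul_assoc)
  have amW: "all_moments T W" unfolding W_def by (intro am)
  have dom: "dominates g (2 * p - 3) (\<Theta> (xa z)) (xa z)" "dominates g (2 * p - 3) (\<Theta> (xb z)) (xb z)"
    if "z \<in> space T" for z
    using dominates_resolvent_mean[OF sa(3)[OF that] h p] dominates_resolvent_mean[OF sa(4)[OF that] h p]
    by (auto simp: \<Theta>_def)
  have Qn: "0 \<le> Q" "0 \<le> Q'" using h q_nonneg by (auto simp: Q_def Q'_def intro!: add_nonneg_nonneg)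
  have Qs: "Q + Q' \<le> 8 / 3 * Q'"
  proof -
    have "Q + Q' = (1 / (2 * h)) * (q (p - 1) + q' (p - 1)) + (h / 2) * (q (p - 2) + q' (p - 2))"
      by (simp add: Q_def Q'_def algebra_simps add_divide_distrib)
    also have "\<dots> \<le> (1 / (2 * h)) * (8 / 3 * q' (p - 1)) + (h / 2) * (8 / 3 * q' (p - 2))"
      using h by (intro add_mono mult_left_mono q_le_q'[OF gl]) auto
    also have "\<dots> = 8 / 3 * Q'" by (simp add: Q'_def field_simps)
    finally show ?thesis .
  qed
  have "cmod (\<integral>z. W z \<partial>T) \<le> l * (3 * (Q + Q'))"
  proof -
    consider (1) "2 * length bs \<le> 2 * p - 3" "2 * length cs \<le> 2 * p - 3"
      | (2) "2 * length cs \<le> 2 * p - 3" "2 * length as \<le> 2 * p - 3"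
      | (3) "2 * length as \<le> 2 * p - 3" "2 * length bs \<le> 2 * p - 3"
      using len by linarith
    then show ?thesis
    proof cases
      case 1
      have "cmod (W z) \<le> (2 * l) / 2 * (quad_trace (dl z) (\<Theta> (xa z)) + quad_trace (dl z) (\<Theta> (xa z))
          + quad_trace (yb z) (\<Theta> (xb z)) + quad_trace (yb z) (\<Theta> (xa z)))"
        if z: "z \<in> space T" for z
        unfolding W_def
        by (rule trace_word_bound[OF pos(4), where r="2 * p - 3"])
           (use 1 pm dom[OF z] sa[OF z] opl[OF z] pos len in auto)
      then have "cmod (W z) \<le> (2 * l) * quad_trace (dl z) (\<Theta> (xa z)) + 0 * quad_trace (dl z) (\<Theta> (xb z))
          + l * quad_trace (yb z) (\<Theta> (xa z)) + l * quad_trace (yb z) (\<Theta> (xb z))"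
        if "z \<in> space T" for z using that by (fastforce simp: algebra_simps)
      from integral_word_bound[OF amW this[unfolded \<Theta>_def], folded Q_def Q'_def]
      show ?thesis by (simp add: algebra_simps)
    next
      case 2
      have "cmod (W z) \<le> l / 2 * (quad_trace (dl z) (\<Theta> (xa z)) + quad_trace (dl z) (\<Theta> (xb z))
          + quad_trace (dl z) (\<Theta> (xa z)) + quad_trace (dl z) (\<Theta> (xa z)))"
        if z: "z \<in> space T" for z
        unfolding W2
        by (rule trace_word_bound[OF pos(4), where r="2 * p - 3"])
           (use 2 pm dom[OF z] sa[OF z] opl[OF z] pos len in auto)
      then have "cmod (W z) \<le> (3 * l / 2) * quad_trace (dl z) (\<Theta> (xa z))
          + (l / 2) * quad_trace (dl z) (\<Theta> (xb z)) + 0 * quad_trace (yb z) (\<Theta> (xa z))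
              + 0 * quad_trace (yb z) (\<Theta> (xb z))"
        if "z \<in> space T" for z using that by (fastforce simp: algebra_simps)
      from integral_word_bound[OF amW this[unfolded \<Theta>_def], folded Q_def Q'_def]
      have "cmod (\<integral>z. W z \<partial>T) \<le> 2 * (l * (Q + Q'))" by (simp add: algebra_simps)
      moreover have "0 \<le> l * (Q + Q')" using pos Qn by simp
      ultimately show ?thesis by linarith
    next
      case 3
      have "cmod (W z) \<le> (2 * l) / 2 * (quad_trace (yb z) (\<Theta> (xb z)) + quad_trace (yb z) (\<Theta> (xa z))
          + quad_trace (dl z) (\<Theta> (xa z)) + quad_trace (dl z) (\<Theta> (xb z)))"
        if z: "z \<in> space T" for z
        unfolding W3
        by (rule trace_word_bound[OF pos(4), where r="2 * p - 3"])
           (use 3 pm dom[OF z] sa[OF z] opl[OF z] pos len in auto)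
      then have "cmod (W z) \<le> l * quad_trace (dl z) (\<Theta> (xa z)) + l * quad_trace (dl z) (\<Theta> (xb z))
          + l * quad_trace (yb z) (\<Theta> (xa z)) + l * quad_trace (yb z) (\<Theta> (xb z))"
        if "z \<in> space T" for z using that by (fastforce simp: algebra_simps)
      from integral_word_bound[OF amW this[unfolded \<Theta>_def], folded Q_def Q'_def]
      show ?thesis by (simp add: algebra_simps)
    qed
  qed
  also have "\<dots> \<le> l * (8 * Q')" using Qs pos by (intro mult_left_mono) auto
  finally show ?thesis by (simp add: W_def[abs_def] Q'_def algebra_simps)
qed

text \<open>Swapping the copies turns \<open>xa\<close>, \<open>ya\<close> into \<open>xb\<close>,
  \<open>yb\<close>, and the word at \<open>xb\<close> is expanded around \<open>xa\<close>. The
  constant term and the part of the linear term along \<open>ya\<close> vanish, being linear in the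
  independent \<open>yb\<close>. What survives is the term quadratic in \<open>yb\<close>, where
  only the covariance enters, and a remainder of three-letter words.\<close>

lemma exchange_bound:
  assumes cs: "pm_shifts g cs" "length cs = 2 * p - 1" and p: "1 \<le> p"
    and h: "0 < h" and gl: "16 * real p * l \<le> g"
  shows "cmod ((\<integral>z. trace (shift_prod cs (xa z) ** ya z) \<partial>T) - s *\<^sub>R (\<integral>z. trace (shift_deriv cs (xa z) (yb z)
      ** yb z) \<partial>T))
    \<le> 8 * real ((2 * p - 1) * (p - 1)) * s\<^sup>2 * l * (q' (p - 1) / (2 * h) + h / 2 * q' (p - 2))"
proof -
  define e where "e z = trace ((shift_prod cs (xb z) - shift_prod cs (xa z) - shift_deriv cs (xa z) (xb z
      - xa z)) ** yb z)" for z
  define W where "W i k z = trace (shift_prod (take i cs) (xa z) ** dl z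
      ** shift_prod (take k (drop (Suc i) cs)) (xa z) ** dl z
          ** shift_prod (drop (Suc k) (drop (Suc i) cs)) (xb z) ** yb z)" for i k z
  define C where "C = 8 * l * (q' (p - 1) / (2 * h) + h / 2 * q' (p - 2))"
  have C: "0 \<le> C" using pos h q_nonneg by (auto simp: C_def intro!: mult_nonneg_nonneg add_nonneg_nonneg)
  have "all_moments T (\<lambda>z. trace (shift_prod cs (xa z) ** ya z))" by (intro am)
  from integral_swap[OF all_moments_integrable[OF this]]
  have "(\<integral>z. trace (shift_prod cs (xb z) ** yb z) \<partial>T) = (\<integral>z. trace (shift_prod cs (xa z) ** ya z) \<partial>T)"
    by (simp add: xa_def xb_def ya_def yb_def)
  moreover have "(\<integral>z. trace (shift_prod cs (xa z) ** yb z) \<partial>T) = 0"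
    unfolding xa_def ya_def
    by (rule integral_linear_yb) (unfold ya_def[symmetric] xa_def[symmetric], intro am)
  moreover have "(\<integral>z. trace (shift_deriv cs (xa z) (ya z) ** yb z) \<partial>T) = 0"
    unfolding xa_def ya_def
    by (rule integral_linear_yb) (unfold ya_def[symmetric] xa_def[symmetric], intro am)
  moreover have "(\<integral>z. e z \<partial>T) = (\<integral>z. trace (shift_prod cs (xb z) ** yb z) - trace (shift_prod cs (xa z) ** yb z)
      - (s *\<^sub>R trace (shift_deriv cs (xa z) (yb z) ** yb z) - s *\<^sub>R trace (shift_deriv cs (xa z) (ya z) ** yb z)) \<partial>T)"
    unfolding e_def diff_x dl_def
    by (simp add: shift_deriv_scaleR shift_deriv_diff matrix_mult_distribs trace_diff' trace_scaleR scaleR_diff_right)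
  moreover have "\<dots> = (\<integral>z. trace (shift_prod cs (xb z) ** yb z) \<partial>T) - (\<integral>z. trace (shift_prod cs (xa z) ** yb z) \<partial>T)
      - (s *\<^sub>R (\<integral>z. trace (shift_deriv cs (xa z) (yb z) ** yb z) \<partial>T)
          - s *\<^sub>R (\<integral>z. trace (shift_deriv cs (xa z) (ya z) ** yb z) \<partial>T))"
    by (subst Bochner_Integration.integral_diff, (intro all_moments_integrable am)+)+
       (simp add: all_moments_integrable am del: scaleR_conv_of_real)
  ultimately have "(\<integral>z. trace (shift_prod cs (xa z) ** ya z) \<partial>T)
      - s *\<^sub>R (\<integral>z. trace (shift_deriv cs (xa z) (yb z) ** yb z) \<partial>T) = (\<integral>z. e z \<partial>T)"
    by simp
  also have "\<dots> = (\<integral>z. (\<Sum>i<length cs. \<Sum>k<length cs - Suc i. s\<^sup>2 *\<^sub>R W i k z) \<partial>T)"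
    unfolding e_def shift_prod_taylor2 unfolding diff_x W_def
    by (simp add: matrix_mult_sum trace_sum matrix_mult_distribs trace_scaleR power2_eq_square)
  also have "\<dots> = (\<Sum>i<length cs. \<Sum>k<length cs - Suc i. s\<^sup>2 *\<^sub>R (\<integral>z. W i k z \<partial>T))"
    unfolding W_def
    by (subst Bochner_Integration.integral_sum,
        intro Bochner_Integration.integrable_sum all_moments_integrable am,
        rule sum.cong[OF refl], subst Bochner_Integration.integral_sum,
        intro all_moments_integrable am, simp)
  also have "cmod \<dots> \<le> (\<Sum>i<length cs. \<Sum>k<length cs - Suc i. s\<^sup>2 * C)"
  proof (intro order_trans[OF norm_sum] sum_mono)
    fix i k assume ik: "i \<in> {..<length cs}" "k \<in> {..<length cs - Suc i}"
    \<comment> \<open>Two different cut positions exist only if the word has at least two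
      factors.\<close>
    then have "2 \<le> p" using cs(2) by auto
    then have "cmod (\<integral>z. W i k z \<partial>T) \<le> C"
      unfolding W_def C_def using ik cs
      by (intro word_bound h gl pm_shifts_take_drop) auto
    then show "cmod (s\<^sup>2 *\<^sub>R (\<integral>z. W i k z \<partial>T)) \<le> s\<^sup>2 * C"
      by (simp add: mult_left_mono)
  qed
  also have "\<dots> = real (\<Sum>i<length cs. length cs - Suc i) * (s\<^sup>2 * C)"
    by (simp add: sum_distrib_right)
  also have "(\<Sum>i<length cs. length cs - Suc i) = (\<Sum>i<length cs. i)"
    by (rule sum.nat_diff_reindex)
  also have "(\<Sum>i<length cs. i) = (2 * p - 1) * (p - 1)"
  proof -
    obtain k where k: "p = Suc k" using p by (cases p) auto
    have "(\<Sum>i<Suc (2 * k). i) = Suc (2 * k) * k"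
      by (induction k) auto
    then show ?thesis by (simp add: cs(2) k)
  qed
  also have "real ((2 * p - 1) * (p - 1)) * (s\<^sup>2 * C)
      = 8 * real ((2 * p - 1) * (p - 1)) * s\<^sup>2 * l * (q' (p - 1) / (2 * h) + h / 2 * q' (p - 2))"
    by (simp add: C_def)
  finally show ?thesis .
qed

end

subsection \<open>Gaussian integration by parts\<close>

text \<open>The recurrence is integration by parts for powers, in a form that also covers constants,
  where both sides vanish. For a normal density it is read off from the even moments; the odd ones
  are zero.\<close>

lemma (in prob_space) gaussian_rv_moments:
  assumes "gaussian_rv M Z"
  shows "all_moments M Z"
    and "(\<integral>\<omega>. (Z \<omega> - expectation Z) ^ (n + 2) \<partial>M)
       = real (n + 1) * (\<integral>\<omega>. (Z \<omega> - expectation Z) ^ 2 \<partial>M) * (\<integral>\<omega>. (Z \<omega> - expectation Z) ^ n \<partial>M)"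
proof -
  have [measurable]: "Z \<in> borel_measurable M" using assms by (simp add: gaussian_rv_def)
  have fin: "finite_measure M" by unfold_locales
  consider (const) \<mu> where "AE \<omega> in M. Z \<omega> = \<mu>"
    | (normal) \<mu> s where "s > 0" "distributed M lborel Z (normal_density \<mu> s)"
    using assms by (auto simp: gaussian_rv_def)
  then have "all_moments M Z \<and> (\<forall>n. (\<integral>\<omega>. (Z \<omega> - expectation Z) ^ (n + 2) \<partial>M)
       = real (n + 1) * (\<integral>\<omega>. (Z \<omega> - expectation Z) ^ 2 \<partial>M) * (\<integral>\<omega>. (Z \<omega> - expectation Z) ^ n \<partial>M))"
  proof cases
    case const
    have "expectation Z = expectation (\<lambda>_. \<mu>)" by (rule integral_cong_AE) (use const in auto)
    then have E: "expectation Z = \<mu>" by (simp add: prob_space)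
    have Zk: "integrable M (\<lambda>x. norm (Z x) ^ k)" for k
      using const by (subst integrable_cong_AE[where g="\<lambda>_. norm \<mu> ^ k"]) auto
    have "(\<integral>\<omega>. (Z \<omega> - expectation Z) ^ Suc k \<partial>M) = (\<integral>\<omega>. 0 \<partial>M)" for k
      by (rule integral_cong_AE) (use const E in auto)
    from this[of "Suc _"] this[of 1] Zk show ?thesis by (simp add: all_moments_def numeral_2_eq_2)
  next
    case normal
    note D = normal(2) and s = normal(1)
    have int: "integrable M (\<lambda>\<omega>. (Z \<omega> - \<mu>) ^ k)" for k
      using distributed_integrable[OF D, of "\<lambda>x. (x - \<mu>) ^ k"] integrable_normal_moment[OF s, of \<mu> k] by simp
    have iabs: "integrable M (\<lambda>\<omega>. \<bar>Z \<omega> - \<mu>\<bar> ^ k)" for k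
      using integrable_abs[OF int[of k]] by (simp add: power_abs)
    have val: "(\<integral>\<omega>. (Z \<omega> - \<mu>) ^ k \<partial>M) = (\<integral>x. normal_density \<mu> s x * (x - \<mu>) ^ k \<partial>lborel)" for k
      using distributed_integral[OF D, of "\<lambda>x. (x - \<mu>) ^ k"] by simp
    have "all_moments M (\<lambda>\<omega>. Z \<omega> - \<mu>)"
      unfolding all_moments_def using iabs by simp
    from all_moments_add[OF this all_moments_const[OF fin, of \<mu>]] have am: "all_moments M Z" by simp
    have "(\<integral>\<omega>. Z \<omega> - \<mu> \<partial>M) = 0"
      using val[of 1] integral_normal_moment_odd[OF s, of \<mu> 0] by simp
    then have E: "expectation Z = \<mu>"
      using all_moments_integrable[OF am] by (simp add: prob_space)
    have ev: "(\<integral>\<omega>. (Z \<omega> - \<mu>) ^ (2 * k) \<partial>M) = fact (2 * k) / ((2 / s\<^sup>2) ^ k * fact k)" for k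
      unfolding val by (rule integral_normal_moment_even[OF s])
    have od: "(\<integral>\<omega>. (Z \<omega> - \<mu>) ^ (2 * k + 1) \<partial>M) = 0" for k
      unfolding val by (rule integral_normal_moment_odd[OF s])
    have e2: "(\<integral>\<omega>. (Z \<omega> - \<mu>) ^ 2 \<partial>M) = s\<^sup>2" using ev[of 1] by (simp add: fact_numeral)
    have "(\<integral>\<omega>. (Z \<omega> - \<mu>) ^ (n + 2) \<partial>M) = real (n + 1) * s\<^sup>2 * (\<integral>\<omega>. (Z \<omega> - \<mu>) ^ n \<partial>M)" for n
    proof (cases "even n")
      case True
      then obtain k where k: "n = 2 * k" by (auto elim: evenE)
      have "fact (2 * Suc k) / ((2 / s\<^sup>2) ^ Suc k * fact (Suc k))
          = real (2 * k + 1) * s\<^sup>2 * (fact (2 * k) / ((2 / s\<^sup>2) ^ k * fact k))"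
      proof -
        have "fact (2 * Suc k) = (2 * (real k + 1)) * (2 * real k + 1) * fact (2 * k)"
          by (simp add: algebra_simps)
        moreover have "fact (Suc k) = (real k + 1) * fact k" by simp
        ultimately show ?thesis using s by (simp add: divide_simps del: fact_Suc)
      qed
      then show ?thesis using ev[of "Suc k"] ev[of k] by (simp add: k)
    next
      case False
      then obtain k where k: "n = 2 * k + 1" by (auto elim: oddE)
      show ?thesis using od[of "Suc k"] od[of k] by (simp add: k)
    qed
    then show ?thesis using am by (simp add: E e2)
  qed
  then show "all_moments M Z" "(\<integral>\<omega>. (Z \<omega> - expectation Z) ^ (n + 2) \<partial>M)
       = real (n + 1) * (\<integral>\<omega>. (Z \<omega> - expectation Z) ^ 2 \<partial>M) * (\<integral>\<omega>. (Z \<omega> - expectation Z) ^ n \<partial>M)"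
    by blast+
qed

lemma all_moments_mult:
  fixes f g :: "'a \<Rightarrow> 'b::{real_normed_algebra, banach, second_countable_topology}"
  shows "all_moments M f \<Longrightarrow> all_moments M g \<Longrightarrow> all_moments M (\<lambda>x. f x * g x)"
  by (rule all_moments_bilinear[OF bounded_bilinear_mult])

lemma all_moments_power:
  fixes f :: "'a \<Rightarrow> 'b::{real_normed_algebra_1, banach, second_countable_topology}"
  shows "finite_measure M \<Longrightarrow> all_moments M f \<Longrightarrow> all_moments M (\<lambda>x. f x ^ n)"
  by (induction n) (auto intro: all_moments_const all_moments_mult)

text \<open>The integral is a polynomial in \<open>\<tau>\<close>, so no limit theorem is needed:
  one factor at a time is moved into \<open>h\<close>, which therefore has to be arbitrary in the
  induction.\<close>

lemma deriv_integral_power: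
  fixes m l h :: "'a \<Rightarrow> complex"
  assumes fin: "finite_measure M" and am: "all_moments M m" "all_moments M l" and h: "all_moments M h"
  shows "((\<lambda>\<tau>. \<integral>x. h x * (m x + of_real \<tau> * l x) ^ k \<partial>M) has_vector_derivative
          (\<integral>x. h x * (of_nat k * m x ^ (k - 1) * l x) \<partial>M)) (at 0)"
  using h
proof (induction k arbitrary: h)
  case 0
  then show ?case by simp
next
  case (Suc k)
  have ms: "all_moments M (\<lambda>x. m x + of_real \<tau> * l x)" for \<tau>
    by (intro all_moments_add all_moments_mult all_moments_const fin am)
  note ams = all_moments_mult all_moments_power[OF fin] all_moments_const[OF fin] am Suc.prems ms
  have eq: "(\<integral>x. h x * (m x + of_real \<tau> * l x) ^ Suc k \<partial>M)
      = (\<integral>x. (h x * m x) * (m x + of_real \<tau> * l x) ^ k \<partial>M) + \<tau> *\<^sub>R (\<integral>x. (h x * l x) * (m x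
          + of_real \<tau> * l x) ^ k \<partial>M)" for \<tau>
  proof -
    have "(\<integral>x. h x * (m x + of_real \<tau> * l x) ^ Suc k \<partial>M)
      = (\<integral>x. (h x * m x) * (m x + of_real \<tau> * l x) ^ k + \<tau> *\<^sub>R ((h x * l x) * (m x + of_real \<tau> * l x) ^ k) \<partial>M)"
      by (simp add: algebra_simps scaleR_conv_of_real)
    also have "\<dots> = (\<integral>x. (h x * m x) * (m x + of_real \<tau> * l x) ^ k \<partial>M) + (\<integral>x. \<tau> *\<^sub>R ((h x * l x) * (m x
        + of_real \<tau> * l x) ^ k) \<partial>M)"
      by (intro Bochner_Integration.integral_add all_moments_integrable all_moments_scaleR ams)
    finally show ?thesis by simp
  qed
  have d1: "((\<lambda>\<tau>. \<integral>x. (h x * m x) * (m x + of_real \<tau> * l x) ^ k \<partial>M) has_vector_derivative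
      (\<integral>x. (h x * m x) * (of_nat k * m x ^ (k - 1) * l x) \<partial>M)) (at 0)"
    by (intro Suc.IH ams)
  have d2: "((\<lambda>\<tau>. \<integral>x. (h x * l x) * (m x + of_real \<tau> * l x) ^ k \<partial>M) has_vector_derivative
      (\<integral>x. (h x * l x) * (of_nat k * m x ^ (k - 1) * l x) \<partial>M)) (at 0)"
    by (intro Suc.IH ams)
  have "((\<lambda>\<tau>. \<integral>x. h x * (m x + of_real \<tau> * l x) ^ Suc k \<partial>M) has_vector_derivative
      (\<integral>x. (h x * m x) * (of_nat k * m x ^ (k - 1) * l x) \<partial>M) +
      (0 *\<^sub>R (\<integral>x. (h x * l x) * (of_nat k * m x ^ (k - 1) * l x) \<partial>M)
       + 1 *\<^sub>R (\<integral>x. (h x * l x) * (m x + of_real 0 * l x) ^ k \<partial>M))) (at 0)"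
    unfolding eq by (intro has_vector_derivative_add d1 has_vector_derivative_scaleR d2 derivative_intros)
  moreover have "(\<integral>x. (h x * m x) * (of_nat k * m x ^ (k - 1) * l x) \<partial>M) + (\<integral>x. (h x * l x) * m x ^ k \<partial>M)
      = (\<integral>x. h x * (of_nat (Suc k) * m x ^ k * l x) \<partial>M)"
  proof -
    have "h x * (of_nat (Suc k) * m x ^ k * l x) = (h x * m x) * (of_nat k * m x ^ (k - 1) * l x)
        + (h x * l x) * m x ^ k" for x
      by (cases k) (auto simp: algebra_simps)
    then show ?thesis
      by (simp only:) (intro Bochner_Integration.integral_add[symmetric] all_moments_integrable ams)
  qed
  ultimately show ?case by simp
qed

locale gaussian_family = prob_space N for N :: "'b measure" +
  fixes Y :: "'i::finite \<Rightarrow> 'b \<Rightarrow> real"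
  assumes joint: "jointly_gaussian N UNIV Y"
begin

text \<open>Centred, and with complex coefficients because a matrix entry combines a real and an
  imaginary part.\<close>

definition form :: "('i \<Rightarrow> complex) \<Rightarrow> 'b \<Rightarrow> complex" where
  "form c \<eta> = (\<Sum>i\<in>UNIV. c i * of_real (Y i \<eta> - expectation (Y i)))"

text \<open>Bilinear, without conjugation: this pairing is what integration by parts produces and
  what the variance tensor records.\<close>

definition cov :: "('i \<Rightarrow> complex) \<Rightarrow> ('i \<Rightarrow> complex) \<Rightarrow> complex" where
  "cov a c = (\<integral>\<eta>. form a \<eta> * form c \<eta> \<partial>N)"

text \<open>Joint Gaussianity speaks of real combinations only; complex coefficients are reached by
  linearity.\<close>

definition real_coeffs :: "('i \<Rightarrow> complex) \<Rightarrow> bool" where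
  "real_coeffs c \<longleftrightarrow> (\<forall>i. c i \<in> \<real>)"

lemma fin: "finite_measure N" by unfold_locales

lemma gaussian_comb: "gaussian_rv N (\<lambda>\<eta>. \<Sum>i\<in>UNIV. r i * Y i \<eta>)"
  using joint[unfolded jointly_gaussian_def, rule_format, of UNIV r] by simp

lemma am_Y: "all_moments N (Y i)"
proof -
  have "(\<lambda>\<eta>. \<Sum>j\<in>UNIV. (if j = i then 1 else 0) * Y j \<eta>) = Y i"
    by (simp add: if_distrib[of "\<lambda>x. x * _"] cong: if_cong)
  then show ?thesis using gaussian_rv_moments(1)[OF gaussian_comb[of "\<lambda>j. if j = i then 1 else 0"]] by simp
qed

lemma am_form: "all_moments N (form c)"
  unfolding form_def
  by (intro all_moments_sum fin all_moments_mult all_moments_const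
      all_moments_linear[OF bounded_linear_of_real] all_moments_diff am_Y)

lemmas amf = all_moments_mult all_moments_power[OF fin] all_moments_const[OF fin] am_form all_moments_add

lemma form_add: "form (\<lambda>i. c i + d i) \<eta> = form c \<eta> + form d \<eta>"
  and form_mult: "form (\<lambda>i. k * c i) \<eta> = k * form c \<eta>"
  by (simp_all add: form_def sum.distrib distrib_right sum_distrib_left mult.assoc)

lemma cov_add: "cov a (\<lambda>i. c i + d i) = cov a c + cov a d"
  unfolding cov_def form_add distrib_left
  by (intro Bochner_Integration.integral_add all_moments_integrable amf)

lemma cov_mult: "cov a (\<lambda>i. k * c i) = k * cov a c"
  unfolding cov_def form_mult by (simp add: mult.left_commute)

lemma cov_commute: "cov a c = cov c a"
  unfolding cov_def by (simp add: mult.commute)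

lemma integral_form: "(\<integral>\<eta>. form c \<eta> \<partial>N) = 0"
proof -
  have "(\<integral>\<eta>. form c \<eta> \<partial>N) = (\<Sum>i\<in>UNIV. c i * (\<integral>\<eta>. of_real (Y i \<eta> - expectation (Y i)) \<partial>N))"
    unfolding form_def
    by (subst Bochner_Integration.integral_sum)
       (auto intro!: all_moments_integrable amf all_moments_linear[OF bounded_linear_of_real] all_moments_diff am_Y)
  also have "\<dots> = 0"
    by (simp add: integral_complex_of_real all_moments_integrable[OF am_Y] prob_space del: of_real_diff)
  finally show ?thesis .
qed

lemma form_recurrence:
  assumes "real_coeffs c"
  shows "(\<integral>\<eta>. form c \<eta> ^ (n + 2) \<partial>N) = of_nat (n + 1) * cov c c * (\<integral>\<eta>. form c \<eta> ^ n \<partial>N)"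
proof -
  define r where "r i = Re (c i)" for i
  have c: "c = (\<lambda>i. of_real (r i))"
    using assms by (auto simp: real_coeffs_def r_def)
  define Z where "Z \<eta> = (\<Sum>i\<in>UNIV. r i * Y i \<eta>)" for \<eta>
  have EZ: "expectation Z = (\<Sum>i\<in>UNIV. r i * expectation (Y i))"
    unfolding Z_def
    by (subst Bochner_Integration.integral_sum) (auto intro!: all_moments_integrable amf am_Y)
  have f: "form c \<eta> = of_real (Z \<eta> - expectation Z)" for \<eta>
    by (simp add: EZ Z_def c form_def sum_subtractf right_diff_distrib)
  have "gaussian_rv N Z" unfolding Z_def by (rule gaussian_comb)
  note rec = gaussian_rv_moments(2)[OF this, of n]
  have fk: "(\<integral>\<eta>. form c \<eta> ^ k \<partial>N) = of_real (\<integral>\<eta>. (Z \<eta> - expectation Z) ^ k \<partial>N)" for k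
    unfolding f of_real_power[symmetric] by (rule integral_complex_of_real)
  have "cov c c = (\<integral>\<eta>. form c \<eta> ^ 2 \<partial>N)" by (simp add: cov_def power2_eq_square)
  then show ?thesis
    unfolding fk rec by simp
qed

text \<open>Differentiating the moment recurrence along the pencil \<open>m + \<tau> a\<close> of Gaussian variables.\<close>

lemma ibp_power:
  assumes a: "real_coeffs a" and m: "real_coeffs m"
  shows "(\<integral>\<eta>. form m \<eta> ^ n * form a \<eta> \<partial>N) = of_nat n * cov a m * (\<integral>\<eta>. form m \<eta> ^ (n - 1) \<partial>N)"
proof (induction n rule: less_induct)
  case (less n)
  define E where "E k = (\<integral>\<eta>. form m \<eta> ^ k \<partial>N)" for k
  define e where "e k = (\<integral>\<eta>. form m \<eta> ^ k * form a \<eta> \<partial>N)" for k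
  define u where "u \<tau> = (\<lambda>i. m i + of_real \<tau> * a i)" for \<tau> :: real
  have fu: "form (u \<tau>) \<eta> = form m \<eta> + of_real \<tau> * form a \<eta>" for \<tau> \<eta>
    by (simp add: u_def form_add form_mult)
  have D: "((\<lambda>\<tau>. \<integral>\<eta>. form (u \<tau>) \<eta> ^ k \<partial>N) has_vector_derivative of_nat k * e (k - 1)) (at 0)" for k
    using deriv_integral_power[of N "form m" "form a" "\<lambda>_. 1" k, OF fin am_form am_form all_moments_const[OF fin]]
    by (simp add: fu e_def mult.assoc)
  show ?case
  proof (cases n)
    case 0
    then show ?thesis by (simp add: integral_form)
  next
    case (Suc k)
    have rc: "real_coeffs (u \<tau>)" for \<tau> using a m by (auto simp: real_coeffs_def u_def)
    have u0: "form (u 0) = form m" by (simp add: u_def)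
    have sq: "(\<integral>\<eta>. form (u \<tau>) \<eta> ^ 2 \<partial>N) = cov (u \<tau>) (u \<tau>)" for \<tau> by (simp add: cov_def power2_eq_square)
    have rec: "(\<integral>\<eta>. form (u \<tau>) \<eta> ^ (k + 2) \<partial>N) = of_nat (k
        + 1) * ((\<integral>\<eta>. form (u \<tau>) \<eta> ^ 2 \<partial>N) * (\<integral>\<eta>. form (u \<tau>) \<eta> ^ k \<partial>N))" for \<tau>
      using form_recurrence[OF rc] by (simp add: sq mult.assoc)
    have "((\<lambda>\<tau>. of_nat (k + 1) * ((\<integral>\<eta>. form (u \<tau>) \<eta> ^ 2 \<partial>N) * (\<integral>\<eta>. form (u \<tau>) \<eta> ^ k \<partial>N))) has_vector_derivative
        of_nat (k + 1) * ((\<integral>\<eta>. form (u 0) \<eta> ^ 2 \<partial>N) * (of_nat k * e (k - 1)) + of_nat 2 * e (2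
            - 1) * (\<integral>\<eta>. form (u 0) \<eta> ^ k \<partial>N))) (at 0)"
      by (rule has_vector_derivative_mult_right, rule has_vector_derivative_mult) (rule D)+
    \<comment> \<open>The same function is differentiated at 0 twice, directly and through the
      recurrence.\<close>
    with D[of "k + 2"] have A: "of_nat (k + 2) * e (k + 1) =
        of_nat (k + 1) * (E 2 * (of_nat k * e (k - 1)) + 2 * e 1 * E k)"
      unfolding rec by (auto simp: u0 E_def dest: vector_derivative_unique_at)
    have e1: "e 1 = cov a m" by (simp add: e_def cov_def mult.commute)
    \<comment> \<open>For \<open>k \<ge> 2\<close> the induction hypothesis lowers the order and the
      recurrence raises it again; for smaller \<open>k\<close> both sides are 0.\<close>
    have B: "E 2 * (of_nat k * e (k - 1)) = of_nat k * cov a m * E k"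
    proof (cases "k \<ge> 2")
      case True
      then obtain j where j: "k = j + 2" by (metis add.commute le_Suc_ex)
      have "e (k - 1) = of_nat (k - 1) * cov a m * E (k - 1 - 1)"
        unfolding e_def E_def by (rule less) (use Suc j in auto)
      moreover have "E k = of_nat (j + 1) * E 2 * E j"
        using form_recurrence[OF m, of j] by (simp add: E_def j cov_def power2_eq_square)
      ultimately show ?thesis by (simp add: j)
    next
      case False
      then consider "k = 0" | "k = 1" by linarith
      then show ?thesis by cases (simp_all add: e_def E_def integral_form)
    qed
    have "of_nat (k + 2) * e (k + 1) = of_nat (k + 2) * (of_nat (k + 1) * cov a m * E k)"
      unfolding A B e1 by (simp add: algebra_simps)
    moreover have "(of_nat (k + 2) :: complex) \<noteq> 0" by (simp only: of_nat_eq_0_iff)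
    ultimately have "e (k + 1) = of_nat (k + 1) * cov a m * E k"
      by (metis mult_cancel_left)
    then show ?thesis by (simp add: Suc e_def E_def)
  qed
qed

end

section \<open>Integration by parts for polynomials\<close>

context gaussian_family
begin

definition form_prod :: "('i \<Rightarrow> complex) list \<Rightarrow> 'b \<Rightarrow> complex" where
  "form_prod cs \<eta> = (\<Prod>c\<leftarrow>cs. form c \<eta>)"

text \<open>Leibniz rule for the derivation that sends \<open>form c\<close> to
  \<open>cov a c\<close>, the one dual to multiplication by \<open>form a\<close> under the
  integral.\<close>

primrec form_deriv :: "('i \<Rightarrow> complex) \<Rightarrow> ('i \<Rightarrow> complex) list \<Rightarrow> 'b \<Rightarrow> complex" where
  "form_deriv a [] \<eta> = 0"
| "form_deriv a (c # cs) \<eta> = cov a c * form_prod cs \<eta> + form c \<eta> * form_deriv a cs \<eta>"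

lemma form_prod_simps [simp]:
  "form_prod [] \<eta> = 1" "form_prod (c # cs) \<eta> = form c \<eta> * form_prod cs \<eta>"
  by (simp_all add: form_prod_def)

lemma form_prod_append: "form_prod (cs @ ds) \<eta> = form_prod cs \<eta> * form_prod ds \<eta>"
  by (simp add: form_prod_def)

lemma form_deriv_append:
  "form_deriv a (cs @ ds) \<eta> = form_deriv a cs \<eta> * form_prod ds \<eta> + form_prod cs \<eta> * form_deriv a ds \<eta>"
  by (induction cs) (simp_all add: form_prod_append algebra_simps)

lemma am_form_prod: "all_moments N (form_prod cs)"
proof (induction cs)
  case Nil
  have "form_prod [] = (\<lambda>\<eta>. 1)" by (simp add: fun_eq_iff)
  then show ?case by (simp add: all_moments_const[OF fin])
next
  case (Cons c cs)
  have "form_prod (c # cs) = (\<lambda>\<eta>. form c \<eta> * form_prod cs \<eta>)" by (simp add: fun_eq_iff)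
  then show ?case using Cons by (auto intro: amf)
qed

lemma am_form_deriv: "all_moments N (form_deriv a cs)"
proof (induction cs)
  case Nil
  have "form_deriv a [] = (\<lambda>\<eta>. 0)" by (simp add: fun_eq_iff)
  then show ?case by (simp add: all_moments_const[OF fin])
next
  case (Cons c cs)
  have "form_deriv a (c # cs) = (\<lambda>\<eta>. cov a c * form_prod cs \<eta> + form c \<eta> * form_deriv a cs \<eta>)"
    by (simp add: fun_eq_iff)
  then show ?case using Cons by (auto intro!: amf am_form_prod)
qed

lemmas amp = amf am_form_prod am_form_deriv

text \<open>Polarization, with the power of \<open>form m\<close> as a reservoir: differentiating
  the induction hypothesis for exponent \<open>n + 1\<close> along the pencil
  \<open>u \<tau>\<close> takes one factor \<open>form l\<close> out of the power and adds it to the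
  list.\<close>

lemma wick_power:
  assumes a: "real_coeffs a" and "real_coeffs m" "list_all real_coeffs rs"
  shows "(\<integral>\<eta>. form a \<eta> * form_prod rs \<eta> * form m \<eta> ^ n \<partial>N)
     = of_nat n * cov a m * (\<integral>\<eta>. form_prod rs \<eta> * form m \<eta> ^ (n - 1) \<partial>N) + (\<integral>\<eta>. form_deriv a rs \<eta> * form m \<eta> ^ n \<partial>N)"
  using assms(2,3)
proof (induction rs arbitrary: m n)
  case Nil
  then show ?case using ibp_power[OF a, of m n] by (simp add: mult.commute)
next
  case (Cons l rs)
  define u where "u \<tau> = (\<lambda>i. m i + of_real \<tau> * l i)" for \<tau> :: real
  have rc: "real_coeffs (u \<tau>)" for \<tau> using Cons.prems by (auto simp: real_coeffs_def u_def)
  have fu: "form (u \<tau>) \<eta> = form m \<eta> + of_real \<tau> * form l \<eta>" for \<tau> \<eta>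
    by (simp add: u_def form_add form_mult)
  have cu: "cov a (u \<tau>) = cov a m + of_real \<tau> * cov a l" for \<tau>
    by (simp add: u_def cov_add cov_mult)
  have D: "((\<lambda>\<tau>. \<integral>\<eta>. h \<eta> * form (u \<tau>) \<eta> ^ k \<partial>N) has_vector_derivative
      (\<integral>\<eta>. h \<eta> * (of_nat k * form m \<eta> ^ (k - 1) * form l \<eta>) \<partial>N)) (at 0)" if "all_moments N h" for h k
    unfolding fu by (rule deriv_integral_power[OF fin am_form am_form that])
  have eq: "(\<integral>\<eta>. form a \<eta> * form_prod rs \<eta> * form (u \<tau>) \<eta> ^ (n + 1) \<partial>N)
     = of_nat (n + 1) * (cov a (u \<tau>) * (\<integral>\<eta>. form_prod rs \<eta> * form (u \<tau>) \<eta> ^ n \<partial>N))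
         + (\<integral>\<eta>. form_deriv a rs \<eta> * form (u \<tau>) \<eta> ^ (n + 1) \<partial>N)" for \<tau>
    using Cons.IH[OF rc[of \<tau>], of "n + 1"] Cons.prems by (simp add: mult.assoc)
  have dc: "((\<lambda>\<tau>. cov a (u \<tau>)) has_vector_derivative cov a l) (at 0)"
    unfolding cu by (auto intro!: derivative_eq_intros has_vector_derivative_real_field)
  have "((\<lambda>\<tau>. of_nat (n + 1) * (cov a (u \<tau>) * (\<integral>\<eta>. form_prod rs \<eta> * form (u \<tau>) \<eta> ^ n \<partial>N))
      + (\<integral>\<eta>. form_deriv a rs \<eta> * form (u \<tau>) \<eta> ^ (n + 1) \<partial>N))
     has_vector_derivative
     of_nat (n + 1) * (cov a (u 0) * (\<integral>\<eta>. form_prod rs \<eta> * (of_nat n * form m \<eta> ^ (n - 1) * form l \<eta>) \<partial>N)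
       + cov a l * (\<integral>\<eta>. form_prod rs \<eta> * form (u 0) \<eta> ^ n \<partial>N))
     + (\<integral>\<eta>. form_deriv a rs \<eta> * (of_nat (n + 1) * form m \<eta> ^ (n + 1 - 1) * form l \<eta>) \<partial>N)) (at 0)"
    by (rule has_vector_derivative_add, rule has_vector_derivative_mult_right, rule has_vector_derivative_mult)
       (intro D dc amp)+
  moreover have "((\<lambda>\<tau>. \<integral>\<eta>. form a \<eta> * form_prod rs \<eta> * form (u \<tau>) \<eta> ^ (n + 1) \<partial>N) has_vector_derivative
      (\<integral>\<eta>. form a \<eta> * form_prod rs \<eta> * (of_nat (n + 1) * form m \<eta> ^ (n + 1 - 1) * form l \<eta>) \<partial>N)) (at 0)"
    by (intro D amp)
  ultimately have der: "(\<integral>\<eta>. form a \<eta> * form_prod rs \<eta> * (of_nat (n + 1) * form m \<eta> ^ (n + 1 - 1) * form l \<eta>) \<partial>N) =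
     of_nat (n + 1) * (cov a (u 0) * (\<integral>\<eta>. form_prod rs \<eta> * (of_nat n * form m \<eta> ^ (n - 1) * form l \<eta>) \<partial>N)
       + cov a l * (\<integral>\<eta>. form_prod rs \<eta> * form (u 0) \<eta> ^ n \<partial>N))
     + (\<integral>\<eta>. form_deriv a rs \<eta> * (of_nat (n + 1) * form m \<eta> ^ (n + 1 - 1) * form l \<eta>) \<partial>N)"
    unfolding eq by (rule vector_derivative_unique_at[rotated])
  have u0: "u 0 = m" by (simp add: u_def)
  have sc: "(\<integral>\<eta>. f \<eta> * (of_nat k * g \<eta> * h \<eta>) \<partial>N) = of_nat k * (\<integral>\<eta>. f \<eta> * (g \<eta> * h \<eta>) \<partial>N)"
      for f g h :: "'b \<Rightarrow> complex" and k
    by (subst integral_mult_right_zero[symmetric]) (simp add: mult_ac)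
  have nz: "(of_nat (n + 1) :: complex) \<noteq> 0" by (simp only: of_nat_eq_0_iff)
  have "of_nat (n + 1) * (\<integral>\<eta>. form a \<eta> * form_prod rs \<eta> * (form m \<eta> ^ n * form l \<eta>) \<partial>N) =
     of_nat (n + 1) * (of_nat n * cov a m * (\<integral>\<eta>. form_prod rs \<eta> * (form m \<eta> ^ (n - 1) * form l \<eta>) \<partial>N)
       + cov a l * (\<integral>\<eta>. form_prod rs \<eta> * form m \<eta> ^ n \<partial>N)
       + (\<integral>\<eta>. form_deriv a rs \<eta> * (form m \<eta> ^ n * form l \<eta>) \<partial>N))"
    using der unfolding sc u0 by (simp add: algebra_simps)
  then have main: "(\<integral>\<eta>. form a \<eta> * form_prod rs \<eta> * (form m \<eta> ^ n * form l \<eta>) \<partial>N) =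
     of_nat n * cov a m * (\<integral>\<eta>. form_prod rs \<eta> * (form m \<eta> ^ (n - 1) * form l \<eta>) \<partial>N)
       + cov a l * (\<integral>\<eta>. form_prod rs \<eta> * form m \<eta> ^ n \<partial>N)
       + (\<integral>\<eta>. form_deriv a rs \<eta> * (form m \<eta> ^ n * form l \<eta>) \<partial>N)"
    by (rule mult_left_cancel[OF nz, THEN iffD1])
  have "(\<integral>\<eta>. form_deriv a (l # rs) \<eta> * form m \<eta> ^ n \<partial>N)
     = (\<integral>\<eta>. cov a l * (form_prod rs \<eta> * form m \<eta> ^ n) + form_deriv a rs \<eta> * (form m \<eta> ^ n * form l \<eta>) \<partial>N)"
    by (simp add: algebra_simps)
  also have "\<dots> = (\<integral>\<eta>. cov a l * (form_prod rs \<eta> * form m \<eta> ^ n) \<partial>N)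
      + (\<integral>\<eta>. form_deriv a rs \<eta> * (form m \<eta> ^ n * form l \<eta>) \<partial>N)"
    by (intro Bochner_Integration.integral_add all_moments_integrable amp)
  finally have 2: "(\<integral>\<eta>. form_deriv a (l # rs) \<eta> * form m \<eta> ^ n \<partial>N) = cov a l * (\<integral>\<eta>. form_prod rs \<eta> * form m \<eta> ^ n \<partial>N)
      + (\<integral>\<eta>. form_deriv a rs \<eta> * (form m \<eta> ^ n * form l \<eta>) \<partial>N)"
    by simp
  show ?case
    unfolding 2 using main by (simp add: mult_ac)
qed

lemma wick_real:
  assumes "real_coeffs a" "list_all real_coeffs rs"
  shows "(\<integral>\<eta>. form a \<eta> * form_prod rs \<eta> \<partial>N) = (\<integral>\<eta>. form_deriv a rs \<eta> \<partial>N)"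
  using wick_power[OF assms(1) _ assms(2), of "\<lambda>_. 0" 0] by (simp add: real_coeffs_def)

lemma real_imag_coeffs:
  obtains cr ci where "real_coeffs cr" "real_coeffs ci" "c = (\<lambda>i. cr i + \<i> * ci i)"
proof
  show "real_coeffs (\<lambda>i. of_real (Re (c i)))" "real_coeffs (\<lambda>i. of_real (Im (c i)))"
    by (auto simp: real_coeffs_def)
  show "c = (\<lambda>i. of_real (Re (c i)) + \<i> * of_real (Im (c i)))"
    by (auto simp: complex_eq_iff)
qed

text \<open>Splitting the head of \<open>cs\<close> into real and imaginary parts moves it to the
  list \<open>rs\<close>, so the case of real coefficients suffices.\<close>

lemma wick_mixed:
  assumes a: "real_coeffs a" and "list_all real_coeffs rs"
  shows "(\<integral>\<eta>. form a \<eta> * (form_prod rs \<eta> * form_prod cs \<eta>) \<partial>N)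
     = (\<integral>\<eta>. form_deriv a rs \<eta> * form_prod cs \<eta> + form_prod rs \<eta> * form_deriv a cs \<eta> \<partial>N)"
  using assms(2)
proof (induction cs arbitrary: rs)
  case Nil
  then show ?case using wick_real[OF a] by simp
next
  case (Cons c cs)
  obtain cr ci where c: "real_coeffs cr" "real_coeffs ci" "c = (\<lambda>i. cr i + \<i> * ci i)"
    by (rule real_imag_coeffs)
  have f: "form c \<eta> = form cr \<eta> + \<i> * form ci \<eta>" for \<eta> by (simp add: c form_add form_mult)
  have cv: "cov a c = cov a cr + \<i> * cov a ci" by (simp add: c cov_add cov_mult)
  note IH = Cons.IH[of "cr # rs"] Cons.IH[of "ci # rs"]
  have "(\<integral>\<eta>. form a \<eta> * (form_prod rs \<eta> * form_prod (c # cs) \<eta>) \<partial>N)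
     = (\<integral>\<eta>. form a \<eta> * (form_prod (cr # rs) \<eta> * form_prod cs \<eta>)
         + \<i> * (form a \<eta> * (form_prod (ci # rs) \<eta> * form_prod cs \<eta>)) \<partial>N)"
    by (simp add: f algebra_simps)
  also have "\<dots> = (\<integral>\<eta>. form a \<eta> * (form_prod (cr # rs) \<eta> * form_prod cs \<eta>) \<partial>N)
      + (\<integral>\<eta>. \<i> * (form a \<eta> * (form_prod (ci # rs) \<eta> * form_prod cs \<eta>)) \<partial>N)"
    by (intro Bochner_Integration.integral_add all_moments_integrable amp)
  also have "\<dots> = (\<integral>\<eta>. form_deriv a (cr # rs) \<eta> * form_prod cs \<eta> + form_prod (cr # rs) \<eta> * form_deriv a cs \<eta> \<partial>N)
     + \<i> * (\<integral>\<eta>. form_deriv a (ci # rs) \<eta> * form_prod cs \<eta> + form_prod (ci # rs) \<eta> * form_deriv a cs \<eta> \<partial>N)"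
    using IH Cons.prems c by simp
  also have "\<dots> = (\<integral>\<eta>. form_deriv a (cr # rs) \<eta> * form_prod cs \<eta> + form_prod (cr # rs) \<eta> * form_deriv a cs \<eta> \<partial>N)
     + (\<integral>\<eta>. \<i> * (form_deriv a (ci # rs) \<eta> * form_prod cs \<eta> + form_prod (ci # rs) \<eta> * form_deriv a cs \<eta>) \<partial>N)"
    by simp
  also have "\<dots> = (\<integral>\<eta>. (form_deriv a (cr # rs) \<eta> * form_prod cs \<eta> + form_prod (cr # rs) \<eta> * form_deriv a cs \<eta>)
     + \<i> * (form_deriv a (ci # rs) \<eta> * form_prod cs \<eta> + form_prod (ci # rs) \<eta> * form_deriv a cs \<eta>) \<partial>N)"
    by (intro Bochner_Integration.integral_add[symmetric] all_moments_integrable amp)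
  also have "\<dots> = (\<integral>\<eta>. form_deriv a rs \<eta> * form_prod (c # cs) \<eta> + form_prod rs \<eta> * form_deriv a (c # cs) \<eta> \<partial>N)"
    by (simp add: f cv algebra_simps)
  finally show ?case .
qed

lemma form_deriv_linear:
  "form_deriv (\<lambda>i. a i + \<i> * b i) cs \<eta> = form_deriv a cs \<eta> + \<i> * form_deriv b cs \<eta>"
proof (induction cs)
  case (Cons c cs)
  have "cov (\<lambda>i. a i + \<i> * b i) c = cov a c + \<i> * cov b c"
    unfolding cov_commute[of _ c] by (simp add: cov_add cov_mult)
  then show ?case by (simp add: Cons algebra_simps)
qed simp

lemma wick: "(\<integral>\<eta>. form a \<eta> * form_prod cs \<eta> \<partial>N) = (\<integral>\<eta>. form_deriv a cs \<eta> \<partial>N)"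
proof -
  obtain r i where a: "real_coeffs r" "real_coeffs i" "a = (\<lambda>k. r k + \<i> * i k)"
    by (rule real_imag_coeffs)
  have "(\<integral>\<eta>. form a \<eta> * form_prod cs \<eta> \<partial>N) = (\<integral>\<eta>. form r \<eta> * form_prod cs \<eta> + \<i> * (form i \<eta> * form_prod cs \<eta>) \<partial>N)"
    by (simp add: a form_add form_mult algebra_simps)
  also have "\<dots> = (\<integral>\<eta>. form r \<eta> * form_prod cs \<eta> \<partial>N) + (\<integral>\<eta>. \<i> * (form i \<eta> * form_prod cs \<eta>) \<partial>N)"
    by (intro Bochner_Integration.integral_add all_moments_integrable amp)
  also have "\<dots> = (\<integral>\<eta>. form_deriv r cs \<eta> \<partial>N) + (\<integral>\<eta>. \<i> * form_deriv i cs \<eta> \<partial>N)"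
    using wick_mixed[OF a(1), of "[]" cs] wick_mixed[OF a(2), of "[]" cs] by simp
  also have "\<dots> = (\<integral>\<eta>. form_deriv r cs \<eta> + \<i> * form_deriv i cs \<eta> \<partial>N)"
    by (intro Bochner_Integration.integral_add[symmetric] all_moments_integrable amp)
  finally show ?thesis by (simp add: a form_deriv_linear)
qed

text \<open>\<open>F\<close> is a polynomial in the Gaussian family and \<open>F'\<close> its derivative in the direction of the
  covariances with \<open>form a\<close>.\<close>

definition gauss_poly :: "('i \<Rightarrow> complex) \<Rightarrow> ('b \<Rightarrow> complex) \<Rightarrow> ('b \<Rightarrow> complex) \<Rightarrow> bool" where
  "gauss_poly a F F' \<longleftrightarrow> (\<exists>ts. F = (\<lambda>\<eta>. \<Sum>(k, cs)\<leftarrow>ts. k * form_prod cs \<eta>) \<and>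
     F' = (\<lambda>\<eta>. \<Sum>(k, cs)\<leftarrow>ts. k * form_deriv a cs \<eta>))"

lemma gauss_poly_const: "gauss_poly a (\<lambda>\<eta>. k) (\<lambda>\<eta>. 0)"
  unfolding gauss_poly_def by (intro exI[of _ "[(k, [])]"]) simp

lemma gauss_poly_form: "gauss_poly a (\<lambda>\<eta>. k * form c \<eta>) (\<lambda>\<eta>. k * cov a c)"
  unfolding gauss_poly_def by (intro exI[of _ "[(k, [c])]"]) simp

lemma gauss_poly_add:
  assumes "gauss_poly a F F'" "gauss_poly a G G'"
  shows "gauss_poly a (\<lambda>\<eta>. F \<eta> + G \<eta>) (\<lambda>\<eta>. F' \<eta> + G' \<eta>)"
proof -
  obtain ts us where "F = (\<lambda>\<eta>. \<Sum>(k, cs)\<leftarrow>ts. k * form_prod cs \<eta>)" "F' = (\<lambda>\<eta>. \<Sum>(k, cs)\<leftarrow>ts. k * form_deriv a cs \<eta>)"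
    "G = (\<lambda>\<eta>. \<Sum>(k, cs)\<leftarrow>us. k * form_prod cs \<eta>)" "G' = (\<lambda>\<eta>. \<Sum>(k, cs)\<leftarrow>us. k * form_deriv a cs \<eta>)"
    using assms unfolding gauss_poly_def by blast
  then show ?thesis unfolding gauss_poly_def by (intro exI[of _ "ts @ us"]) simp
qed

lemma gauss_poly_mult:
  assumes "gauss_poly a F F'" "gauss_poly a G G'"
  shows "gauss_poly a (\<lambda>\<eta>. F \<eta> * G \<eta>) (\<lambda>\<eta>. F' \<eta> * G \<eta> + F \<eta> * G' \<eta>)"
proof -
  obtain us where us: "G = (\<lambda>\<eta>. \<Sum>(k, cs)\<leftarrow>us. k * form_prod cs \<eta>)" "G' = (\<lambda>\<eta>. \<Sum>(k, cs)\<leftarrow>us. k * form_deriv a cs \<eta>)"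
    using assms unfolding gauss_poly_def by blast
  have mono: "gauss_poly a (\<lambda>\<eta>. k * form_prod cs \<eta> * G \<eta>) (\<lambda>\<eta>. k * form_deriv a cs \<eta> * G \<eta>
      + k * form_prod cs \<eta> * G' \<eta>)" for k cs
    unfolding gauss_poly_def us
    by (intro exI[of _ "map (\<lambda>(l, ds). (k * l, cs @ ds)) us"])
       (auto simp: fun_eq_iff case_prod_unfold o_def form_prod_append form_deriv_append
         sum_list_const_mult[symmetric] sum_list_addf[symmetric] algebra_simps)
  obtain ts where "F = (\<lambda>\<eta>. \<Sum>(k, cs)\<leftarrow>ts. k * form_prod cs \<eta>)" "F' = (\<lambda>\<eta>. \<Sum>(k, cs)\<leftarrow>ts. k * form_deriv a cs \<eta>)"
    using assms unfolding gauss_poly_def by blast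
  then show ?thesis
  proof (induction ts arbitrary: F F')
    case Nil
    then show ?case using gauss_poly_const[of a 0] by simp
  next
    case (Cons t ts)
    obtain k cs where t: "t = (k, cs)" by (cases t)
    from gauss_poly_add[OF mono[of k cs] Cons.IH[OF refl refl]]
    show ?case by (simp add: Cons.prems t algebra_simps)
  qed
qed

lemma gauss_poly_sum:
  assumes "\<And>i. i \<in> I \<Longrightarrow> gauss_poly a (F i) (F' i)"
  shows "gauss_poly a (\<lambda>\<eta>. \<Sum>i\<in>I. F i \<eta>) (\<lambda>\<eta>. \<Sum>i\<in>I. F' i \<eta>)"
  using assms
  by (induction I rule: infinite_finite_induct) (auto intro: gauss_poly_add gauss_poly_const)

lemma gauss_poly_ibp:
  assumes "gauss_poly a F F'"
  shows "(\<integral>\<eta>. form a \<eta> * F \<eta> \<partial>N) = (\<integral>\<eta>. F' \<eta> \<partial>N)"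
proof -
  obtain ts where "F = (\<lambda>\<eta>. \<Sum>(k, cs)\<leftarrow>ts. k * form_prod cs \<eta>)" "F' = (\<lambda>\<eta>. \<Sum>(k, cs)\<leftarrow>ts. k * form_deriv a cs \<eta>)"
    using assms unfolding gauss_poly_def by blast
  then have "(\<integral>\<eta>. form a \<eta> * F \<eta> \<partial>N) = (\<integral>\<eta>. F' \<eta> \<partial>N) \<and> all_moments N F \<and> all_moments N F'"
  proof (induction ts arbitrary: F F')
    case Nil
    then show ?case by (auto intro: amf)
  next
    case (Cons t ts)
    obtain k cs where t: "t = (k, cs)" by (cases t)
    define G where "G = (\<lambda>\<eta>. \<Sum>(k, cs)\<leftarrow>ts. k * form_prod cs \<eta>)"
    define G' where "G' = (\<lambda>\<eta>. \<Sum>(k, cs)\<leftarrow>ts. k * form_deriv a cs \<eta>)"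
    have IH: "(\<integral>\<eta>. form a \<eta> * G \<eta> \<partial>N) = (\<integral>\<eta>. G' \<eta> \<partial>N)" "all_moments N G" "all_moments N G'"
      using Cons.IH[OF G_def G'_def] by auto
    have F: "F = (\<lambda>\<eta>. k * form_prod cs \<eta> + G \<eta>)" "F' = (\<lambda>\<eta>. k * form_deriv a cs \<eta> + G' \<eta>)"
      using Cons.prems by (simp_all add: t G_def G'_def)
    have "(\<integral>\<eta>. form a \<eta> * F \<eta> \<partial>N) = (\<integral>\<eta>. k * (form a \<eta> * form_prod cs \<eta>) + form a \<eta> * G \<eta> \<partial>N)"
      by (simp add: F algebra_simps)
    also have "\<dots> = (\<integral>\<eta>. k * (form a \<eta> * form_prod cs \<eta>) \<partial>N) + (\<integral>\<eta>. form a \<eta> * G \<eta> \<partial>N)"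
      by (intro Bochner_Integration.integral_add all_moments_integrable amp IH)
    also have "\<dots> = (\<integral>\<eta>. k * form_deriv a cs \<eta> \<partial>N) + (\<integral>\<eta>. G' \<eta> \<partial>N)"
      by (simp add: wick IH)
    also have "\<dots> = (\<integral>\<eta>. F' \<eta> \<partial>N)"
      unfolding F by (intro Bochner_Integration.integral_add[symmetric] all_moments_integrable amp IH)
    finally show ?case
      unfolding F by (auto intro!: amp IH)
  qed
  then show ?thesis by simp
qed

end

subsection \<open>Covariance contractions\<close>

text \<open>The trace of \<open>shift_deriv\<close> against a further letter, with the products of
  entries of the two letters replaced by an array \<open>V\<close> that stands for their
  covariances. Gaussian and summands both reduce to it and are then compared through the arrays
  alone. A single sum over tuples lets linearity and integration act in one step.\<close>

definition cov_form :: "('n \<Rightarrow> 'n \<Rightarrow> 'n \<Rightarrow> 'n \<Rightarrow> complex) \<Rightarrow> complex list \<Rightarrow> complex ^ 'n ^ 'n \<Rightarrow> complex" where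
  "cov_form V cs x = (\<Sum>(i, j, k, a, b)\<in>UNIV \<times> UNIV \<times> {..<length cs} \<times> UNIV \<times> UNIV.
     shift_prod (take k cs) x $ i $ a * shift_prod (drop (Suc k) cs) x $ b $ j * V a b j i)"

lemma shift_deriv_nth:
  "shift_deriv cs x H $ i $ j = (\<Sum>k<length cs. \<Sum>a\<in>UNIV. \<Sum>b\<in>UNIV.
      shift_prod (take k cs) x $ i $ a * shift_prod (drop (Suc k) cs) x $ b $ j * H $ a $ b)"
proof -
  have "shift_deriv cs x H $ i $ j = (\<Sum>k<length cs. \<Sum>b\<in>UNIV. \<Sum>a\<in>UNIV.
      shift_prod (take k cs) x $ i $ a * shift_prod (drop (Suc k) cs) x $ b $ j * H $ a $ b)"
    unfolding shift_deriv_eq_sum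
    by (simp add: matrix_matrix_mult_def sum_distrib_right sum_distrib_left mult_ac)
  then show ?thesis by (subst sum.swap)
qed

lemma cov_form_eq_sum:
  "cov_form V cs x = (\<Sum>i\<in>UNIV. \<Sum>j\<in>UNIV. shift_deriv cs x (\<chi> a b. V a b j i) $ i $ j)"
  unfolding cov_form_def shift_deriv_nth by (simp add: sum.cartesian_product)

lemma trace_shift_deriv_mult:
  "trace (shift_deriv cs x H ** K) = cov_form (\<lambda>a b j i. H $ a $ b * K $ j $ i) cs x"
  unfolding cov_form_eq_sum trace_def matrix_matrix_mult_def vec_lambda_beta
  by (simp add: shift_deriv_nth sum_distrib_right sum_distrib_left mult_ac)

lemma cov_form_sum: "cov_form (\<lambda>a b j i. \<Sum>n\<in>I. V n a b j i) cs x = (\<Sum>n\<in>I. cov_form (V n) cs x)"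
  unfolding cov_form_def by (subst sum.swap) (simp add: sum_distrib_left case_prod_unfold)

lemma all_moments_nth:
  fixes f :: "'a \<Rightarrow> complex ^ 'n ^ 'm"
  shows "all_moments M f \<Longrightarrow> all_moments M (\<lambda>x. f x $ i $ j)"
  by (rule all_moments_linear[OF bounded_linear_compose[OF bounded_linear_vec_nth bounded_linear_vec_nth]])

lemma all_moments_cov_form:
  assumes "finite_measure M" "all_moments M x"
  shows "all_moments M (\<lambda>z. cov_form V cs (x z))"
  unfolding cov_form_def case_prod_unfold
  by (intro all_moments_sum all_moments_mult all_moments_nth all_moments_shift_prod all_moments_const assms)

lemma integral_nth:
  fixes f :: "'a \<Rightarrow> complex ^ 'n ^ 'm"
  assumes "integrable M f"
  shows "(\<integral>x. f x \<partial>M) $ i $ j = (\<integral>x. f x $ i $ j \<partial>M)"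
  using integral_bounded_linear[OF bounded_linear_compose[OF bounded_linear_vec_nth bounded_linear_vec_nth]
      assms, of i j]
  by simp

section \<open>Averaging over the independent letter\<close>

context exchange
begin

lemma integral_T_factor:
  fixes \<phi> :: "'a \<Rightarrow> 'b \<Rightarrow> complex" and \<psi> :: "'b \<Rightarrow> complex"
  assumes \<phi>: "all_moments T (\<lambda>z. \<phi> (fst z) (fst (snd z)))" and \<psi>: "all_moments B \<psi>"
  shows "(\<integral>z. \<phi> (fst z) (fst (snd z)) * \<psi> (snd (snd z)) \<partial>T)
     = (\<integral>z. \<phi> (fst z) (fst (snd z)) \<partial>T) * (\<integral>b. \<psi> b \<partial>B)"
proof -
  have \<psi>': "all_moments T (\<lambda>z. \<psi> (snd (snd z)))"
    unfolding T_def
    by (intro all_moments_snd[where f="\<lambda>b. \<psi> (snd b)"] all_moments_snd \<psi> BB_prob A.prob_space_axioms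
        B.prob_space_axioms)
  define f where "f z = \<phi> (fst z) (fst (snd z))" for z :: "'a \<times> 'b \<times> 'b"
  define g where "g z = \<phi> (fst z) (fst (snd z)) * \<psi> (snd (snd z))" for z :: "'a \<times> 'b \<times> 'b"
  have intf: "integrable (A \<Otimes>\<^sub>M (B \<Otimes>\<^sub>M B)) f"
    unfolding f_def T_def[symmetric] by (intro all_moments_integrable \<phi>)
  have intg: "integrable (A \<Otimes>\<^sub>M (B \<Otimes>\<^sub>M B)) g"
    unfolding g_def T_def[symmetric] by (intro all_moments_integrable all_moments_mult \<phi> \<psi>')
  have "(\<integral>z. g z \<partial>T) = (\<integral>a. (\<integral>c. g (a, c) \<partial>(B \<Otimes>\<^sub>M B)) \<partial>A)"
    unfolding T_def by (rule ABB.integral_fst'[OF intg, symmetric])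
  also have "\<dots> = (\<integral>a. (\<integral>c. f (a, c) \<partial>(B \<Otimes>\<^sub>M B)) * (\<integral>b. \<psi> b \<partial>B) \<partial>A)"
  proof (rule integral_cong_AE)
    show "(\<lambda>a. \<integral>c. g (a, c) \<partial>(B \<Otimes>\<^sub>M B)) \<in> borel_measurable A"
      using ABB.integrable_fst'[OF intg] by simp
    show "(\<lambda>a. (\<integral>c. f (a, c) \<partial>(B \<Otimes>\<^sub>M B)) * (\<integral>b. \<psi> b \<partial>B)) \<in> borel_measurable A"
      using ABB.integrable_fst'[OF intf] by simp
    show "AE a in A. (\<integral>c. g (a, c) \<partial>(B \<Otimes>\<^sub>M B)) = (\<integral>c. f (a, c) \<partial>(B \<Otimes>\<^sub>M B)) * (\<integral>b. \<psi> b \<partial>B)"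
      using ABB.AE_integrable_fst'[OF intf] ABB.AE_integrable_fst'[OF intg]
    proof eventually_elim
      case (elim a)
      have "(\<integral>c. g (a, c) \<partial>(B \<Otimes>\<^sub>M B)) = (\<integral>b. (\<integral>b'. g (a, b, b') \<partial>B) \<partial>B)"
        by (rule BB.integral_fst'[OF elim(2), symmetric])
      also have "\<dots> = (\<integral>b. \<phi> a b \<partial>B) * (\<integral>b. \<psi> b \<partial>B)"
        by (simp add: g_def)
      also have "(\<integral>b. \<phi> a b \<partial>B) = (\<integral>b. (\<integral>b'. f (a, b, b') \<partial>B) \<partial>B)"
        by (simp add: f_def B.prob_space)
      also have "\<dots> = (\<integral>c. f (a, c) \<partial>(B \<Otimes>\<^sub>M B))"
        by (rule BB.integral_fst'[OF elim(1)])
      finally show ?case .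
    qed
  qed
  also have "\<dots> = (\<integral>a. (\<integral>c. f (a, c) \<partial>(B \<Otimes>\<^sub>M B)) \<partial>A) * (\<integral>b. \<psi> b \<partial>B)"
    by simp
  also have "(\<integral>a. (\<integral>c. f (a, c) \<partial>(B \<Otimes>\<^sub>M B)) \<partial>A) = (\<integral>z. f z \<partial>T)"
    unfolding T_def by (rule ABB.integral_fst'[OF intf])
  finally show ?thesis by (simp add: f_def g_def)
qed

text \<open>Both occurrences of \<open>yb\<close> are independent of \<open>xa\<close>, so their
  joint second moments factor out.\<close>

lemma integral_deriv_cov:
  "(\<integral>z. trace (shift_deriv cs (xa z) (yb z) ** yb z) \<partial>T)
     = (\<integral>z. cov_form (\<lambda>a b j i. \<integral>\<omega>. y \<omega> $ a $ b * y \<omega> $ j $ i \<partial>B) cs (xa z) \<partial>T)"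
proof -
  have *: "(\<integral>z. shift_prod as (xa z) $ i $ a * shift_prod bs (xa z) $ b $ j * (yb z $ a $ b * yb z $ j $ i) \<partial>T)
    = (\<integral>z. shift_prod as (xa z) $ i $ a * shift_prod bs (xa z) $ b $ j \<partial>T) * (\<integral>\<omega>. y \<omega> $ a $ b * y \<omega> $ j $ i \<partial>B)"
        for as bs i a b j
    unfolding xa_def ya_def yb_def
    by (rule integral_T_factor) ((unfold ya_def[symmetric] xa_def[symmetric])?, (intro all_moments_mult
        all_moments_nth am am_y)[1])+
  show ?thesis
    unfolding trace_shift_deriv_mult cov_form_def case_prod_unfold
    by (subst (1 2) Bochner_Integration.integral_sum)
       (auto intro!: all_moments_integrable all_moments_mult all_moments_nth am all_moments_const sum.cong simp: *)
qed

lemma q'_eq: "q' m = (\<integral>z. Re (trace ((\<integral>\<omega>. y \<omega> ** y \<omega> \<partial>B) ** resolvent_pow g m (xa z))) \<partial>T)"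
proof -
  have *: "(\<integral>z. resolvent_pow g m (xa z) $ k $ i * (yb z $ i $ j * yb z $ j $ k) \<partial>T)
    = (\<integral>z. resolvent_pow g m (xa z) $ k $ i \<partial>T) * (\<integral>\<omega>. y \<omega> $ i $ j * y \<omega> $ j $ k \<partial>B)" for i j k
    unfolding xa_def ya_def yb_def
    by (rule integral_T_factor) ((unfold ya_def[symmetric] xa_def[symmetric])?, (intro all_moments_mult
        all_moments_nth am am_y)[1])+
  have yy: "integrable B (\<lambda>\<omega>. y \<omega> ** y \<omega>)"
    by (intro all_moments_integrable am am_y)
  have "(\<integral>\<omega>. y \<omega> ** y \<omega> \<partial>B) $ i $ k = (\<Sum>j\<in>UNIV. \<integral>\<omega>. y \<omega> $ i $ j * y \<omega> $ j $ k \<partial>B)" for i k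
    unfolding integral_nth[OF yy] unfolding matrix_matrix_mult_def vec_lambda_beta
    by (rule Bochner_Integration.integral_sum) (intro all_moments_integrable all_moments_mult all_moments_nth am_y)
  note V = this
  have "q' m = Re (\<integral>z. trace (yb z ** yb z ** resolvent_pow g m (xa z)) \<partial>T)"
    unfolding q'_def quad_trace_def by (rule integral_Re) (intro all_moments_integrable am)
  also have "(\<integral>z. trace (yb z ** yb z ** resolvent_pow g m (xa z)) \<partial>T)
     = (\<integral>z. (\<Sum>(i, k, j)\<in>UNIV. resolvent_pow g m (xa z) $ k $ i * (yb z $ i $ j * yb z $ j $ k)) \<partial>T)"
    by (simp add: trace_def matrix_matrix_mult_def sum_distrib_left sum_distrib_right sum.cartesian_product mult_ac
      flip: UNIV_Times_UNIV)
  also have "\<dots> = (\<Sum>(i, k, j)\<in>UNIV. (\<integral>z. resolvent_pow g m (xa z) $ k $ i \<partial>T) * (\<integral>\<omega>. y \<omega> $ i $ j * y \<omega> $ j $ k \<partial>B))"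
    unfolding case_prod_unfold
    by (subst Bochner_Integration.integral_sum)
       (auto intro!: all_moments_integrable all_moments_mult all_moments_nth am simp: *)
  also have "\<dots> = (\<integral>z. (\<Sum>(i, k, j)\<in>UNIV. resolvent_pow g m (xa z) $ k $ i * (\<integral>\<omega>. y \<omega> $ i $ j * y \<omega> $ j $ k \<partial>B)) \<partial>T)"
    unfolding case_prod_unfold
    by (subst Bochner_Integration.integral_sum)
       (auto intro!: all_moments_integrable all_moments_mult all_moments_nth am all_moments_const)
  also have "\<dots> = (\<integral>z. trace ((\<integral>\<omega>. y \<omega> ** y \<omega> \<partial>B) ** resolvent_pow g m (xa z)) \<partial>T)"
  proof -
    have "(\<Sum>(i, k, j)\<in>UNIV. R $ k $ i * (\<integral>\<omega>. y \<omega> $ i $ j * y \<omega> $ j $ k \<partial>B)) = trace ((\<integral>\<omega>. y \<omega> ** y \<omega> \<partial>B) ** R)" for R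
      unfolding trace_def matrix_matrix_mult_def[of _ R] vec_lambda_beta V
      by (simp add: sum_distrib_left sum_distrib_right sum.cartesian_product mult_ac flip: UNIV_Times_UNIV)
    then show ?thesis by simp
  qed
  also have "Re \<dots> = (\<integral>z. Re (trace ((\<integral>\<omega>. y \<omega> ** y \<omega> \<partial>B) ** resolvent_pow g m (xa z))) \<partial>T)"
    by (rule integral_Re[symmetric]) (intro all_moments_integrable am all_moments_const)
  finally show ?thesis .
qed

text \<open>Expectations that involve \<open>w\<close> and the first copy depend only on the product
  of the two laws. Thus the locale, which uses fresh copies, applies to independent variables on a
  common space.\<close>

lemma integral_T_pair:
  fixes F :: "(complex ^ 'n ^ 'n) \<times> (complex ^ 'n ^ 'n) \<Rightarrow> 'c::{banach, second_countable_topology}"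
  assumes F: "F \<in> borel_measurable (borel \<Otimes>\<^sub>M borel)"
  shows "(\<integral>z. F (w (fst z), y (fst (snd z))) \<partial>T) = (\<integral>u. F u \<partial>(distr A borel w \<Otimes>\<^sub>M distr B borel y))"
proof -
  have [measurable]: "w \<in> borel_measurable A" "y \<in> borel_measurable B"
    using w(1) y(1) by (auto simp: all_moments_def)
  have "distr (B \<Otimes>\<^sub>M B) borel (\<lambda>c. y (fst c)) = distr (distr (B \<Otimes>\<^sub>M B) B fst) borel y"
    by (subst distr_distr) (auto simp: o_def)
  then have Y: "distr (B \<Otimes>\<^sub>M B) borel (\<lambda>c. y (fst c)) = distr B borel y"
    by (simp add: B.distr_pair_fst)
  have "distr A borel w \<Otimes>\<^sub>M distr B borel y = distr T (borel \<Otimes>\<^sub>M borel) (\<lambda>(a, c). (w a, y (fst c)))"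
    unfolding T_def Y[symmetric]
    by (rule pair_measure_distr) (auto simp: Y intro!: prob_space_imp_sigma_finite B.prob_space_distr)
  then have "(\<integral>u. F u \<partial>(distr A borel w \<Otimes>\<^sub>M distr B borel y))
      = (\<integral>u. F u \<partial>(distr T (borel \<Otimes>\<^sub>M borel) (\<lambda>(a, c). (w a, y (fst c)))))"
    by simp
  also have "\<dots> = (\<integral>z. F (case z of (a, c) \<Rightarrow> (w a, y (fst c))) \<partial>T)"
    by (rule integral_distr[OF _ F]) (simp add: T_def)
  finally show ?thesis by (simp add: case_prod_unfold)
qed

end

section \<open>Measurability, and independence on a product space\<close>

lemma measurable_matrix_mult [measurable (raw)]:
  fixes f g :: "'a \<Rightarrow> complex ^ 'n ^ 'n"
  assumes "f \<in> borel_measurable M" "g \<in> borel_measurable M"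
  shows "(\<lambda>x. f x ** g x) \<in> borel_measurable M"
  by (rule borel_measurable_continuous_Pair[OF assms])
     (auto intro!: bounded_bilinear.continuous_on[OF bounded_bilinear_matrix_mult] continuous_intros)

lemma measurable_trace [measurable (raw)]:
  fixes f :: "'a \<Rightarrow> complex ^ 'n ^ 'n"
  assumes "f \<in> borel_measurable M"
  shows "(\<lambda>x. trace (f x)) \<in> borel_measurable M"
  by (rule borel_measurable_continuous_on[OF linear_continuous_on[OF bounded_linear_trace] assms])

lemma measurable_nth_nth [measurable (raw)]:
  fixes f :: "'a \<Rightarrow> complex ^ 'n ^ 'm"
  assumes "f \<in> borel_measurable M"
  shows "(\<lambda>x. f x $ i $ j) \<in> borel_measurable M"
  by (rule borel_measurable_continuous_on[OF linear_continuous_on assms])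
     (rule bounded_linear_compose[OF bounded_linear_vec_nth bounded_linear_vec_nth])

lemma measurable_shift_prod [measurable (raw)]:
  fixes f :: "'a \<Rightarrow> complex ^ 'n ^ 'n"
  assumes [measurable]: "f \<in> borel_measurable M"
  shows "(\<lambda>x. shift_prod cs (f x)) \<in> borel_measurable M"
  by (induction cs) simp_all

lemma measurable_cov_form [measurable (raw)]:
  fixes f :: "'a \<Rightarrow> complex ^ 'n ^ 'n"
  assumes [measurable]: "f \<in> borel_measurable M"
  shows "(\<lambda>x. cov_form V cs (f x)) \<in> borel_measurable M"
  unfolding cov_form_def case_prod_unfold by measurable

text \<open>Without the summand under exchange, the interpolating matrix mixes the other summands
  with the Gaussian from the second factor. For a fixed second coordinate the independence of
  \<open>U\<close> and \<open>Y\<close> splits the measure of a section; integrating over that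
  coordinate concludes.\<close>

lemma indep_var_product_space:
  fixes U Y :: "'a \<Rightarrow> 'm::topological_space" and h :: "'m \<times> 'b \<Rightarrow> 'm"
  assumes M: "prob_space M" and N: "prob_space N" and UY: "prob_space.indep_var M borel U borel Y"
    and h[measurable]: "h \<in> borel_measurable (borel \<Otimes>\<^sub>M N)"
  shows "prob_space.indep_var (M \<Otimes>\<^sub>M N) borel (\<lambda>z. h (U (fst z), snd z)) borel (\<lambda>z. Y (fst z))"
proof -
  interpret M: prob_space M by fact
  interpret N: prob_space N by fact
  interpret MN: pair_prob_space M N ..
  have [measurable]: "U \<in> borel_measurable M" "Y \<in> borel_measurable M"
    using UY M.indep_var_rv1 M.indep_var_rv2 by blast+
  define W where "W z = h (U (fst z), snd z)" for z
  have [measurable]: "W \<in> borel_measurable (M \<Otimes>\<^sub>M N)" unfolding W_def by measurable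
  have eq: "emeasure (M \<Otimes>\<^sub>M N) ({z \<in> space (M \<Otimes>\<^sub>M N). W z \<in> C} \<inter> {z \<in> space (M \<Otimes>\<^sub>M N). Y (fst z) \<in> D})
     = emeasure (M \<Otimes>\<^sub>M N) {z \<in> space (M \<Otimes>\<^sub>M N). W z \<in> C} * emeasure M {\<omega> \<in> space M. Y \<omega> \<in> D}"
    if CD[measurable]: "C \<in> sets borel" "D \<in> sets borel" for C D
  proof -
    have s: "emeasure M ((\<lambda>\<omega>. (\<omega>, \<eta>)) -` ({z \<in> space (M \<Otimes>\<^sub>M N). W z \<in> C} \<inter> {z \<in> space (M \<Otimes>\<^sub>M N). Y (fst z) \<in> D}))
      = emeasure M ((\<lambda>\<omega>. (\<omega>, \<eta>)) -` {z \<in> space (M \<Otimes>\<^sub>M N). W z \<in> C}) * emeasure M {\<omega> \<in> space M. Y \<omega> \<in> D}"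
      if \<eta>: "\<eta> \<in> space N" for \<eta>
    proof -
      have [measurable]: "(\<lambda>u. h (u, \<eta>)) \<in> borel_measurable borel"
        using \<eta> by measurable
      define C' where "C' = (\<lambda>u. h (u, \<eta>)) -` C"
      have C': "C' \<in> sets borel" unfolding C'_def using measurable_sets[of "\<lambda>u. h (u, \<eta>)" borel borel C] by simp
      have 1: "(\<lambda>\<omega>. (\<omega>, \<eta>)) -` ({z \<in> space (M \<Otimes>\<^sub>M N). W z \<in> C} \<inter> {z \<in> space (M \<Otimes>\<^sub>M N). Y (fst z) \<in> D})
         = (U -` C' \<inter> space M) \<inter> (Y -` D \<inter> space M)"
        using \<eta> by (auto simp: space_pair_measure W_def C'_def)
      have 2: "(\<lambda>\<omega>. (\<omega>, \<eta>)) -` {z \<in> space (M \<Otimes>\<^sub>M N). W z \<in> C} = U -` C' \<inter> space M"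
        using \<eta> by (auto simp: space_pair_measure W_def C'_def)
      have 3: "{\<omega> \<in> space M. Y \<omega> \<in> D} = Y -` D \<inter> space M" by auto
      have "emeasure M ((U -` C' \<inter> space M) \<inter> (Y -` D \<inter> space M))
          = emeasure M (U -` C' \<inter> space M) * emeasure M (Y -` D \<inter> space M)"
      proof -
        have "(U -` C' \<inter> space M) \<inter> (Y -` D \<inter> space M) = (\<lambda>x. (U x, Y x)) -` (C' \<times> D) \<inter> space M"
          by auto
        then show ?thesis
          using M.indep_varD[OF UY C' CD(2)] by (simp add: M.emeasure_eq_measure ennreal_mult[symmetric])
      qed
      then show ?thesis unfolding 1 2 3 .
    qed
    have "emeasure (M \<Otimes>\<^sub>M N) ({z \<in> space (M \<Otimes>\<^sub>M N). W z \<in> C} \<inter> {z \<in> space (M \<Otimes>\<^sub>M N). Y (fst z) \<in> D})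
      = (\<integral>\<^sup>+ \<eta>. emeasure M ((\<lambda>\<omega>. (\<omega>, \<eta>)) -` {z \<in> space (M \<Otimes>\<^sub>M N). W z \<in> C}) * emeasure M {\<omega> \<in> space M. Y \<omega> \<in> D} \<partial>N)"
      by (subst MN.emeasure_pair_measure_alt2, measurable) (rule nn_integral_cong, rule s)
    also have "\<dots> = (\<integral>\<^sup>+ \<eta>. emeasure M ((\<lambda>\<omega>. (\<omega>, \<eta>)) -` {z \<in> space (M \<Otimes>\<^sub>M N). W z \<in> C}) \<partial>N) * emeasure M {\<omega> \<in>
        space M. Y \<omega> \<in> D}"
      by (rule nn_integral_multc) (intro MN.measurable_emeasure_Pair2, measurable)
    also have "(\<integral>\<^sup>+ \<eta>. emeasure M ((\<lambda>\<omega>. (\<omega>, \<eta>)) -` {z \<in> space (M \<Otimes>\<^sub>M N). W z \<in> C}) \<partial>N)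
        = emeasure (M \<Otimes>\<^sub>M N) {z \<in> space (M \<Otimes>\<^sub>M N). W z \<in> C}"
      by (rule MN.emeasure_pair_measure_alt2[symmetric]) measurable
    finally show ?thesis .
  qed
  have Y: "emeasure M {\<omega> \<in> space M. Y \<omega> \<in> D} = emeasure (M \<Otimes>\<^sub>M N) {z \<in> space (M \<Otimes>\<^sub>M N). Y (fst z) \<in> D}"
    if "D \<in> sets borel" for D
    using eq[of UNIV D] that MN.P.emeasure_space_1 by simp
  show ?thesis
    unfolding W_def[symmetric] MN.P.indep_var_distribution_eq
  proof (intro conjI)
    show "distr (M \<Otimes>\<^sub>M N) borel W \<Otimes>\<^sub>M distr (M \<Otimes>\<^sub>M N) borel (\<lambda>z. Y (fst z))
      = distr (M \<Otimes>\<^sub>M N) (borel \<Otimes>\<^sub>M borel) (\<lambda>x. (W x, Y (fst x)))"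
    proof (rule pair_measure_eqI)
      show "sigma_finite_measure (distr (M \<Otimes>\<^sub>M N) borel W)" "sigma_finite_measure (distr (M \<Otimes>\<^sub>M N) borel (\<lambda>z. Y
          (fst z)))"
        by (intro prob_space_imp_sigma_finite MN.P.prob_space_distr, measurable)+
      fix C D assume "C \<in> sets (distr (M \<Otimes>\<^sub>M N) borel W)" "D \<in> sets (distr (M \<Otimes>\<^sub>M N) borel (\<lambda>z. Y (fst z)))"
      then have [measurable]: "C \<in> sets borel" "D \<in> sets borel" by auto
      have "emeasure (distr (M \<Otimes>\<^sub>M N) (borel \<Otimes>\<^sub>M borel) (\<lambda>x. (W x, Y (fst x)))) (C \<times> D)
        = emeasure (M \<Otimes>\<^sub>M N) ({z \<in> space (M \<Otimes>\<^sub>M N). W z \<in> C} \<inter> {z \<in> space (M \<Otimes>\<^sub>M N). Y (fst z) \<in> D})"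
        by (subst emeasure_distr) (auto intro!: arg_cong[where f="emeasure _"])
      then show "emeasure (distr (M \<Otimes>\<^sub>M N) borel W) C * emeasure (distr (M \<Otimes>\<^sub>M N) borel (\<lambda>z. Y (fst z))) D
        = emeasure (distr (M \<Otimes>\<^sub>M N) (borel \<Otimes>\<^sub>M borel) (\<lambda>x. (W x, Y (fst x)))) (C \<times> D)"
        unfolding eq[OF \<open>C \<in> sets borel\<close> \<open>D \<in> sets borel\<close>] Y[OF \<open>D \<in> sets borel\<close>]
        by (simp add: emeasure_distr vimage_def Int_def conj_commute)
    qed simp
  qed measurable
qed

subsection \<open>Differentiation under the integral\<close>

text \<open>The bound \<open>K\<close> on the derivatives makes \<open>F\<close> Lipschitz in the
  parameter. Hence \<open>2 * K\<close> dominates the remainder quotient, and dominated convergence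
  along sequences applies.\<close>

lemma has_vector_derivative_integral:
  fixes F :: "real \<Rightarrow> 'a \<Rightarrow> 'b::{banach, second_countable_topology}"
  assumes int: "\<And>t. integrable M (F t)"
    and der: "\<And>t x. x \<in> space M \<Longrightarrow> ((\<lambda>t. F t x) has_vector_derivative F' t x) (at t)"
    and meas: "\<And>t. F' t \<in> borel_measurable M"
    and bnd: "\<And>t x. x \<in> space M \<Longrightarrow> norm (F' t x) \<le> K x" and K: "integrable M K"
  shows "((\<lambda>t. \<integral>x. F t x \<partial>M) has_vector_derivative (\<integral>x. F' t x \<partial>M)) (at t)"
proof -
  have intF': "integrable M (F' t)" for t
  proof (rule Bochner_Integration.integrable_bound[OF K meas], rule AE_I2)
    show "norm (F' t x) \<le> norm (K x)" if "x \<in> space M" for x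
      using bnd[OF that, of t] by (simp add: order_trans[OF _ abs_ge_self])
  qed
  have lip: "norm (F (t + h) x - F t x) \<le> K x * \<bar>h\<bar>" if "x \<in> space M" for h x
  proof -
    have "norm (F (t + h) x - F t x) \<le> K x * norm (t + h - t)"
    proof (rule differentiable_bound[OF convex_UNIV])
      show "((\<lambda>t. F t x) has_derivative (\<lambda>h. h *\<^sub>R F' u x)) (at u within UNIV)" for u
        using der[OF that] by (simp add: has_vector_derivative_def)
      show "onorm (\<lambda>h. h *\<^sub>R F' u x) \<le> K x" for u
        using bnd[OF that, of u] by (simp add: onorm_scaleR_left[OF bounded_linear_ident] onorm_id[unfolded id_def])
    qed auto
    then show ?thesis by simp
  qed
  \<comment> \<open>At \<open>h = 0\<close> the quotient is 0 by division by zero, so the comparison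
    of integrals below holds for every \<open>h\<close>.\<close>
  define q where "q h x = norm (F (t + h) x - F t x - h *\<^sub>R F' t x) / \<bar>h\<bar>" for h x
  have [measurable]: "F t \<in> borel_measurable M" "F' t \<in> borel_measurable M" for t
    using int[of t] meas[of t] by auto
  have lim: "((\<lambda>h. \<integral>x. q h x \<partial>M) \<longlongrightarrow> 0) (at 0)"
    unfolding tendsto_at_iff_sequentially
  proof (intro allI impI)
    fix H :: "nat \<Rightarrow> real" assume H: "\<forall>i. H i \<in> UNIV - {0}" "H \<longlonglongrightarrow> 0"
    have "(\<lambda>i. \<integral>x. q (H i) x \<partial>M) \<longlonglongrightarrow> (\<integral>x. 0 \<partial>M)"
    proof (rule integral_dominated_convergence[where w="\<lambda>x. 2 * K x"])
      show "AE x in M. (\<lambda>i. q (H i) x) \<longlonglongrightarrow> 0"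
      proof (rule AE_I2)
        fix x assume "x \<in> space M"
        from der[OF this, of t] have "(\<lambda>h. q h x) \<midarrow>0\<rightarrow> 0"
          by (simp add: has_vector_derivative_def has_derivative_at q_def)
        with H show "(\<lambda>i. q (H i) x) \<longlonglongrightarrow> 0"
          unfolding tendsto_at_iff_sequentially by (auto simp: o_def)
      qed
      show "AE x in M. norm (q (H i) x) \<le> 2 * K x" for i
      proof (rule AE_I2)
        fix x assume x: "x \<in> space M"
        have "norm (H i *\<^sub>R F' t x) \<le> \<bar>H i\<bar> * K x"
          using bnd[OF x, of t] by (auto intro: mult_left_mono)
        then have "norm (F (t + H i) x - F t x - H i *\<^sub>R F' t x) \<le> K x * \<bar>H i\<bar> + \<bar>H i\<bar> * K x"
          using lip[OF x, of "H i"] norm_triangle_ineq4[of "F (t + H i) x - F t x" "H i *\<^sub>R F' t x"]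
          by linarith
        then show "norm (q (H i) x) \<le> 2 * K x"
          using H(1) by (simp add: q_def divide_le_eq mult_ac)
      qed
      show "integrable M (\<lambda>x. 2 * K x)" using K by simp
    qed (auto simp: q_def)
    then show "((\<lambda>h. \<integral>x. q h x \<partial>M) \<circ> H) \<longlonglongrightarrow> 0" by (simp add: o_def)
  qed
  have "(\<lambda>h. norm ((\<integral>x. F (t + h) x \<partial>M) - (\<integral>x. F t x \<partial>M) - h *\<^sub>R (\<integral>x. F' t x \<partial>M)) / norm h) \<midarrow>0\<rightarrow> 0"
  proof (rule tendsto_sandwich[OF _ _ tendsto_const lim])
    show "\<forall>\<^sub>F h in at 0. norm ((\<integral>x. F (t + h) x \<partial>M) - (\<integral>x. F t x \<partial>M) - h *\<^sub>R (\<integral>x. F' t x \<partial>M)) / norm h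
        \<le> (\<integral>x. q h x \<partial>M)"
    proof (rule always_eventually, rule allI)
      fix h
      have "(\<integral>x. F (t + h) x \<partial>M) - (\<integral>x. F t x \<partial>M) - h *\<^sub>R (\<integral>x. F' t x \<partial>M)
          = (\<integral>x. F (t + h) x - F t x - h *\<^sub>R F' t x \<partial>M)"
        by (simp add: int intF')
      then have "norm ((\<integral>x. F (t + h) x \<partial>M) - (\<integral>x. F t x \<partial>M) - h *\<^sub>R (\<integral>x. F' t x \<partial>M))
          \<le> (\<integral>x. norm (F (t + h) x - F t x - h *\<^sub>R F' t x) \<partial>M)"
        by (simp only: integral_norm_bound)
      then show "norm ((\<integral>x. F (t + h) x \<partial>M) - (\<integral>x. F t x \<partial>M) - h *\<^sub>R (\<integral>x. F' t x \<partial>M)) / norm h \<le> (\<integral>x. q h x \<partial>M)"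
        by (simp add: q_def divide_right_mono)
    qed
  qed simp
  then show ?thesis
    unfolding has_vector_derivative_def has_derivative_at by (simp add: bounded_linear_scaleR_left)
qed

lemma has_vector_derivative_shift_prod:
  assumes "(x has_vector_derivative x') (at t)"
  shows "((\<lambda>t. shift_prod cs (x t)) has_vector_derivative shift_deriv cs (x t) x') (at t)"
proof (induction cs)
  case (Cons c cs)
  have "((\<lambda>t. x t + mat c) has_vector_derivative x') (at t)"
    using has_vector_derivative_add[OF assms has_vector_derivative_const[of "mat c"]] by simp
  from bounded_bilinear.has_vector_derivative[OF bounded_bilinear_matrix_mult this Cons]
  show ?case by (simp add: add.commute)
qed simp



section \<open>Polynomial majorants for words\<close>

definition mat_norm :: "'n::finite itself \<Rightarrow> complex \<Rightarrow> real" where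
  "mat_norm n c = norm (mat c :: complex ^ 'n ^ 'n)"

text \<open>A polynomial in a bound on the size of \<open>x\<close>, so that domination is uniform
  in the angle and the majorant has all moments. The \<open>itself\<close> argument carries the
  dimension, which no other argument mentions.\<close>

primrec prod_bound :: "'n::finite itself \<Rightarrow> complex list \<Rightarrow> real \<Rightarrow> real" where
  "prod_bound n [] r = mat_norm n 1"
| "prod_bound n (c # cs) r = (r + mat_norm n c) * prod_bound n cs r"

primrec deriv_bound :: "'n::finite itself \<Rightarrow> complex list \<Rightarrow> real \<Rightarrow> real" where
  "deriv_bound n [] r = 0"
| "deriv_bound n (c # cs) r = r * prod_bound n cs r + (r + mat_norm n c) * deriv_bound n cs r"

lemma norm_shift_prod_le:
  fixes x :: "complex ^ 'n ^ 'n"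
  assumes "norm x \<le> r"
  shows "norm (shift_prod cs x) \<le> prod_bound TYPE('n) cs r"
proof (induction cs)
  case (Cons c cs)
  have r: "0 \<le> r" using assms norm_ge_zero order_trans by blast
  have "norm ((x + mat c) ** shift_prod cs x) \<le> norm (x + mat c) * norm (shift_prod cs x)"
    by (rule norm_matrix_mult_le)
  also have "\<dots> \<le> (r + mat_norm TYPE('n) c) * prod_bound TYPE('n) cs r"
    using assms Cons norm_triangle_ineq[of x "mat c"] r
    by (intro mult_mono) (auto simp: mat_norm_def)
  finally show ?case by simp
qed (simp add: mat_norm_def)

lemma norm_shift_deriv_le:
  fixes x H :: "complex ^ 'n ^ 'n"
  assumes "norm x \<le> r" "norm H \<le> r"
  shows "norm (shift_deriv cs x H) \<le> deriv_bound TYPE('n) cs r"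
proof (induction cs)
  case (Cons c cs)
  have r: "0 \<le> r" using assms norm_ge_zero order_trans by blast
  have "norm (H ** shift_prod cs x) \<le> norm H * norm (shift_prod cs x)"
    by (rule norm_matrix_mult_le)
  also have "\<dots> \<le> r * prod_bound TYPE('n) cs r"
    using assms norm_shift_prod_le[OF assms(1)] r by (intro mult_mono) auto
  finally have 1: "norm (H ** shift_prod cs x) \<le> r * prod_bound TYPE('n) cs r" .
  have "norm ((x + mat c) ** shift_deriv cs x H) \<le> norm (x + mat c) * norm (shift_deriv cs x H)"
    by (rule norm_matrix_mult_le)
  also have "\<dots> \<le> (r + mat_norm TYPE('n) c) * deriv_bound TYPE('n) cs r"
    using assms Cons norm_triangle_ineq[of x "mat c"] r
    by (intro mult_mono) (auto simp: mat_norm_def)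
  finally show ?case using 1 by (auto intro: norm_triangle_le)
qed simp

lemma all_moments_deriv_bound:
  assumes "finite_measure M" "all_moments M R"
  shows "all_moments M (\<lambda>z. deriv_bound n cs (R z))"
proof -
  have P: "all_moments M (\<lambda>z. prod_bound n cs (R z))" for cs
    by (induction cs) (auto intro!: all_moments_mult_real all_moments_add all_moments_const assms)
  show ?thesis
    by (induction cs) (auto intro!: all_moments_mult_real all_moments_add all_moments_const assms P)
qed

subsection \<open>Interpolating between the sum and the Gaussian matrix\<close>

lemma (in prob_space) indep_var_sum_rest:
  fixes X :: "'i \<Rightarrow> 'a \<Rightarrow> 'b::{second_countable_topology, real_normed_vector}"
  assumes I: "finite I" "i \<notin> I" and indep: "indep_vars (\<lambda>_. borel) X (insert i I)"
  shows "indep_var borel (\<lambda>\<omega>. \<Sum>j\<in>I. X j \<omega>) borel (X i)"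
proof -
  have "indep_var borel ((\<lambda>f. \<Sum>j\<in>I. f j) \<circ> (\<lambda>\<omega>. restrict (\<lambda>j. X j \<omega>) I)) borel ((\<lambda>f. f i) \<circ> (\<lambda>\<omega>. restrict (\<lambda>j. X
      j \<omega>) {i}))"
    using I by (intro indep_var_compose[OF indep_var_restrict[OF indep]]) auto
  also have "((\<lambda>f. f i) \<circ> (\<lambda>\<omega>. restrict (\<lambda>j. X j \<omega>) {i})) = X i"
    by auto
  also have "((\<lambda>f. \<Sum>j\<in>I. f j) \<circ> (\<lambda>\<omega>. restrict (\<lambda>j. X j \<omega>) I)) = (\<lambda>\<omega>. \<Sum>j\<in>I. X j \<omega>)"
    by (auto cong: rev_conj_cong)
  finally show ?thesis .
qed

text \<open>Gaussianity enters only through \<open>ibp\<close>, whose arbitrary matrix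
  \<open>C\<close> later holds everything that is frozen while integrating over \<open>N\<close>.
  The summands are bounded everywhere, not just almost surely; truncation will arrange this.\<close>

locale comparison =
  M: prob_space M + N: prob_space N for M :: "'a measure" and N :: "'b measure" +
  fixes Y :: "nat \<Rightarrow> 'a \<Rightarrow> complex ^ 'n ^ 'n" and G :: "'b \<Rightarrow> complex ^ 'n ^ 'n" and A :: "complex ^ 'n ^ 'n"
    and n p :: nat and l :: real
  assumes p: "1 \<le> p" and l: "0 < l"
    and indep: "M.indep_vars (\<lambda>_. borel) Y {1..n}"
    and Y: "\<And>i \<omega>. i \<in> {1..n} \<Longrightarrow> \<omega> \<in> space M \<Longrightarrow> self_adjoint (Y i \<omega>)"
      "\<And>i \<omega>. i \<in> {1..n} \<Longrightarrow> \<omega> \<in> space M \<Longrightarrow> op_le l (Y i \<omega>)"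
      "\<And>i. i \<in> {1..n} \<Longrightarrow> (\<integral>\<omega>. Y i \<omega> \<partial>M) = 0"
    and G: "all_moments N G" "\<And>\<eta>. \<eta> \<in> space N \<Longrightarrow> self_adjoint (G \<eta>)" "(\<integral>\<eta>. G \<eta> \<partial>N) = 0"
    and ibp: "\<And>cs C b. (\<integral>\<eta>. trace (shift_prod cs (C + b *\<^sub>R G \<eta>) ** G \<eta>) \<partial>N)
       = b *\<^sub>R (\<integral>\<eta>. cov_form (\<lambda>a b j i. \<integral>\<eta>. G \<eta> $ a $ b * G \<eta> $ j $ i \<partial>N) cs (C + b *\<^sub>R G \<eta>) \<partial>N)"
    and cov: "\<And>a b j i. (\<integral>\<eta>. G \<eta> $ a $ b * G \<eta> $ j $ i \<partial>N) = (\<Sum>k\<in>{1..n}. \<integral>\<omega>. Y k \<omega> $ a $ b * Y k \<omega> $ j $ i \<partial>M)"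
    and A: "self_adjoint A"
begin

definition g :: real where "g = 16 * real p * l"

lemma g: "0 < g" using p l by (simp add: g_def)

abbreviation \<Omega> :: "('a \<times> 'b) measure" where "\<Omega> \<equiv> M \<Otimes>\<^sub>M N"

sublocale MN: pair_prob_space M N ..

lemma Y_meas: "i \<in> {1..n} \<Longrightarrow> Y i \<in> borel_measurable M"
  using indep unfolding M.indep_vars_def by auto

lemma am_Y: "i \<in> {1..n} \<Longrightarrow> all_moments M (Y i)"
proof (rule all_moments_bounded)
  assume i: "i \<in> {1..n}"
  show "norm (Y i \<omega>) \<le> l * norm (mat 1 :: complex ^ 'n ^ 'n)" if "\<omega> \<in> space M" for \<omega>
    using op_le_norm_mult[OF Y(2)[OF i that], of "mat 1"] l by simp
qed (use Y_meas in \<open>auto intro: M.finite_measure_axioms\<close>)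

definition S :: "'a \<Rightarrow> complex ^ 'n ^ 'n" where "S \<omega> = (\<Sum>i\<in>{1..n}. Y i \<omega>)"

definition X :: "real \<Rightarrow> 'a \<times> 'b \<Rightarrow> complex ^ 'n ^ 'n" where
  "X \<theta> z = A + sin \<theta> *\<^sub>R S (fst z) + cos \<theta> *\<^sub>R G (snd z)"

definition X' :: "real \<Rightarrow> 'a \<times> 'b \<Rightarrow> complex ^ 'n ^ 'n" where
  "X' \<theta> z = cos \<theta> *\<^sub>R S (fst z) - sin \<theta> *\<^sub>R G (snd z)"

lemma fin: "finite_measure \<Omega>" by unfold_locales

lemma am_S: "all_moments \<Omega> (\<lambda>z. S (fst z))"
  unfolding S_def
  by (intro all_moments_sum fin all_moments_fst N.prob_space_axioms am_Y)

lemma am_Yi: "i \<in> {1..n} \<Longrightarrow> all_moments \<Omega> (\<lambda>z. Y i (fst z))"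
  by (intro all_moments_fst N.prob_space_axioms am_Y)

lemma am_G: "all_moments \<Omega> (\<lambda>z. G (snd z))"
  by (intro all_moments_snd N.prob_space_axioms M.prob_space_axioms G)

lemma am_X: "all_moments \<Omega> (X \<theta>)" and am_X': "all_moments \<Omega> (X' \<theta>)"
  unfolding X_def X'_def by (intro all_moments_intros all_moments_const fin am_S am_G)+

lemmas amc = all_moments_intros am_X am_X' am_S am_G fin

lemma sa_S: "\<omega> \<in> space M \<Longrightarrow> self_adjoint (S \<omega>)"
  using Y(1) by (simp add: S_def self_adjoint_def cadjoint_sum)

lemma sa_X: "z \<in> space \<Omega> \<Longrightarrow> self_adjoint (X \<theta> z)"
  unfolding X_def
  by (intro self_adjoint_add self_adjoint_scaleR A sa_S G(2)) (auto simp: space_pair_measure)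

definition f :: "real \<Rightarrow> real" where
  "f \<theta> = (\<integral>z. Re (trace (resolvent_pow g p (X \<theta> z))) \<partial>\<Omega>) / CARD('n)"

definition f' :: "real \<Rightarrow> real" where
  "f' \<theta> = (\<integral>z. Re (trace (shift_deriv (resolvent_shifts g p) (X \<theta> z) (X' \<theta> z))) \<partial>\<Omega>) / CARD('n)"

lemma DERIV_f: "DERIV f \<theta> :> f' \<theta>"
proof -
  \<comment> \<open>Independent of the angle, because sine and cosine are at most 1 in
    modulus.\<close>
  define R where "R z = norm A + norm (S (fst z)) + norm (G (snd z))" for z
  have amR: "all_moments \<Omega> R"
    unfolding R_def by (intro all_moments_add all_moments_norm all_moments_const amc)
  have XR: "norm (X \<theta> z) \<le> R z" for \<theta> z
  proof -
    have "norm (X \<theta> z) \<le> norm A + norm (sin \<theta> *\<^sub>R S (fst z)) + norm (cos \<theta> *\<^sub>R G (snd z))"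
      unfolding X_def by (intro norm_triangle_le add_mono order_refl)
    also have "\<dots> \<le> R z"
      unfolding R_def by (intro add_mono) (auto intro!: mult_left_le_one_le)
    finally show ?thesis .
  qed
  have X'R: "norm (X' \<theta> z) \<le> R z" for \<theta> z
  proof -
    have "norm (X' \<theta> z) \<le> norm (cos \<theta> *\<^sub>R S (fst z)) + norm (sin \<theta> *\<^sub>R G (snd z))"
      unfolding X'_def by (rule norm_triangle_ineq4)
    also have "\<dots> \<le> 0 + norm (S (fst z)) + norm (G (snd z))"
      by (simp, intro add_mono) (auto intro!: mult_left_le_one_le)
    also have "\<dots> \<le> R z" unfolding R_def by (intro add_mono) auto
    finally show ?thesis .
  qed
  let ?h = "\<lambda>x :: complex ^ 'n ^ 'n. Re (trace x)"
  have h: "bounded_linear ?h" by (intro bounded_linear_compose[OF bounded_linear_Re bounded_linear_trace])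
  obtain K where K: "\<And>x. norm (?h x) \<le> norm x * K" using bounded_linear.bounded[OF h] by blast
  have K0: "norm (?h x) \<le> norm x * \<bar>K\<bar>" for x
    by (rule order_trans[OF K]) (auto intro: mult_left_mono)
  have "((\<lambda>t. \<integral>z. ?h (resolvent_pow g p (X t z)) \<partial>\<Omega>) has_vector_derivative
      (\<integral>z. ?h (shift_deriv (resolvent_shifts g p) (X \<theta> z) (X' \<theta> z)) \<partial>\<Omega>)) (at \<theta>)"
  proof (rule has_vector_derivative_integral)
    show "integrable \<Omega> (\<lambda>z. ?h (resolvent_pow g p (X t z)))" for t
      by (intro all_moments_integrable amc)
    show "(\<lambda>z. ?h (shift_deriv (resolvent_shifts g p) (X t z) (X' t z))) \<in> borel_measurable \<Omega>" for t
      by (intro all_moments_measurable amc)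
    show "((\<lambda>t. ?h (resolvent_pow g p (X t z))) has_vector_derivative
        ?h (shift_deriv (resolvent_shifts g p) (X t z) (X' t z))) (at t)" for t z
    proof (rule bounded_linear.has_vector_derivative[OF h], rule has_vector_derivative_shift_prod)
      show "((\<lambda>t. X t z) has_vector_derivative X' t z) (at t)"
        unfolding X_def X'_def
        by (auto intro!: derivative_eq_intros has_vector_derivative_scaleR simp: algebra_simps)
    qed
    show "norm (?h (shift_deriv (resolvent_shifts g p) (X t z) (X' t z)))
        \<le> deriv_bound TYPE('n) (resolvent_shifts g p) (R z) * \<bar>K\<bar>" for t z
      by (rule order_trans[OF K0]) (intro mult_right_mono norm_shift_deriv_le XR X'R, simp)
    show "integrable \<Omega> (\<lambda>z. deriv_bound TYPE('n) (resolvent_shifts g p) (R z) * \<bar>K\<bar>)"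
      by (intro all_moments_integrable all_moments_mult_real all_moments_deriv_bound all_moments_const amR fin)
  qed
  then have "((\<lambda>t. \<integral>z. ?h (resolvent_pow g p (X t z)) \<partial>\<Omega>) has_field_derivative
      (\<integral>z. ?h (shift_deriv (resolvent_shifts g p) (X \<theta> z) (X' \<theta> z)) \<partial>\<Omega>)) (at \<theta>)"
    by (simp add: has_real_derivative_iff_has_vector_derivative)
  then show ?thesis
    unfolding f_def[abs_def] f'_def by (rule DERIV_cdivide)
qed

definition V :: "complex ^ 'n ^ 'n" where "V = (\<Sum>i\<in>{1..n}. \<integral>\<omega>. Y i \<omega> ** Y i \<omega> \<partial>M)"

text \<open>The quantity to which the numbers \<open>q'\<close> of all summands add up, normalized
  by the dimension.\<close>

definition v :: "real \<Rightarrow> nat \<Rightarrow> real" where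
  "v \<theta> m = (\<integral>z. Re (trace (V ** resolvent_pow g m (X \<theta> z))) \<partial>\<Omega>) / CARD('n)"

text \<open>All randomness except summand \<open>i\<close> is collected in \<open>W\<close>, which
  is independent of it. The exchange runs on fresh copies, but \<open>W\<close> and
  \<open>Y i\<close> have the same joint law there, so its integrals return to
  \<open>\<Omega>\<close> and \<open>q'\<close> becomes \<open>w\<close>.\<close>

lemma summand_bound:
  assumes i: "i \<in> {1..n}" and cs: "pm_shifts g cs" "length cs = 2 * p - 1" and h: "0 < h"
    and \<theta>: "0 \<le> sin \<theta>"
  defines "Vi \<equiv> (\<lambda>a b j k. \<integral>\<omega>. Y i \<omega> $ a $ b * Y i \<omega> $ j $ k \<partial>M)"
  defines "w m \<equiv> \<integral>z. Re (trace ((\<integral>\<omega>. Y i \<omega> ** Y i \<omega> \<partial>M) ** resolvent_pow g m (X \<theta> z))) \<partial>\<Omega>"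
  shows "cmod ((\<integral>z. trace (shift_prod cs (X \<theta> z) ** Y i (fst z)) \<partial>\<Omega>) - sin \<theta> *\<^sub>R (\<integral>z. cov_form Vi cs (X \<theta> z) \<partial>\<Omega>))
     \<le> 8 * real ((2 * p - 1) * (p - 1)) * (sin \<theta>)\<^sup>2 * l * (w (p - 1) / (2 * h) + h / 2 * w (p - 2))"
proof -
  define U where "U \<omega> = (\<Sum>j\<in>{1..n} - {i}. Y j \<omega>)" for \<omega>
  define W where "W z = A + sin \<theta> *\<^sub>R U (fst z) + cos \<theta> *\<^sub>R G (snd z)" for z
  have XW: "X \<theta> z = W z + sin \<theta> *\<^sub>R Y i (fst z)" for z
    unfolding X_def W_def S_def U_def using i by (subst sum.remove[of _ i]) (auto simp: algebra_simps)
  have amW: "all_moments \<Omega> W"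
    unfolding W_def U_def
    by (intro all_moments_intros all_moments_const fin am_G all_moments_sum am_Yi) auto
  interpret E: exchange \<Omega> M W "Y i" "sin \<theta>" l g
  proof unfold_locales
    show "self_adjoint (W z)" if "z \<in> space \<Omega>" for z
    proof -
      have "self_adjoint (U (fst z))"
        using that Y(1) unfolding U_def self_adjoint_def cadjoint_sum
        by (intro sum.cong) (auto simp: space_pair_measure)
      then show ?thesis
        using that unfolding W_def
        by (intro self_adjoint_add self_adjoint_scaleR A G(2)) (auto simp: space_pair_measure)
    qed
  qed (use i amW Y Y_meas \<theta> l g in auto)
  have UY: "M.indep_var borel U borel (Y i)"
    unfolding U_def
  proof (rule M.indep_var_sum_rest)
    have "insert i ({1..n} - {i}) = {1..n}" using i by auto
    then show "M.indep_vars (\<lambda>_. borel) Y (insert i ({1..n} - {i}))" using indep by simp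
  qed auto
  have [measurable]: "G \<in> borel_measurable N" "Y i \<in> borel_measurable M" "W \<in> borel_measurable \<Omega>"
    using G(1) Y_meas[OF i] amW by (auto simp: all_moments_def)
  have "MN.P.indep_var borel (\<lambda>z. (\<lambda>(u, \<eta>). A + sin \<theta> *\<^sub>R u
      + cos \<theta> *\<^sub>R G \<eta>) (U (fst z), snd z)) borel (\<lambda>z. Y i (fst z))"
    by (rule indep_var_product_space[OF M.prob_space_axioms N.prob_space_axioms UY]) measurable
  then have indW: "MN.P.indep_var borel W borel (\<lambda>z. Y i (fst z))"
    by (simp add: W_def[abs_def])
  have law: "distr \<Omega> borel W \<Otimes>\<^sub>M distr M borel (Y i) = distr \<Omega> (borel \<Otimes>\<^sub>M borel) (\<lambda>z. (W z, Y i (fst z)))"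
  proof -
    have "distr \<Omega> borel (\<lambda>z. Y i (fst z)) = distr (distr \<Omega> M fst) borel (Y i)"
      by (subst distr_distr) (auto simp: o_def)
    then have "distr \<Omega> borel (\<lambda>z. Y i (fst z)) = distr M borel (Y i)"
      by (simp add: N.distr_pair_fst)
    with indW show ?thesis by (simp add: MN.P.indep_var_distribution_eq)
  qed
  have transfer: "(\<integral>z. F (W (fst z), Y i (fst (snd z))) \<partial>E.T) = (\<integral>z. F (W z, Y i (fst z)) \<partial>\<Omega>)"
    if "F \<in> borel_measurable (borel \<Otimes>\<^sub>M borel)" for F :: "_ \<Rightarrow> 'c::{banach, second_countable_topology}"
    unfolding E.integral_T_pair[OF that] law by (rule integral_distr[OF _ that]) measurable
  have 1: "(\<integral>z. trace (shift_prod cs (E.xa z) ** E.ya z) \<partial>E.T)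
      = (\<integral>z. trace (shift_prod cs (X \<theta> z) ** Y i (fst z)) \<partial>\<Omega>)"
    using transfer[of "\<lambda>u. trace (shift_prod cs (fst u + sin \<theta> *\<^sub>R snd u) ** snd u)"]
    by (simp add: XW E.xa_def E.ya_def)
  have 2: "(\<integral>z. trace (shift_deriv cs (E.xa z) (E.yb z) ** E.yb z) \<partial>E.T) = (\<integral>z. cov_form Vi cs (X \<theta> z) \<partial>\<Omega>)"
    unfolding E.integral_deriv_cov
    using transfer[of "\<lambda>u. cov_form Vi cs (fst u + sin \<theta> *\<^sub>R snd u)"]
    by (simp add: XW E.xa_def E.ya_def Vi_def)
  have 3: "E.q' m = w m" for m
    unfolding E.q'_eq w_def
    using transfer[of "\<lambda>u. Re (trace ((\<integral>\<omega>. Y i \<omega> ** Y i \<omega> \<partial>M) ** resolvent_pow g m (fst u + sin \<theta> *\<^sub>R snd u)))"]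
    by (simp add: XW E.xa_def E.ya_def)
  show ?thesis
    using E.exchange_bound[OF cs p h] unfolding 1 2 3 by (simp add: g_def)
qed

end

subsection \<open>Trace inequalities of Young type\<close>

text \<open>Weighted arithmetic-geometric mean for \<open>z ^ p\<close> and 1, with denominators
  cleared so that induction on \<open>p\<close> starting at \<open>k\<close> applies.\<close>

lemma power_le_interpolation:
  fixes z :: real
  assumes z: "0 \<le> z" and kp: "k \<le> p"
  shows "real p * z ^ k \<le> real k * z ^ p + real (p - k)"
  using kp
proof (induction rule: dec_induct)
  case (step p)
  \<comment> \<open>A factor \<open>z - 1\<close> splits off the left side; the remaining terms
    \<open>z ^ j\<close> compare with \<open>z ^ p\<close> in the direction that the sign of
    \<open>z - 1\<close> requires.\<close>
  have *: "z ^ k - 1 \<le> real k * z ^ p * (z - 1)"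
  proof (cases "1 \<le> z")
    case True
    have "(\<Sum>j<k. z ^ j) \<le> (\<Sum>j<k. z ^ p)"
      using True step(1) by (intro sum_mono power_increasing) auto
    then have "(z - 1) * (\<Sum>j<k. z ^ j) \<le> (z - 1) * (real k * z ^ p)"
      using True by (intro mult_left_mono) auto
    then show ?thesis by (simp add: power_diff_1_eq mult_ac)
  next
    case False
    have "(\<Sum>j<k. z ^ p) \<le> (\<Sum>j<k. z ^ j)"
      using False step(1) z by (intro sum_mono power_decreasing) auto
    then have "(z - 1) * (\<Sum>j<k. z ^ j) \<le> (z - 1) * (real k * z ^ p)"
      using False by (intro mult_left_mono_neg) auto
    then show ?thesis by (simp add: power_diff_1_eq mult_ac)
  qed
  have "real (Suc p) * z ^ k = real p * z ^ k + z ^ k" by (simp add: algebra_simps)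
  also have "\<dots> \<le> real k * z ^ p + real (p - k) + (real k * z ^ p * (z - 1) + 1)"
    using step.IH * by linarith
  also have "\<dots> = real k * z ^ Suc p + real (Suc p - k)"
    using step(1) by (simp add: algebra_simps of_nat_diff)
  finally show ?case .
qed simp

text \<open>Young's inequality in three terms, the third being 1. The product is first bounded
  homogeneously in degree \<open>m + 1\<close>, then each power is interpolated up to degree
  \<open>p\<close>.\<close>

lemma mult_power_le_interpolation:
  fixes a b :: real
  assumes a: "0 \<le> a" and b: "0 \<le> b" and m: "m + 1 \<le> p"
  shows "a * b ^ m \<le> (a ^ p + real m * b ^ p + real (p - (m + 1))) / real p"
proof -
  have 1: "real (m + 1) * (a * b ^ m) \<le> a ^ (m + 1) + real m * b ^ (m + 1)"
  proof (cases "b = 0")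
    case True
    then show ?thesis using a by (cases m) auto
  next
    case False
    then have bp: "0 < b" using b by simp
    have "real (m + 1) * (a / b) \<le> (a / b) ^ (m + 1) + real m"
      using power_le_interpolation[of "a / b" 1 "m + 1"] a b by simp
    then have "real (m + 1) * (a / b) * b ^ (m + 1) \<le> ((a / b) ^ (m + 1) + real m) * b ^ (m + 1)"
      using b by (intro mult_right_mono) auto
    moreover have "(a / b) ^ (m + 1) * b ^ (m + 1) = a ^ (m + 1)"
      using bp by (simp add: power_divide)
    moreover have "(a / b) * b ^ (m + 1) = a * b ^ m" using bp by simp
    ultimately show ?thesis by (metis distrib_right mult.assoc)
  qed
  have "real p * (real (m + 1) * (a * b ^ m)) \<le> real p * a ^ (m + 1) + real m * (real p * b ^ (m + 1))"
    using mult_left_mono[OF 1, of "real p"] by (simp add: algebra_simps)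
  also have "\<dots> \<le> (real (m + 1) * a ^ p + real (p - (m + 1))) + real m * (real (m + 1) * b ^ p + real (p - (m + 1)))"
    using power_le_interpolation[OF a m] power_le_interpolation[OF b m]
    by (intro add_mono mult_left_mono) auto
  also have "\<dots> = real (m + 1) * (a ^ p + real m * b ^ p + real (p - (m + 1)))"
    by (simp add: algebra_simps)
  finally have "real (m + 1) * (real p * (a * b ^ m)) \<le> real (m + 1) * (a ^ p + real m * b ^ p + real (p - (m + 1)))"
    by (simp only: mult.left_commute)
  then have "real p * (a * b ^ m) \<le> a ^ p + real m * b ^ p + real (p - (m + 1))"
    by (subst (asm) mult_le_cancel_left_pos) auto
  then show ?thesis using m by (simp add: field_simps)
qed

lemma trace_real_conj:
  assumes "unitary_matrix U"
  shows "trace (real_conj U t) = of_real (\<Sum>i\<in>UNIV. t i)"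
proof -
  have "trace (real_conj U t) = trace (cadjoint U ** U ** cdiag (\<chi> i. of_real (t i)))"
    unfolding real_conj_def
    using trace_commute[of "U ** cdiag (\<chi> i. of_real (t i))" "cadjoint U"] by (simp add: matrix_mul_assoc)
  then show ?thesis by (simp add: unitary_matrixD[OF assms]) (simp add: trace_def cdiag_def)
qed

text \<open>This double stochasticity lets mixed sums over two eigenbases collapse to
  traces.\<close>

lemma unitary_entries:
  assumes "unitary_matrix (K :: complex ^ 'n ^ 'n)"
  shows "(\<Sum>j\<in>UNIV. (cmod (K $ i $ j))\<^sup>2) = 1" "(\<Sum>i\<in>UNIV. (cmod (K $ i $ j))\<^sup>2) = 1"
proof -
  have "of_real (\<Sum>j\<in>UNIV. (cmod (K $ i $ j))\<^sup>2) = (K ** cadjoint K) $ i $ i"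
    by (simp add: matrix_matrix_mult_def complex_norm_square del: of_real_power)
  then have "of_real (\<Sum>j\<in>UNIV. (cmod (K $ i $ j))\<^sup>2) = (1 :: complex)"
    by (simp add: unitary_matrixD[OF assms] mat_def)
  then show "(\<Sum>j\<in>UNIV. (cmod (K $ i $ j))\<^sup>2) = 1" by (simp only: of_real_eq_1_iff)
  have "of_real (\<Sum>i\<in>UNIV. (cmod (K $ i $ j))\<^sup>2) = (cadjoint K ** K) $ j $ j"
    by (simp add: matrix_matrix_mult_def complex_norm_square mult.commute del: of_real_power)
  then have "of_real (\<Sum>i\<in>UNIV. (cmod (K $ i $ j))\<^sup>2) = (1 :: complex)"
    by (simp add: unitary_matrixD[OF assms] mat_def)
  then show "(\<Sum>i\<in>UNIV. (cmod (K $ i $ j))\<^sup>2) = 1" by (simp only: of_real_eq_1_iff)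
qed

text \<open>Between two eigenbases the trace becomes a scalar sum with doubly stochastic weights, so
  that scalar inequalities carry over to matrices that do not commute.\<close>

lemma trace_real_conj_mult:
  assumes U: "unitary_matrix U" and W: "unitary_matrix W"
  shows "trace (real_conj U s ** real_conj W t) =
    of_real (\<Sum>i\<in>UNIV. \<Sum>j\<in>UNIV. (cmod ((cadjoint U ** W) $ i $ j))\<^sup>2 * (s i * t j))"
proof -
  define K where "K = cadjoint U ** W"
  have "trace (real_conj U s ** real_conj W t)
      = trace ((cdiag (\<chi> i. of_real (s i)) ** K ** cdiag (\<chi> i. of_real (t i))) ** cadjoint K)"
    unfolding real_conj_def K_def cadjoint_mult
    using trace_commute[of U "cdiag (\<chi> i. of_real (s i)) ** cadjoint U ** W ** cdiag (\<chi> i. of_real (t i))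
        ** cadjoint W"]
    by (simp add: matrix_mul_assoc)
  also have "\<dots> = (\<Sum>i\<in>UNIV. \<Sum>j\<in>UNIV. of_real (s i) * K $ i $ j * of_real (t j) * cnj (K $ i $ j))"
    unfolding trace_def matrix_matrix_mult_def[of _ "cadjoint K"] cdiag_mult_left cdiag_mult_right
    by (simp add: cdiag_mult_left cdiag_mult_right)
  also have "\<dots> = (\<Sum>i\<in>UNIV. \<Sum>j\<in>UNIV. of_real ((cmod (K $ i $ j))\<^sup>2 * (s i * t j)))"
    by (simp add: complex_norm_square mult_ac del: of_real_power)
  finally show ?thesis by (simp add: K_def)
qed

lemma trace_resolvent_ge:
  assumes "self_adjoint (x :: complex ^ 'n ^ 'n)"
  shows "real CARD('n) * g ^ (2 * m) \<le> Re (trace (resolvent_pow g m x))"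
proof -
  obtain U w where U: "diagonalizes U w x"
    using self_adjoint_diagonalization[OF assms] by (auto simp: diagonalizes_def)
  have "(\<Sum>i\<in>(UNIV :: 'n set). g ^ (2 * m)) \<le> (\<Sum>i\<in>UNIV. ((w $ i)\<^sup>2 + g\<^sup>2) ^ m)"
    unfolding power_mult by (intro sum_mono power_mono) auto
  moreover have "unitary_matrix U" using U by (simp add: diagonalizes_def)
  ultimately show ?thesis
    by (simp add: resolvent_pow_diagonal[OF U] trace_real_conj)
qed

text \<open>The scalar interpolation at the eigenvalues of the squared matrix plus g^2, divided by
  h^2. When \<open>h ^ (2 * p)\<close> is the mean of the normalized trace on the right, the bracket
  averages to \<open>p\<close> times the dimension and \<open>h ^ (2 * m)\<close> remains.\<close>

lemma trace_resolvent_interpolation: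
  fixes x :: "complex ^ 'n ^ 'n"
  assumes x: "self_adjoint x" and h: "0 < h" and p: "1 \<le> p" and m: "m \<le> p"
  shows "Re (trace (resolvent_pow g m x)) \<le> h ^ (2 * m) *
    (real m * (Re (trace (resolvent_pow g p x)) / h ^ (2 * p)) + real (p - m) * real CARD('n)) / real p"
proof -
  obtain U w where U: "diagonalizes U w x"
    using self_adjoint_diagonalization[OF x] by (auto simp: diagonalizes_def)
  then have uU: "unitary_matrix U" by (simp add: diagonalizes_def)
  define t where "t i = (w $ i)\<^sup>2 + g\<^sup>2" for i
  have t: "0 \<le> t i" for i by (simp add: t_def)
  have "t i ^ m \<le> h ^ (2 * m) * (real m * (t i ^ p / h ^ (2 * p)) + real (p - m)) / real p" for i
  proof -
    have "(t i / h\<^sup>2) ^ m \<le> (real m * (t i / h\<^sup>2) ^ p + real (p - m)) / real p"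
      using power_le_interpolation[of "t i / h\<^sup>2" m p] t[of i] m p by (simp add: field_simps)
    then have "h ^ (2 * m) * (t i / h\<^sup>2) ^ m \<le> h ^ (2 * m) * ((real m * (t i / h\<^sup>2) ^ p + real (p - m)) / real p)"
      using h by (intro mult_left_mono) auto
    then show ?thesis using h by (simp add: power_divide power_mult[symmetric])
  qed
  then have "(\<Sum>i\<in>UNIV. t i ^ m) \<le> (\<Sum>i\<in>UNIV. h ^ (2 * m) * (real m * (t i ^ p / h ^ (2 * p)) + real (p - m)) / real p)"
    by (rule sum_mono)
  also have "\<dots> = h ^ (2 * m) * (real m * ((\<Sum>i\<in>UNIV. t i ^ p) / h ^ (2 * p)) + real (p - m) * real CARD('n)) / real p"
    by (simp add: sum.distrib sum_distrib_left[symmetric] sum_divide_distrib[symmetric])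
  finally show ?thesis
    by (simp add: resolvent_pow_diagonal[OF U] trace_real_conj[OF uU] t_def)
qed

text \<open>Young's inequality for each pair of eigenvalues, each matrix on its own scale; row and
  column sums equal to 1 turn the one-sided terms into traces.\<close>

lemma trace_resolvent_mult_interpolation:
  fixes x z :: "complex ^ 'n ^ 'n"
  assumes x: "self_adjoint x" and z: "self_adjoint z" and h: "0 < h" "0 < k" and m: "m + 1 \<le> p"
  shows "Re (trace (resolvent_pow g 1 z ** resolvent_pow g m x)) \<le> k\<^sup>2 * h ^ (2 * m) *
    (Re (trace (resolvent_pow g p z)) / k ^ (2 * p) + real m * (Re (trace (resolvent_pow g p x)) / h ^ (2 * p))
      + real (p - (m + 1)) * real CARD('n)) / real p"
proof -
  obtain U w where U: "diagonalizes U w z"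
    using self_adjoint_diagonalization[OF z] by (auto simp: diagonalizes_def)
  then have uU: "unitary_matrix U" by (simp add: diagonalizes_def)
  obtain W u where W: "diagonalizes W u x"
    using self_adjoint_diagonalization[OF x] by (auto simp: diagonalizes_def)
  then have uW: "unitary_matrix W" by (simp add: diagonalizes_def)
  define s where "s i = (w $ i)\<^sup>2 + g\<^sup>2" for i
  define t where "t i = (u $ i)\<^sup>2 + g\<^sup>2" for i
  have st: "0 \<le> s i" "0 \<le> t i" for i by (simp_all add: s_def t_def)
  define c where "c i j = (cmod ((cadjoint U ** W) $ i $ j))\<^sup>2" for i j
  note uK = unitary_entries[OF unitary_mult[OF unitary_cadjoint[OF uU] uW], folded c_def]
  define C where "C = k\<^sup>2 * h ^ (2 * m) / real p"
  have le: "s i * t j ^ m \<le> C * (s i ^ p / k ^ (2 * p) + real m * (t j ^ p / h ^ (2 * p)) + real (p - (m + 1)))"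
      for i j
  proof -
    have "(s i / k\<^sup>2) * (t j / h\<^sup>2) ^ m \<le> ((s i / k\<^sup>2) ^ p + real m * (t j / h\<^sup>2) ^ p + real (p - (m + 1))) / real p"
      using st by (intro mult_power_le_interpolation m) auto
    then have "(k\<^sup>2 * h ^ (2 * m)) * ((s i / k\<^sup>2) * (t j / h\<^sup>2) ^ m)
       \<le> (k\<^sup>2 * h ^ (2 * m)) * (((s i / k\<^sup>2) ^ p + real m * (t j / h\<^sup>2) ^ p + real (p - (m + 1))) / real p)"
      using h by (intro mult_left_mono) auto
    moreover have "(k\<^sup>2 * h ^ (2 * m)) * ((s i / k\<^sup>2) * (t j / h\<^sup>2) ^ m) = s i * t j ^ m"
      using h by (simp add: power_divide power_mult[symmetric])
    ultimately show ?thesis by (simp add: C_def power_divide power_mult[symmetric])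
  qed
  have "Re (trace (resolvent_pow g 1 z ** resolvent_pow g m x)) = (\<Sum>i\<in>UNIV. \<Sum>j\<in>UNIV. c i j * (s i * t j ^ m))"
    unfolding resolvent_pow_diagonal[OF U] resolvent_pow_diagonal[OF W] trace_real_conj_mult[OF uU uW]
    by (simp add: c_def s_def t_def)
  also have "\<dots> \<le> (\<Sum>i\<in>UNIV. \<Sum>j\<in>UNIV. c i j * (C * (s i ^ p / k ^ (2 * p) + real m * (t j ^ p / h ^ (2 * p))
      + real (p - (m + 1)))))"
    by (intro sum_mono mult_left_mono le) (simp add: c_def)
  also have "\<dots> = C * ((\<Sum>i\<in>UNIV. \<Sum>j\<in>UNIV. c i j * (s i ^ p / k ^ (2 * p)))
      + (\<Sum>i\<in>UNIV. \<Sum>j\<in>UNIV. c i j * (real m * (t j ^ p / h ^ (2 * p))))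
      + (\<Sum>i\<in>UNIV. \<Sum>j\<in>UNIV. c i j * real (p - (m + 1))))"
    by (simp add: sum_distrib_left sum.distrib[symmetric] algebra_simps)
  also have "(\<Sum>i\<in>UNIV. \<Sum>j\<in>UNIV. c i j * (s i ^ p / k ^ (2 * p))) = (\<Sum>i\<in>UNIV. s i ^ p / k ^ (2 * p))"
    by (simp only: sum_distrib_right[symmetric] uK mult_1)
  also have "(\<Sum>i\<in>UNIV. \<Sum>j\<in>UNIV. c i j * (real m * (t j ^ p / h ^ (2 * p))))
      = (\<Sum>j\<in>UNIV. real m * (t j ^ p / h ^ (2 * p)))"
    by (subst sum.swap) (simp only: sum_distrib_right[symmetric] uK mult_1)
  also have "(\<Sum>i\<in>UNIV. \<Sum>j\<in>UNIV. c i j * real (p - (m + 1))) = real (p - (m + 1)) * real CARD('n)"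
    by (simp only: sum_distrib_right[symmetric] uK) simp
  also have "(\<Sum>i\<in>UNIV. s i ^ p / k ^ (2 * p)) = Re (trace (resolvent_pow g p z)) / k ^ (2 * p)"
    by (simp add: resolvent_pow_diagonal[OF U] trace_real_conj[OF uU] s_def sum_divide_distrib)
  also have "(\<Sum>j\<in>UNIV. real m * (t j ^ p / h ^ (2 * p))) = real m * (Re (trace (resolvent_pow g p x)) / h ^ (2 * p))"
    by (simp add: resolvent_pow_diagonal[OF W] trace_real_conj[OF uW] t_def sum_divide_distrib sum_distrib_left)
  finally show ?thesis by (simp add: C_def)
qed

text \<open>In an eigenbasis of \<open>x\<close> only the diagonal entries of \<open>V\<close> enter
  the trace, and the operator norm bounds each of them.\<close>

lemma trace_op_le_resolvent:
  fixes x V :: "complex ^ 'n ^ 'n"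
  assumes x: "self_adjoint x" and V: "op_le c V"
  shows "Re (trace (V ** resolvent_pow g m x)) \<le> c * Re (trace (resolvent_pow g m x))"
proof -
  obtain U w where U: "diagonalizes U w x"
    using self_adjoint_diagonalization[OF x] by (auto simp: diagonalizes_def)
  then have uU: "unitary_matrix U" by (simp add: diagonalizes_def)
  define t where "t i = ((w $ i)\<^sup>2 + g\<^sup>2) ^ m" for i
  define K where "K = cadjoint U ** V ** U"
  have K: "op_le c K" unfolding K_def by (intro op_le_unitary_conj unitary_cadjoint uU V)
  have Kc: "Re (K $ i $ i) \<le> c" for i
  proof -
    have "Re (K $ i $ i) \<le> cmod ((K *v axis i 1) $ i)"
      by (simp add: matrix_vector_mult_def axis_def complex_Re_le_cmod if_distrib[of "\<lambda>x. _ * x"] cong: if_cong)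
    also have "\<dots> \<le> norm (K *v axis i 1)" by (rule Finite_Cartesian_Product.norm_nth_le)
    also have "\<dots> \<le> c" 
    proof -
      have "norm (axis i 1 :: complex ^ 'n) = 1"
        by (simp add: norm_vec_def L2_set_def axis_def if_distrib[of "\<lambda>x. (cmod x)\<^sup>2"] cong: if_cong)
      then show ?thesis using K[unfolded op_le_def, rule_format, of "axis i 1"] by simp
    qed
    finally show ?thesis .
  qed
  have "trace (V ** resolvent_pow g m x) = trace (K ** cdiag (\<chi> i. of_real (t i)))"
    unfolding resolvent_pow_diagonal[OF U] real_conj_def K_def t_def
    using trace_commute[of "V ** U ** cdiag (\<chi> i. of_real (((w $ i)\<^sup>2 + g\<^sup>2) ^ m))" "cadjoint U"]
    by (simp only: matrix_mul_assoc)
  then have "Re (trace (V ** resolvent_pow g m x)) = (\<Sum>i\<in>UNIV. Re (K $ i $ i) * t i)"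
    by (simp add: trace_def cdiag_mult_right)
  also have "\<dots> \<le> (\<Sum>i\<in>UNIV. c * t i)"
    by (intro sum_mono mult_right_mono Kc) (simp add: t_def)
  also have "\<dots> = c * Re (trace (resolvent_pow g m x))"
    by (simp add: resolvent_pow_diagonal[OF U] trace_real_conj[OF uU] t_def sum_distrib_left)
  finally show ?thesis .
qed

section \<open>The differential inequality and its integration\<close>

context comparison
begin

lemma v_eq_sum:
  "real CARD('n) * v \<theta> m =
     (\<Sum>i\<in>{1..n}. \<integral>z. Re (trace ((\<integral>\<omega>. Y i \<omega> ** Y i \<omega> \<partial>M) ** resolvent_pow g m (X \<theta> z))) \<partial>\<Omega>)"
proof -
  have "real CARD('n) * v \<theta> m = (\<integral>z. (\<Sum>i\<in>{1..n}. Re (trace ((\<integral>\<omega>. Y i \<omega> ** Y i \<omega> \<partial>M)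
      ** resolvent_pow g m (X \<theta> z)))) \<partial>\<Omega>)"
    unfolding v_def V_def by (simp add: matrix_mult_sum trace_sum)
  also have "\<dots> = (\<Sum>i\<in>{1..n}. \<integral>z. Re (trace ((\<integral>\<omega>. Y i \<omega> ** Y i \<omega> \<partial>M) ** resolvent_pow g m (X \<theta> z))) \<partial>\<Omega>)"
    by (rule Bochner_Integration.integral_sum) (intro all_moments_integrable amc all_moments_const)
  finally show ?thesis .
qed

text \<open>With the first coordinate frozen, \<open>ibp\<close> applies to
  \<open>A + sin \<theta> *\<^sub>R S \<omega>\<close> as its constant matrix; \<open>cov\<close>
  then distributes the result over the summands.\<close>

lemma integral_trace_G:
  "(\<integral>z. trace (shift_prod cs (X \<theta> z) ** G (snd z)) \<partial>\<Omega>)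
    = cos \<theta> *\<^sub>R (\<Sum>i\<in>{1..n}. \<integral>z. cov_form (\<lambda>a b j k. \<integral>\<omega>. Y i \<omega> $ a $ b * Y i \<omega> $ j $ k \<partial>M) cs (X \<theta> z) \<partial>\<Omega>)"
proof -
  let ?V = "\<lambda>a b j i. \<integral>\<eta>. G \<eta> $ a $ b * G \<eta> $ j $ i \<partial>N"
  have amcf: "all_moments \<Omega> (\<lambda>z. cov_form W cs (X \<theta> z))" for W
    by (intro all_moments_cov_form amc)
  have "(\<integral>z. trace (shift_prod cs (X \<theta> z) ** G (snd z)) \<partial>\<Omega>)
      = (\<integral>\<omega>. (\<integral>\<eta>. trace (shift_prod cs (X \<theta> (\<omega>, \<eta>)) ** G \<eta>) \<partial>N) \<partial>M)"
    by (subst MN.integral_fst'[symmetric]) (auto intro!: all_moments_integrable amc)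
  also have "\<dots> = (\<integral>\<omega>. cos \<theta> *\<^sub>R (\<integral>\<eta>. cov_form ?V cs (X \<theta> (\<omega>, \<eta>)) \<partial>N) \<partial>M)"
    unfolding X_def fst_conv snd_conv ibp ..
  also have "\<dots> = cos \<theta> *\<^sub>R (\<integral>\<omega>. (\<integral>\<eta>. cov_form ?V cs (X \<theta> (\<omega>, \<eta>)) \<partial>N) \<partial>M)"
    by simp
  also have "(\<integral>\<omega>. (\<integral>\<eta>. cov_form ?V cs (X \<theta> (\<omega>, \<eta>)) \<partial>N) \<partial>M) = (\<integral>z. cov_form ?V cs (X \<theta> z) \<partial>\<Omega>)"
    by (rule MN.integral_fst') (intro all_moments_integrable amcf)
  also have "\<dots> = (\<Sum>i\<in>{1..n}. \<integral>z. cov_form (\<lambda>a b j k. \<integral>\<omega>. Y i \<omega> $ a $ b * Y i \<omega> $ j $ k \<partial>M) cs (X \<theta> z) \<partial>\<Omega>)"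
    unfolding cov cov_form_sum
    by (rule Bochner_Integration.integral_sum) (intro all_moments_integrable amcf)
  finally show ?thesis .
qed

lemma f'_bound:
  assumes \<theta>: "0 \<le> sin \<theta>" "0 \<le> cos \<theta>" and h: "0 < h"
  shows "\<bar>f' \<theta>\<bar> \<le> 2 * real p * cos \<theta> * (8 * real ((2 * p - 1) * (p - 1)) * (sin \<theta>)\<^sup>2 * l * (v \<theta> (p
      - 1) / (2 * h) + h / 2 * v \<theta> (p - 2)))"
proof -
  define rs where "rs = resolvent_shifts g p"
  define c where "c k = drop (Suc k) rs @ take k rs" for k
  define d where "d = real CARD('n)"
  have d: "0 < d" by (simp add: d_def)
  define C where "C = 8 * real ((2 * p - 1) * (p - 1)) * (sin \<theta>)\<^sup>2 * l"
  define w where "w i m = (\<integral>z. Re (trace ((\<integral>\<omega>. Y i \<omega> ** Y i \<omega> \<partial>M) ** resolvent_pow g m (X \<theta> z))) \<partial>\<Omega>)" for i m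
  have dv: "d * v \<theta> m = (\<Sum>i\<in>{1..n}. w i m)" for m
    unfolding d_def w_def by (rule v_eq_sum)
  have J: "cmod (\<integral>z. trace (shift_prod cs (X \<theta> z) ** X' \<theta> z) \<partial>\<Omega>)
      \<le> cos \<theta> * (C * (d * v \<theta> (p - 1) / (2 * h) + h / 2 * (d * v \<theta> (p - 2))))"
    if cs: "pm_shifts g cs" "length cs = 2 * p - 1" for cs
  proof -
    let ?J = "\<lambda>i. \<integral>z. trace (shift_prod cs (X \<theta> z) ** Y i (fst z)) \<partial>\<Omega>"
    let ?K = "\<lambda>i. \<integral>z. cov_form (\<lambda>a b j k. \<integral>\<omega>. Y i \<omega> $ a $ b * Y i \<omega> $ j $ k \<partial>M) cs (X \<theta> z) \<partial>\<Omega>"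
    have "(\<integral>z. trace (shift_prod cs (X \<theta> z) ** X' \<theta> z) \<partial>\<Omega>)
       = (\<integral>z. cos \<theta> *\<^sub>R (\<Sum>i\<in>{1..n}. trace (shift_prod cs (X \<theta> z) ** Y i (fst z)))
           - sin \<theta> *\<^sub>R trace (shift_prod cs (X \<theta> z) ** G (snd z)) \<partial>\<Omega>)"
      unfolding X'_def S_def by (simp add: matrix_mult_distribs matrix_mult_sum trace_diff' trace_scaleR trace_sum)
    also have "\<dots> = (\<integral>z. cos \<theta> *\<^sub>R (\<Sum>i\<in>{1..n}. trace (shift_prod cs (X \<theta> z) ** Y i (fst z))) \<partial>\<Omega>)
        - (\<integral>z. sin \<theta> *\<^sub>R trace (shift_prod cs (X \<theta> z) ** G (snd z)) \<partial>\<Omega>)"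
      by (intro Bochner_Integration.integral_diff all_moments_integrable amc all_moments_sum am_Yi)
    also have "\<dots> = cos \<theta> *\<^sub>R (\<integral>z. (\<Sum>i\<in>{1..n}. trace (shift_prod cs (X \<theta> z) ** Y i (fst z))) \<partial>\<Omega>)
        - sin \<theta> *\<^sub>R (cos \<theta> *\<^sub>R (\<Sum>i\<in>{1..n}. ?K i))"
      unfolding integral_scaleR_right integral_trace_G ..
    also have "(\<integral>z. (\<Sum>i\<in>{1..n}. trace (shift_prod cs (X \<theta> z) ** Y i (fst z))) \<partial>\<Omega>) = (\<Sum>i\<in>{1..n}. ?J i)"
      by (rule Bochner_Integration.integral_sum) (intro all_moments_integrable amc am_Yi)
    \<comment> \<open>Each summand is grouped with its share of the Gaussian term, so that only the
      exchange errors of \<open>summand_bound\<close> remain.\<close>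
    also have "cos \<theta> *\<^sub>R (\<Sum>i\<in>{1..n}. ?J i) - sin \<theta> *\<^sub>R (cos \<theta> *\<^sub>R (\<Sum>i\<in>{1..n}. ?K i))
        = cos \<theta> *\<^sub>R (\<Sum>i\<in>{1..n}. ?J i - sin \<theta> *\<^sub>R ?K i)"
      by (simp add: sum_subtractf scaleR_diff_right scaleR_sum_right mult.commute)
    finally have "cmod (\<integral>z. trace (shift_prod cs (X \<theta> z) ** X' \<theta> z) \<partial>\<Omega>)
        = cos \<theta> * cmod (\<Sum>i\<in>{1..n}. ?J i - sin \<theta> *\<^sub>R ?K i)"
      using \<theta> by simp
    also have "\<dots> \<le> cos \<theta> * (\<Sum>i\<in>{1..n}. C * (w i (p - 1) / (2 * h) + h / 2 * w i (p - 2)))"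
      unfolding C_def w_def
      by (intro mult_left_mono order_trans[OF norm_sum] sum_mono summand_bound cs h \<theta>)
    also have "(\<Sum>i\<in>{1..n}. C * (w i (p - 1) / (2 * h) + h / 2 * w i (p - 2)))
        = C * (d * v \<theta> (p - 1) / (2 * h) + h / 2 * (d * v \<theta> (p - 2)))"
      unfolding dv by (simp add: sum_distrib_left sum_divide_distrib sum.distrib algebra_simps)
    finally show ?thesis .
  qed
  have "d * f' \<theta> = (\<integral>z. Re (trace (shift_deriv rs (X \<theta> z) (X' \<theta> z))) \<partial>\<Omega>)"
    by (simp add: f'_def d_def rs_def)
  also have "\<dots> = Re (\<integral>z. trace (shift_deriv rs (X \<theta> z) (X' \<theta> z)) \<partial>\<Omega>)"
    by (rule integral_Re) (intro all_moments_integrable amc)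
  also have "(\<integral>z. trace (shift_deriv rs (X \<theta> z) (X' \<theta> z)) \<partial>\<Omega>)
      = (\<Sum>k<2 * p. \<integral>z. trace (shift_prod (c k) (X \<theta> z) ** X' \<theta> z) \<partial>\<Omega>)"
    unfolding trace_shift_deriv c_def
    by (subst Bochner_Integration.integral_sum) (auto intro!: all_moments_integrable amc simp: rs_def)
  finally have "\<bar>d * f' \<theta>\<bar> \<le> cmod (\<Sum>k<2 * p. \<integral>z. trace (shift_prod (c k) (X \<theta> z) ** X' \<theta> z) \<partial>\<Omega>)"
    by (simp only: abs_Re_le_cmod)
  also have "\<dots> \<le> (\<Sum>k<2 * p. cos \<theta> * (C * (d * v \<theta> (p - 1) / (2 * h) + h / 2 * (d * v \<theta> (p - 2)))))"
  proof (intro order_trans[OF norm_sum] sum_mono J)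
    fix k assume "k \<in> {..<2 * p}"
    then show "pm_shifts g (c k)" "length (c k) = 2 * p - 1"
      by (auto simp: c_def rs_def intro: pm_shifts_take_drop)
  qed
  also have "\<dots> = d * (2 * real p * cos \<theta> * (C * (v \<theta> (p - 1) / (2 * h) + h / 2 * v \<theta> (p - 2))))"
    by (simp add: algebra_simps)
  finally have "d * \<bar>f' \<theta>\<bar> \<le> d * (2 * real p * cos \<theta> * (C * (v \<theta> (p - 1) / (2 * h) + h / 2 * v \<theta> (p - 2))))"
    using d by (simp add: abs_mult)
  then show ?thesis using d by (simp add: C_def)
qed

lemma f_ge: "g ^ (2 * p) \<le> f \<theta>"
proof -
  have "real CARD('n) * g ^ (2 * p) = (\<integral>z. real CARD('n) * g ^ (2 * p) \<partial>\<Omega>)"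
    using MN.P.prob_space by simp
  also have "\<dots> \<le> (\<integral>z. Re (trace (resolvent_pow g p (X \<theta> z))) \<partial>\<Omega>)"
    using MN.P.finite_measure_axioms
    by (intro integral_mono trace_resolvent_ge sa_X all_moments_integrable amc all_moments_const)
  finally show ?thesis by (simp add: f_def field_simps)
qed

lemma f_pos: "0 < f \<theta>"
  using f_ge[of \<theta>] g by (meson less_le_trans zero_less_power)

text \<open>Hoelder's inequality for the expected trace, obtained by interpolating eigenvalues at
  the scale \<open>h\<close> and averaging afterwards.\<close>

lemma v_le_op:
  assumes V: "op_le c V" "0 \<le> c" and h: "0 < h" "h ^ (2 * p) = f \<theta>" and m: "m \<le> p"
  shows "v \<theta> m \<le> c * h ^ (2 * m)"
proof -
  have "real CARD('n) * v \<theta> m = (\<integral>z. Re (trace (V ** resolvent_pow g m (X \<theta> z))) \<partial>\<Omega>)"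
    by (simp add: v_def)
  also have "\<dots> \<le> (\<integral>z. c * (h ^ (2 * m) *
    (real m * (Re (trace (resolvent_pow g p (X \<theta> z))) / h ^ (2 * p)) + real (p - m) * real CARD('n)) / real p) \<partial>\<Omega>)"
  proof (rule integral_mono)
    show "integrable \<Omega> (\<lambda>z. Re (trace (V ** resolvent_pow g m (X \<theta> z))))"
      by (intro all_moments_integrable amc all_moments_const)
    have "integrable \<Omega> (\<lambda>z. Re (trace (resolvent_pow g p (X \<theta> z))))"
      by (intro all_moments_integrable amc)
    then show "integrable \<Omega> (\<lambda>z. c * (h ^ (2 * m) *
       (real m * (Re (trace (resolvent_pow g p (X \<theta> z))) / h ^ (2 * p)) + real (p - m) * real CARD('n)) / real p))"
      by simp
    show "Re (trace (V ** resolvent_pow g m (X \<theta> z))) \<le> c * (h ^ (2 * m) *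
       (real m * (Re (trace (resolvent_pow g p (X \<theta> z))) / h ^ (2 * p)) + real (p - m) * real CARD('n)) / real p)"
      if "z \<in> space \<Omega>" for z
      by (rule order_trans[OF trace_op_le_resolvent[OF sa_X[OF that] V(1)]])
         (intro mult_left_mono trace_resolvent_interpolation sa_X that h p m V)
  qed
  also have "\<dots> = c * (h ^ (2 * m) *
    (real m * ((\<integral>z. Re (trace (resolvent_pow g p (X \<theta> z))) \<partial>\<Omega>) / h ^ (2 * p)) + real (p
        - m) * real CARD('n)) / real p)"
  proof -
    have "integrable \<Omega> (\<lambda>z. Re (trace (resolvent_pow g p (X \<theta> z))))"
      by (intro all_moments_integrable amc)
    then show ?thesis using MN.P.prob_space by simp
  qed
  also have "(\<integral>z. Re (trace (resolvent_pow g p (X \<theta> z))) \<partial>\<Omega>) = real CARD('n) * h ^ (2 * p)"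
    unfolding h(2) by (simp add: f_def)
  also have "c * (h ^ (2 * m) * (real m * (real CARD('n) * h ^ (2 * p) / h ^ (2 * p)) + real (p
      - m) * real CARD('n)) / real p)
     = real CARD('n) * (c * h ^ (2 * m))"
    using h(1) p m by (simp add: field_simps of_nat_diff)
  finally show ?thesis by simp
qed

lemma integral_fst_marginal:
  fixes \<phi> :: "'a \<Rightarrow> real"
  assumes "integrable \<Omega> (\<lambda>z. \<phi> (fst z))"
  shows "(\<integral>z. \<phi> (fst z) \<partial>\<Omega>) = (\<integral>\<omega>. \<phi> \<omega> \<partial>M)"
  using MN.integral_fst'[OF assms] by (simp add: N.prob_space)

lemma integral_snd_marginal:
  fixes \<phi> :: "'b \<Rightarrow> real"
  assumes "integrable \<Omega> (\<lambda>z. \<phi> (snd z))"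
  shows "(\<integral>z. \<phi> (snd z) \<partial>\<Omega>) = (\<integral>\<eta>. \<phi> \<eta> \<partial>N)"
  using MN.integral_fst'[OF assms] by (simp add: M.prob_space)

lemma f_0: "f 0 = (\<integral>\<eta>. Re (trace (resolvent_pow g p (A + G \<eta>))) \<partial>N) / CARD('n)"
proof -
  have "integrable \<Omega> (\<lambda>z. Re (trace (resolvent_pow g p (A + G (snd z)))))"
    by (intro all_moments_integrable amc all_moments_const)
  from integral_snd_marginal[OF this] show ?thesis by (simp add: f_def X_def)
qed

lemma f_pi_half: "f (pi / 2) = (\<integral>\<omega>. Re (trace (resolvent_pow g p (A + S \<omega>))) \<partial>M) / CARD('n)"
proof -
  have "integrable \<Omega> (\<lambda>z. Re (trace (resolvent_pow g p (A + S (fst z)))))"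
    by (intro all_moments_integrable amc all_moments_const)
  from integral_fst_marginal[OF this] show ?thesis by (simp add: f_def X_def)
qed

lemma V_eq: "V = (\<integral>\<eta>. G \<eta> ** G \<eta> \<partial>N)"
proof -
  have "V $ a $ b = (\<integral>\<eta>. G \<eta> ** G \<eta> \<partial>N) $ a $ b" for a b
  proof -
    have YY: "integrable M (\<lambda>\<omega>. Y i \<omega> ** Y i \<omega>)" if "i \<in> {1..n}" for i
      by (intro all_moments_integrable all_moments_matrix_mult am_Y that)
    have GG: "integrable N (\<lambda>\<eta>. G \<eta> ** G \<eta>)"
      by (intro all_moments_integrable all_moments_matrix_mult G)
    have "V $ a $ b = (\<Sum>i\<in>{1..n}. \<Sum>k\<in>UNIV. \<integral>\<omega>. Y i \<omega> $ a $ k * Y i \<omega> $ k $ b \<partial>M)"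
      unfolding V_def sum_component
    proof (rule sum.cong[OF refl])
      fix i assume i: "i \<in> {1..n}"
      show "(\<integral>\<omega>. Y i \<omega> ** Y i \<omega> \<partial>M) $ a $ b = (\<Sum>k\<in>UNIV. \<integral>\<omega>. Y i \<omega> $ a $ k * Y i \<omega> $ k $ b \<partial>M)"
        unfolding integral_nth[OF YY[OF i]] unfolding matrix_matrix_mult_def vec_lambda_beta
        by (rule Bochner_Integration.integral_sum) (intro all_moments_integrable all_moments_mult
            all_moments_nth am_Y i)
    qed
    also have "\<dots> = (\<Sum>k\<in>UNIV. \<integral>\<eta>. G \<eta> $ a $ k * G \<eta> $ k $ b \<partial>N)"
      by (subst sum.swap) (simp add: cov)
    also have "\<dots> = (\<integral>\<eta>. G \<eta> ** G \<eta> \<partial>N) $ a $ b"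
      unfolding integral_nth[OF GG] unfolding matrix_matrix_mult_def vec_lambda_beta
      by (rule Bochner_Integration.integral_sum[symmetric]) (intro all_moments_integrable all_moments_mult
          all_moments_nth G)
    finally show ?thesis .
  qed
  then show ?thesis by (simp add: vec_eq_iff)
qed

lemma resolvent_pow_1: "resolvent_pow g 1 x = x ** x + g\<^sup>2 *\<^sub>R (mat 1 :: complex ^ 'n ^ 'n)"
proof -
  have mm: "(mat c ** B) $ i $ j = c * B $ i $ j" for c i j and B :: "complex ^ 'n ^ 'n"
  proof -
    have "mat c = (cdiag (\<chi> i. c) :: complex ^ 'n ^ 'n)" by (simp add: mat_def cdiag_def vec_eq_iff)
    then show ?thesis by (simp add: cdiag_mult_left)
  qed
  have "resolvent_pow g 1 x = (x + mat (\<i> * of_real g)) ** (x + mat (- (\<i> * of_real g)))"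
    by (simp add: resolvent_shifts_def)
  also have "\<dots> = x ** x + mat (- (\<i> * of_real g)) ** x + mat (\<i> * of_real g) ** x + mat (\<i> * of_real g)
      ** mat (- (\<i> * of_real g))"
    by (simp add: matrix_mult_distribs mat_mult_commute[of x] add_ac)
  also have "\<dots> = x ** x + g\<^sup>2 *\<^sub>R (mat 1 :: complex ^ 'n ^ 'n)"
    by (simp add: vec_eq_iff mm) (simp add: mat_def power2_eq_square scaleR_conv_of_real)
  finally show ?thesis .
qed

text \<open>Holds because \<open>E (A + G)\<^sup>2 = A\<^sup>2 + V\<close>.\<close>

lemma trace_V_le:
  assumes x: "self_adjoint x"
  shows "Re (trace (V ** resolvent_pow g m x)) \<le> (\<integral>\<eta>. Re (trace (resolvent_pow g 1 (A + G \<eta>)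
      ** resolvent_pow g m x)) \<partial>N)"
proof -
  let ?R = "resolvent_pow g m x"
  have finN: "finite_measure N" by unfold_locales
  note amN = all_moments_intros all_moments_const[OF finN] G(1) finN
  have "(\<integral>\<eta>. trace (?R ** resolvent_pow g 1 (A + G \<eta>)) \<partial>N) = trace (?R ** (\<integral>\<eta>. resolvent_pow g 1 (A + G \<eta>) \<partial>N))"
    by (rule integral_trace_mult_right) (intro all_moments_integrable amN)
  also have "(\<integral>\<eta>. resolvent_pow g 1 (A + G \<eta>) \<partial>N) = A ** A + V + g\<^sup>2 *\<^sub>R mat 1"
  proof -
    have AG: "(\<integral>\<eta>. A ** G \<eta> \<partial>N) = 0" "(\<integral>\<eta>. G \<eta> ** A \<partial>N) = 0"
      using integral_bounded_linear[OF bounded_bilinear.bounded_linear_right[OF bounded_bilinear_matrix_mult, of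
          A] all_moments_integrable[OF G(1)]]
        integral_bounded_linear[OF bounded_bilinear.bounded_linear_left[OF bounded_bilinear_matrix_mult, of A]
            all_moments_integrable[OF G(1)]]
      by (simp_all add: G(3) matrix_mult_distribs)
    have "(\<integral>\<eta>. resolvent_pow g 1 (A + G \<eta>) \<partial>N) = (\<integral>\<eta>. (A ** A + g\<^sup>2 *\<^sub>R mat 1) + (A ** G \<eta> + (G \<eta> ** A + G \<eta>
        ** G \<eta>)) \<partial>N)"
      unfolding resolvent_pow_1 by (simp add: matrix_mult_distribs algebra_simps)
    also have "\<dots> = (A ** A + g\<^sup>2 *\<^sub>R mat 1) + ((\<integral>\<eta>. A ** G \<eta> \<partial>N) + ((\<integral>\<eta>. G \<eta> ** A \<partial>N) + (\<integral>\<eta>. G \<eta> ** G \<eta> \<partial>N)))"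
    proof -
      have i: "integrable N (\<lambda>\<eta>. A ** G \<eta>)" "integrable N (\<lambda>\<eta>. G \<eta> ** A)" "integrable N (\<lambda>\<eta>. G \<eta> ** G \<eta>)"
        by (intro all_moments_integrable amN)+
      then show ?thesis by (simp add: N.prob_space)
    qed
    finally show ?thesis by (simp add: AG V_eq)
  qed
  finally have "Re (\<integral>\<eta>. trace (?R ** resolvent_pow g 1 (A + G \<eta>)) \<partial>N)
      = Re (trace (?R ** (A ** A))) + Re (trace (?R ** V)) + g\<^sup>2 * Re (trace ?R)"
    by (simp add: matrix_mult_distribs trace_add' trace_scaleR)
  \<comment> \<open>The excess over \<open>V\<close>, coming from \<open>A\<close> and from
    \<open>g\<close>, has nonnegative trace against the resolvent power.\<close>
  moreover have "Re (trace (?R ** (A ** A))) = quad_trace A ?R"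
    unfolding quad_trace_def by (subst trace_commute) simp
  moreover have "0 \<le> quad_trace A ?R" by (rule quad_trace_resolvent_nonneg[OF x A])
  moreover have "0 \<le> g\<^sup>2 * Re (trace ?R)"
    using trace_resolvent_ge[OF x, of g m] g by (intro mult_nonneg_nonneg) (auto intro: order_trans[rotated])
  moreover have "Re (\<integral>\<eta>. trace (?R ** resolvent_pow g 1 (A + G \<eta>)) \<partial>N)
      = (\<integral>\<eta>. Re (trace (resolvent_pow g 1 (A + G \<eta>) ** ?R)) \<partial>N)"
    unfolding trace_commute[of ?R]
    by (rule integral_Re[symmetric]) (intro all_moments_integrable amN)
  ultimately show ?thesis by (simp add: trace_commute[of V])
qed

text \<open>By \<open>trace_V_le\<close>, \<open>V\<close> gives way to a Gaussian independent of
  \<open>X \<theta>\<close>. Young's inequality, with scale \<open>k\<close> for that Gaussian and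
  \<open>h\<close> for \<open>X \<theta>\<close>, then averages to the claim. The Gaussian uses up
  one of the \<open>p\<close> exponents, hence \<open>m + 1 \<le> p\<close>.\<close>

lemma v_le_gauss:
  assumes k: "0 < k" "k ^ (2 * p) = f 0" and h: "0 < h" "h ^ (2 * p) = f \<theta>" and m: "m + 1 \<le> p"
  shows "v \<theta> m \<le> k\<^sup>2 * h ^ (2 * m)"
proof -
  define d where "d = real CARD('n)"
  have d: "0 < d" by (simp add: d_def)
  have finN: "finite_measure N" by unfold_locales
  note amN = all_moments_intros all_moments_const[OF finN] G(1) finN
  define r where "r z = Re (trace (resolvent_pow g p (X \<theta> z)))" for z
  define C where "C = k\<^sup>2 * h ^ (2 * m)"
  have fin1: "integrable N (\<lambda>\<eta>. Re (trace (resolvent_pow g p (A + G \<eta>))))"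
    by (intro all_moments_integrable amN)
  have int_r: "integrable \<Omega> r" unfolding r_def by (intro all_moments_integrable amc)
  have kf: "(\<integral>\<eta>. Re (trace (resolvent_pow g p (A + G \<eta>))) \<partial>N) = d * k ^ (2 * p)"
    unfolding k(2) f_0 by (simp add: d_def)
  have hf: "(\<integral>z. r z \<partial>\<Omega>) = d * h ^ (2 * p)"
    unfolding h(2) by (simp add: f_def d_def r_def)
  have le: "Re (trace (V ** resolvent_pow g m (X \<theta> z)))
      \<le> C * (d + real m * (r z / h ^ (2 * p)) + real (p - (m + 1)) * d) / real p"
    if z: "z \<in> space \<Omega>" for z
  proof -
    have "Re (trace (V ** resolvent_pow g m (X \<theta> z))) \<le> (\<integral>\<eta>. Re (trace (resolvent_pow g 1 (A + G \<eta>)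
        ** resolvent_pow g m (X \<theta> z))) \<partial>N)"
      by (rule trace_V_le[OF sa_X[OF z]])
    also have "\<dots> \<le> (\<integral>\<eta>. C * (Re (trace (resolvent_pow g p (A + G \<eta>))) / k ^ (2 * p)
        + real m * (r z / h ^ (2 * p)) + real (p - (m + 1)) * d) / real p \<partial>N)"
    proof (rule integral_mono)
      show "integrable N (\<lambda>\<eta>. Re (trace (resolvent_pow g 1 (A + G \<eta>) ** resolvent_pow g m (X \<theta> z))))"
        by (intro all_moments_integrable amN)
      show "integrable N (\<lambda>\<eta>. C * (Re (trace (resolvent_pow g p (A + G \<eta>))) / k ^ (2 * p)
          + real m * (r z / h ^ (2 * p)) + real (p - (m + 1)) * d) / real p)"
        using fin1 by simp
      show "Re (trace (resolvent_pow g 1 (A + G \<eta>) ** resolvent_pow g m (X \<theta> z)))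
         \<le> C * (Re (trace (resolvent_pow g p (A + G \<eta>))) / k ^ (2 * p) + real m * (r z / h ^ (2 * p)) + real (p
             - (m + 1)) * d) / real p"
        if "\<eta> \<in> space N" for \<eta>
        unfolding C_def r_def d_def
        by (rule trace_resolvent_mult_interpolation) (intro sa_X z self_adjoint_add A G(2) that h k m)+
    qed
    also have "\<dots> = C * (d * k ^ (2 * p) / k ^ (2 * p) + real m * (r z / h ^ (2 * p)) + real (p - (m
        + 1)) * d) / real p"
      using fin1 by (simp add: kf N.prob_space)
    finally show ?thesis using k(1) by simp
  qed
  have "d * v \<theta> m = (\<integral>z. Re (trace (V ** resolvent_pow g m (X \<theta> z))) \<partial>\<Omega>)"
    by (simp add: v_def d_def)
  also have "\<dots> \<le> (\<integral>z. C * (d + real m * (r z / h ^ (2 * p)) + real (p - (m + 1)) * d) / real p \<partial>\<Omega>)"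
  proof (rule integral_mono[OF _ _ le])
    show "integrable \<Omega> (\<lambda>z. Re (trace (V ** resolvent_pow g m (X \<theta> z))))"
      by (intro all_moments_integrable amc all_moments_const)
    show "integrable \<Omega> (\<lambda>z. C * (d + real m * (r z / h ^ (2 * p)) + real (p - (m + 1)) * d) / real p)"
      using int_r by simp
  qed
  also have "\<dots> = C * (d + real m * (d * h ^ (2 * p) / h ^ (2 * p)) + real (p - (m + 1)) * d) / real p"
    using int_r MN.P.prob_space by (simp add: hf)
  also have "\<dots> = d * C"
    using h(1) p m by (simp add: field_simps of_nat_diff)
  finally show ?thesis using d by (simp add: C_def)
qed

text \<open>With \<open>h\<close> the regularized norm, each of the two terms in
  \<open>f'_bound\<close> is at most half of c h^(2p - 3), and the factor \<open>h ^ 3\<close>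
  completes this to \<open>f \<theta>\<close>. The constant comes from 2p * 8 (2p - 1)(p - 1) <= 32
  p^3.\<close>

lemma derivative_inequality:
  assumes \<theta>: "0 \<le> sin \<theta>" "0 \<le> cos \<theta>" and h: "0 < h" "h ^ (2 * p) = f \<theta>" and c: "0 \<le> c"
    and v: "\<And>m. m + 1 \<le> p \<Longrightarrow> v \<theta> m \<le> c * h ^ (2 * m)"
  shows "\<bar>f' \<theta>\<bar> * h ^ 3 \<le> 32 * real p ^ 3 * l * c * cos \<theta> * (sin \<theta>)\<^sup>2 * f \<theta>"
proof (cases "p = 1")
  case True
  \<comment> \<open>For \<open>p = 1\<close> there are no three-letter words, and the bound on
    \<open>f'\<close> is 0.\<close>
  have "f' \<theta> = 0" using f'_bound[OF \<theta> h(1)] True by simp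
  then show ?thesis using \<theta> c l less_imp_le[OF f_pos[of \<theta>]] by simp
next
  case False
  then obtain k where k: "p = k + 2" using p by (metis One_nat_def Suc_leI add.commute le_Suc_ex le_antisym
      not_less_eq_eq numeral_2_eq_2)
  define B where "B = 2 * real p * cos \<theta> * (8 * real ((2 * p - 1) * (p - 1)) * (sin \<theta>)\<^sup>2 * l)"
  have B0: "0 \<le> B" unfolding B_def using \<theta> l by (intro mult_nonneg_nonneg) auto
  have "v \<theta> (p - 1) / (2 * h) + h / 2 * v \<theta> (p - 2) \<le> c * h ^ (2 * (p - 1)) / (2 * h) + h / 2 * (c * h ^ (2 * (p
      - 2)))"
    using h p k by (intro add_mono divide_right_mono mult_left_mono v) auto
  also have "\<dots> = c * h ^ (2 * k + 1)"
    using h by (simp add: k field_simps)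
  finally have "B * (v \<theta> (p - 1) / (2 * h) + h / 2 * v \<theta> (p - 2)) \<le> B * (c * h ^ (2 * k + 1))"
    by (rule mult_left_mono[OF _ B0])
  with f'_bound[OF \<theta> h(1)] have "\<bar>f' \<theta>\<bar> \<le> B * (c * h ^ (2 * k + 1))"
    by (simp add: B_def mult.assoc)
  then have "\<bar>f' \<theta>\<bar> * h ^ 3 \<le> B * (c * h ^ (2 * k + 1)) * h ^ 3"
    using h by (intro mult_right_mono) auto
  also have "\<dots> = B * c * f \<theta>"
  proof -
    have "h ^ (2 * k + 1) * h ^ 3 = h ^ (2 * p)" 
      unfolding power_add[symmetric] k by (rule arg_cong[where f="\<lambda>n. h ^ n"]) simp
    then show ?thesis unfolding h(2)[symmetric] by (simp only: mult.assoc)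
  qed
  also have "\<dots> \<le> (32 * real p ^ 3 * cos \<theta> * (sin \<theta>)\<^sup>2 * l) * c * f \<theta>"
  proof (intro mult_right_mono c less_imp_le[OF f_pos])
    have "real ((2 * p - 1) * (p - 1)) \<le> real (2 * p * p)"
      by (intro of_nat_mono mult_le_mono) auto
    then have "16 * real p * real ((2 * p - 1) * (p - 1)) \<le> 16 * real p * real (2 * p * p)"
      by (intro mult_left_mono) auto
    then have "16 * real p * real ((2 * p - 1) * (p - 1)) * (cos \<theta> * (sin \<theta>)\<^sup>2 * l)
        \<le> 16 * real p * real (2 * p * p) * (cos \<theta> * (sin \<theta>)\<^sup>2 * l)"
      using \<theta> l by (intro mult_right_mono mult_nonneg_nonneg) auto
    then show "B \<le> 32 * real p ^ 3 * cos \<theta> * (sin \<theta>)\<^sup>2 * l"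
      by (simp add: B_def power3_eq_cube mult_ac)
  qed
  finally show ?thesis by (simp add: mult_ac)
qed

definition H :: "real \<Rightarrow> real" where "H \<theta> = f \<theta> powr (1 / (2 * real p))"

lemma H: "0 < H \<theta>" "H \<theta> ^ (2 * p) = f \<theta>" "H \<theta> ^ 3 = f \<theta> powr (3 / (2 * real p))"
proof -
  show pos: "0 < H \<theta>" using f_pos[of \<theta>] by (simp add: H_def)
  show "H \<theta> ^ (2 * p) = f \<theta>"
    using f_pos[of \<theta>] p by (simp add: H_def powr_powr flip: powr_realpow)
  show "H \<theta> ^ 3 = f \<theta> powr (3 / (2 * real p))"
    using f_pos[of \<theta>] by (simp add: H_def powr_powr flip: powr_realpow)
qed

text \<open>The derivative of \<open>H ^ 3\<close> is bounded by that of K sin^3, whose increase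
  over the quarter period is \<open>K\<close>. The constants fit because 3/(2p) * 32 p^3 = 48 p^2 is
  three times the 16 p^2 in \<open>K\<close>.\<close>

lemma H_cube_diff:
  assumes c: "0 \<le> c" and v: "\<And>\<theta> m. m + 1 \<le> p \<Longrightarrow> v \<theta> m \<le> c * H \<theta> ^ (2 * m)"
  shows "\<bar>H (pi / 2) ^ 3 - H 0 ^ 3\<bar> \<le> 16 * (real p)\<^sup>2 * l * c"
proof -
  define K where "K = 16 * (real p)\<^sup>2 * l * c"
  define a where "a = 3 / (2 * real p)"
  have der: "DERIV (\<lambda>\<theta>. f \<theta> powr a) \<theta> :> a * f \<theta> powr (a - 1) * f' \<theta>" for \<theta>
    using DERIV_fun_powr[OF DERIV_f f_pos, of a \<theta>] by simp
  have bnd: "\<bar>a * f \<theta> powr (a - 1) * f' \<theta>\<bar> \<le> K * (3 * (sin \<theta>)\<^sup>2 * cos \<theta>)"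
    if "0 \<le> sin \<theta>" "0 \<le> cos \<theta>" for \<theta>
  proof -
    have "\<bar>f' \<theta>\<bar> * H \<theta> ^ 3 \<le> 32 * real p ^ 3 * l * c * cos \<theta> * (sin \<theta>)\<^sup>2 * f \<theta>"
      by (rule derivative_inequality[OF that H(1,2) c v])
    then have le: "\<bar>f' \<theta>\<bar> * (H \<theta> ^ 3 / f \<theta>) \<le> 32 * real p ^ 3 * l * c * cos \<theta> * (sin \<theta>)\<^sup>2"
      using f_pos[of \<theta>] by (simp add: field_simps)
    have "f \<theta> powr (a - 1) = H \<theta> ^ 3 / f \<theta>"
      using f_pos[of \<theta>] by (simp add: H(3) a_def powr_diff)
    then have "\<bar>a * f \<theta> powr (a - 1) * f' \<theta>\<bar> = a * (\<bar>f' \<theta>\<bar> * (H \<theta> ^ 3 / f \<theta>))"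
      using f_pos[of \<theta>] H(1)[of \<theta>] by (simp add: abs_mult a_def)
    also have "\<dots> \<le> a * (32 * real p ^ 3 * l * c * cos \<theta> * (sin \<theta>)\<^sup>2)"
      by (intro mult_left_mono le) (simp add: a_def)
    also have "\<dots> = K * (3 * (sin \<theta>)\<^sup>2 * cos \<theta>)"
      using p by (simp add: a_def K_def power2_eq_square power3_eq_cube)
    finally show ?thesis .
  qed
  have sc: "0 \<le> sin \<theta>" "0 \<le> cos \<theta>" if "0 \<le> \<theta>" "\<theta> \<le> pi / 2" for \<theta> :: real
    using that by (auto intro: sin_ge_zero cos_ge_zero)
  have up: "f (pi / 2) powr a - K * sin (pi / 2) ^ 3 \<le> f 0 powr a - K * sin 0 ^ 3"
  proof (rule DERIV_nonpos_imp_nonincreasing[where f="\<lambda>\<theta>. f \<theta> powr a - K * sin \<theta> ^ 3"])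
    fix \<theta> :: real assume "0 \<le> \<theta>" "\<theta> \<le> pi / 2"
    note sc = sc[OF this]
    have "DERIV (\<lambda>\<theta>. f \<theta> powr a - K * sin \<theta> ^ 3) \<theta> :> a * f \<theta> powr (a - 1) * f' \<theta> - K * (3 * (sin \<theta>)\<^sup>2 * cos \<theta>)"
      by (rule DERIV_diff[OF der]) (auto intro!: derivative_eq_intros)
    moreover have "a * f \<theta> powr (a - 1) * f' \<theta> - K * (3 * (sin \<theta>)\<^sup>2 * cos \<theta>) \<le> 0"
      using bnd[OF sc] by (simp add: abs_le_iff)
    ultimately show "\<exists>y. DERIV (\<lambda>\<theta>. f \<theta> powr a - K * sin \<theta> ^ 3) \<theta> :> y \<and> y \<le> 0" by blast
  qed simp
  have lo: "f 0 powr a + K * sin 0 ^ 3 \<le> f (pi / 2) powr a + K * sin (pi / 2) ^ 3"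
  proof (rule DERIV_nonneg_imp_nondecreasing[where f="\<lambda>\<theta>. f \<theta> powr a + K * sin \<theta> ^ 3"])
    fix \<theta> :: real assume "0 \<le> \<theta>" "\<theta> \<le> pi / 2"
    note sc = sc[OF this]
    have "DERIV (\<lambda>\<theta>. f \<theta> powr a + K * sin \<theta> ^ 3) \<theta> :> a * f \<theta> powr (a - 1) * f' \<theta> + K * (3 * (sin \<theta>)\<^sup>2 * cos \<theta>)"
      by (rule DERIV_add[OF der]) (auto intro!: derivative_eq_intros)
    moreover have "0 \<le> a * f \<theta> powr (a - 1) * f' \<theta> + K * (3 * (sin \<theta>)\<^sup>2 * cos \<theta>)"
      using bnd[OF sc] by (simp add: abs_le_iff)
    ultimately show "\<exists>y. DERIV (\<lambda>\<theta>. f \<theta> powr a + K * sin \<theta> ^ 3) \<theta> :> y \<and> 0 \<le> y" by blast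
  qed simp
  from up lo show ?thesis
    by (simp add: H(3) a_def[symmetric] K_def[symmetric] abs_le_iff)
qed

text \<open>For positive numbers (a - b)^2 <= a^2 + ab + b^2, so the cube of the distance is at most
  the distance of the cubes.\<close>

lemma H_diff_op:
  assumes "op_le c V" "0 \<le> c"
  shows "\<bar>H (pi / 2) - H 0\<bar> ^ 3 \<le> 16 * (real p)\<^sup>2 * l * c"
proof -
  have "\<bar>a - b\<bar> ^ 3 \<le> \<bar>a ^ 3 - b ^ 3\<bar>" if "0 < a" "0 < b" for a b :: real
  proof -
    have "a ^ 3 - b ^ 3 = (a - b) * (a\<^sup>2 + a * b + b\<^sup>2)" by (simp add: power2_eq_square power3_eq_cube algebra_simps)
    moreover have "(a - b)\<^sup>2 \<le> a\<^sup>2 + a * b + b\<^sup>2"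
      using that by (simp add: power2_diff)
    ultimately have "\<bar>a - b\<bar> * (a - b)\<^sup>2 \<le> \<bar>a ^ 3 - b ^ 3\<bar>"
      using that by (simp add: abs_mult mult_left_mono)
    then show ?thesis
      unfolding power2_abs[symmetric, of "a - b"] by (simp only: power3_eq_cube power2_eq_square mult.assoc)
  qed
  from this[OF H(1) H(1)] show ?thesis
    by (rule order_trans[OF _ H_cube_diff[OF assms(2)]]) (intro v_le_op assms H, simp)
qed

text \<open>With \<open>c\<close> the square of \<open>H 0\<close>, the bound a^2 + ab + b^2 >= b^2
  is used instead; cancelling b^2 leaves an estimate without a cube root.\<close>

lemma H_diff_gauss: "\<bar>H (pi / 2) - H 0\<bar> \<le> 16 * (real p)\<^sup>2 * l"
proof -
  define a where "a = H (pi / 2)"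
  define b where "b = H 0"
  have ab: "0 < a" "0 < b" by (simp_all add: a_def b_def H)
  have "\<bar>a ^ 3 - b ^ 3\<bar> \<le> 16 * (real p)\<^sup>2 * l * b\<^sup>2"
    unfolding a_def b_def by (rule H_cube_diff[OF zero_le_power2]) (intro v_le_gauss H, simp)
  moreover have "\<bar>a - b\<bar> * b\<^sup>2 \<le> \<bar>a ^ 3 - b ^ 3\<bar>"
  proof -
    have "a ^ 3 - b ^ 3 = (a - b) * (a\<^sup>2 + a * b + b\<^sup>2)" by (simp add: power2_eq_square power3_eq_cube algebra_simps)
    moreover have "b\<^sup>2 \<le> a\<^sup>2 + a * b + b\<^sup>2" using ab by simp
    ultimately show ?thesis using ab by (simp add: abs_mult mult_left_mono)
  qed
  ultimately have "\<bar>a - b\<bar> * b\<^sup>2 \<le> 16 * (real p)\<^sup>2 * l * b\<^sup>2"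
    by linarith
  then show ?thesis using ab by (simp add: a_def b_def)
qed

end

subsection \<open>Gaussian matrices\<close>

text \<open>The coefficients of one matrix entry in the family of real parts (\<open>Inl\<close>)
  and imaginary parts (\<open>Inr\<close>).\<close>

definition entry_coeff :: "'n \<Rightarrow> 'n \<Rightarrow> 'n \<times> 'n + 'n \<times> 'n \<Rightarrow> complex" where
  "entry_coeff i j = case_sum (\<lambda>q. if q = (i, j) then 1 else 0) (\<lambda>q. if q = (i, j) then \<i> else 0)"

lemma sum_UNIV_sum_type:
  "(\<Sum>q\<in>(UNIV :: ('a::finite + 'b::finite) set). f q) = (\<Sum>q\<in>UNIV. f (Inl q)) + (\<Sum>q\<in>UNIV. f (Inr q))"
  by (simp only: UNIV_Plus_UNIV[symmetric], subst sum.Plus) simp_all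

context
  fixes N :: "'b measure" and Z :: "'b \<Rightarrow> complex ^ 'n ^ 'n"
  assumes N: "prob_space N" and Z: "gaussian_matrix N Z"
begin

interpretation N: prob_space N by (rule N)

interpretation GF: gaussian_family N "case_sum (\<lambda>(i, j) \<omega>. Re (Z \<omega> $ i $ j)) (\<lambda>(i, j) \<omega>. Im (Z \<omega> $ i $ j))"
  by unfold_locales (use Z in \<open>simp add: gaussian_matrix_def\<close>)

lemma all_moments_gaussian_matrix: "all_moments N Z"
proof -
  have re: "all_moments N (\<lambda>\<omega>. Re (Z \<omega> $ i $ j))" and im: "all_moments N (\<lambda>\<omega>. Im (Z \<omega> $ i $ j))" for i j
    using GF.am_Y[of "Inl (i, j)"] GF.am_Y[of "Inr (i, j)"] by simp_all
  have eq: "Z = (\<lambda>\<omega>. \<Sum>i\<in>UNIV. \<Sum>j\<in>UNIV. Re (Z \<omega> $ i $ j) *\<^sub>R axis i (axis j 1)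
      + Im (Z \<omega> $ i $ j) *\<^sub>R axis i (axis j \<i>))"
  proof (rule ext)
    fix \<omega>
    have key: "(\<Sum>i\<in>UNIV. \<Sum>j\<in>UNIV. Re (Z \<omega> $ i $ j) *\<^sub>R axis i (axis j 1)
        + Im (Z \<omega> $ i $ j) *\<^sub>R axis i (axis j \<i>)) $ a $ b
        = Z \<omega> $ a $ b" for a b
    proof -
      have "(\<Sum>i\<in>UNIV. \<Sum>j\<in>UNIV. Re (Z \<omega> $ i $ j) *\<^sub>R axis i (axis j 1)
          + Im (Z \<omega> $ i $ j) *\<^sub>R axis i (axis j \<i>)) $ a $ b
        = (\<Sum>i\<in>UNIV. \<Sum>j\<in>UNIV. if j = b then if i = a then Z \<omega> $ i $ j else 0 else 0)"
        unfolding sum_component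
        by (intro sum.cong refl) (auto simp: axis_def complex_eq_iff)
      then show ?thesis by simp
    qed
    show "Z \<omega> = (\<Sum>i\<in>UNIV. \<Sum>j\<in>UNIV. Re (Z \<omega> $ i $ j) *\<^sub>R axis i (axis j 1) + Im (Z \<omega> $ i $ j) *\<^sub>R axis i (axis j \<i>))"
      by (intro vec_eq_iff[THEN iffD2] allI) (rule key[symmetric])
  qed
  show ?thesis
    by (subst eq) (intro all_moments_sum GF.fin all_moments_add
      all_moments_linear[OF bounded_linear_scaleR_left] re im)
qed

lemma form_entry_coeff: "GF.form (entry_coeff i j) \<eta> = (Z \<eta> - (\<integral>\<omega>. Z \<omega> \<partial>N)) $ i $ j"
proof -
  have int: "integrable N (\<lambda>\<omega>. Z \<omega> $ i $ j)"
    by (intro all_moments_integrable all_moments_nth all_moments_gaussian_matrix)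
  have E: "N.expectation (\<lambda>\<omega>. Re (Z \<omega> $ i $ j)) = Re ((\<integral>\<omega>. Z \<omega> \<partial>N) $ i $ j)"
    "N.expectation (\<lambda>\<omega>. Im (Z \<omega> $ i $ j)) = Im ((\<integral>\<omega>. Z \<omega> \<partial>N) $ i $ j)"
    unfolding integral_nth[OF all_moments_integrable[OF all_moments_gaussian_matrix]]
    by (rule integral_Re[OF int] integral_Im[OF int])+
  have "GF.form (entry_coeff i j) \<eta> = of_real (Re (Z \<eta> $ i $ j) - N.expectation (\<lambda>\<omega>. Re (Z \<omega> $ i $ j)))
      + \<i> * of_real (Im (Z \<eta> $ i $ j) - N.expectation (\<lambda>\<omega>. Im (Z \<omega> $ i $ j)))"
    unfolding GF.form_def sum_UNIV_sum_type entry_coeff_def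
    by (simp add: if_distrib[of "\<lambda>x. x * _"] cong: if_cong)
  then show ?thesis by (simp add: E complex_eq_iff)
qed

text \<open>Entries of a word in \<open>C + b *\<^sub>R G \<eta>\<close> are polynomials in the
  Gaussian family. Their derivative along the covariances with the entry (j, i) of \<open>G\<close>
  is \<open>shift_deriv\<close> in the direction of the matrix of these covariances, scaled by
  \<open>b\<close>; summing over \<open>i\<close> and \<open>j\<close> gives the
  contraction.\<close>

lemma gaussian_matrix_ibp:
  defines "G \<equiv> \<lambda>\<eta>. Z \<eta> - (\<integral>\<omega>. Z \<omega> \<partial>N)"
  shows "(\<integral>\<eta>. trace (shift_prod cs (C + b *\<^sub>R G \<eta>) ** G \<eta>) \<partial>N)
     = b *\<^sub>R (\<integral>\<eta>. cov_form (\<lambda>a b j i. \<integral>\<eta>. G \<eta> $ a $ b * G \<eta> $ j $ i \<partial>N) cs (C + b *\<^sub>R G \<eta>) \<partial>N)"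
proof -
  let ?V = "\<lambda>a b j i. \<integral>\<eta>. G \<eta> $ a $ b * G \<eta> $ j $ i \<partial>N"
  have f: "GF.form (entry_coeff i j) \<eta> = G \<eta> $ i $ j" for i j \<eta>
    by (simp add: form_entry_coeff G_def)
  have amG: "all_moments N G"
    unfolding G_def by (intro all_moments_diff all_moments_gaussian_matrix all_moments_const GF.fin)
  note am = all_moments_intros all_moments_const[OF GF.fin] amG GF.fin
  have cv: "GF.cov (entry_coeff j i) (entry_coeff a c) = ?V a c j i" for a c i j
    unfolding GF.cov_def f by (simp add: mult.commute)
  have gp: "GF.gauss_poly (entry_coeff j i) (\<lambda>\<eta>. shift_prod cs (C + b *\<^sub>R G \<eta>) $ k $ m)
     (\<lambda>\<eta>. shift_deriv cs (C + b *\<^sub>R G \<eta>) (b *\<^sub>R (\<chi> a c. ?V a c j i)) $ k $ m)" for i j k m cs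
  proof (induction cs arbitrary: k m)
    case Nil
    then show ?case using GF.gauss_poly_const by simp
  next
    case (Cons c cs)
    have lin: "GF.gauss_poly (entry_coeff j i) (\<lambda>\<eta>. (C + b *\<^sub>R G \<eta>
        + mat c) $ k $ q) (\<lambda>\<eta>. (b *\<^sub>R (\<chi> a c. ?V a c j i)) $ k $ q)" for q
    proof -
      have "(C + b *\<^sub>R G \<eta> + mat c) $ k $ q = (C + mat c) $ k $ q + of_real b * G \<eta> $ k $ q" for \<eta>
        by (simp add: scaleR_conv_of_real[where 'a=complex])
      moreover have "(b *\<^sub>R (\<chi> a c. ?V a c j i)) $ k $ q = 0 + of_real b * ?V k q j i"
        by (simp add: scaleR_conv_of_real[where 'a=complex])
      ultimately show ?thesis
        using GF.gauss_poly_add[OF GF.gauss_poly_const[of _ "(C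
            + mat c) $ k $ q"] GF.gauss_poly_form[of "entry_coeff j i" "of_real b" "entry_coeff k q"]]
        unfolding f cv by (simp only:)
    qed
    have "GF.gauss_poly (entry_coeff j i)
        (\<lambda>\<eta>. \<Sum>q\<in>UNIV. (C + b *\<^sub>R G \<eta> + mat c) $ k $ q * shift_prod cs (C + b *\<^sub>R G \<eta>) $ q $ m)
        (\<lambda>\<eta>. \<Sum>q\<in>UNIV. (b *\<^sub>R (\<chi> a c. ?V a c j i)) $ k $ q * shift_prod cs (C + b *\<^sub>R G \<eta>) $ q $ m
           + (C + b *\<^sub>R G \<eta> + mat c) $ k $ q * shift_deriv cs (C + b *\<^sub>R G \<eta>) (b *\<^sub>R (\<chi> a c. ?V a c j i)) $ q $ m)"
      by (intro GF.gauss_poly_sum GF.gauss_poly_mult lin Cons)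
    then show ?case
      by (simp add: matrix_matrix_mult_def sum.distrib)
  qed
  have "(\<integral>\<eta>. trace (shift_prod cs (C + b *\<^sub>R G \<eta>) ** G \<eta>) \<partial>N)
     = (\<integral>\<eta>. (\<Sum>i\<in>UNIV. \<Sum>j\<in>UNIV. GF.form (entry_coeff j i) \<eta> * shift_prod cs (C + b *\<^sub>R G \<eta>) $ i $ j) \<partial>N)"
    by (simp add: trace_def matrix_matrix_mult_def f mult.commute)
  also have "\<dots> = (\<Sum>i\<in>UNIV. \<Sum>j\<in>UNIV. \<integral>\<eta>. GF.form (entry_coeff j i) \<eta> * shift_prod cs (C + b *\<^sub>R G \<eta>) $ i $ j \<partial>N)"
    by (subst Bochner_Integration.integral_sum, (intro Bochner_Integration.integrable_sum all_moments_integrable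
        all_moments_mult all_moments_nth GF.am_form am)[1],
        rule sum.cong[OF refl], rule Bochner_Integration.integral_sum)
       (intro all_moments_integrable all_moments_mult all_moments_nth GF.am_form am)
  also have "\<dots> = (\<Sum>i\<in>UNIV. \<Sum>j\<in>UNIV. \<integral>\<eta>. shift_deriv cs (C + b *\<^sub>R G \<eta>) (b *\<^sub>R (\<chi> a c. ?V a c j i)) $ i $ j \<partial>N)"
    by (intro sum.cong refl GF.gauss_poly_ibp gp)
  also have "\<dots> = (\<integral>\<eta>. (\<Sum>i\<in>UNIV. \<Sum>j\<in>UNIV. shift_deriv cs (C + b *\<^sub>R G \<eta>) (b *\<^sub>R (\<chi> a c. ?V a c j i)) $ i $ j) \<partial>N)"
    by (rule sym, subst Bochner_Integration.integral_sum, (intro Bochner_Integration.integrable_sum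
        all_moments_integrable all_moments_nth am)[1],
        rule sum.cong[OF refl], rule Bochner_Integration.integral_sum)
       (intro all_moments_integrable all_moments_nth am)
  also have "\<dots> = (\<integral>\<eta>. b *\<^sub>R cov_form ?V cs (C + b *\<^sub>R G \<eta>) \<partial>N)"
    unfolding cov_form_eq_sum shift_deriv_scaleR by (simp add: scaleR_sum_right)
  finally show ?thesis by simp
qed

end

subsection \<open>Moments of the spectrum\<close>

text \<open>Two diagonalizations are related by a unitary \<open>T\<close> that intertwines the
  diagonal matrices. Its nonzero entries join equal eigenvalues only, so it also intertwines their
  images under \<open>f\<close>, and the definite description is meaningful.\<close>

lemma hermitian_fun_diagonal:
  fixes U :: "complex ^ 'n ^ 'n"
  assumes U: "unitary_matrix U"
  shows "hermitian_fun f (U ** diag_matrix w ** cadjoint U) = U ** diag_matrix (\<chi> i. f (w $ i)) ** cadjoint U"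
  unfolding hermitian_fun_def
proof (rule the_equality)
  show "\<exists>U' w'. unitary_matrix U' \<and> U ** diag_matrix w ** cadjoint U = U' ** diag_matrix w' ** cadjoint U' \<and>
     U ** diag_matrix (\<chi> i. f (w $ i)) ** cadjoint U = U' ** diag_matrix (\<chi> i. f (w' $ i)) ** cadjoint U'"
    using U by blast
next
  fix B assume "\<exists>U' w'. unitary_matrix U' \<and> U ** diag_matrix w ** cadjoint U = U' ** diag_matrix w' ** cadjoint U' \<and>
     B = U' ** diag_matrix (\<chi> i. f (w' $ i)) ** cadjoint U'"
  then obtain U' w' where U': "unitary_matrix U'"
    and eq: "U ** diag_matrix w ** cadjoint U = U' ** diag_matrix w' ** cadjoint U'"
    and B: "B = U' ** diag_matrix (\<chi> i. f (w' $ i)) ** cadjoint U'" by blast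
  define T where "T = cadjoint U' ** U"
  have unT: "cadjoint U' ** (U ** D ** cadjoint U) ** U = T ** D" "cadjoint U' ** (U' ** D ** cadjoint U') ** U
      = D ** T" for D
  proof -
    have "cadjoint U' ** (U ** D ** cadjoint U) ** U = cadjoint U' ** U ** D ** (cadjoint U ** U)"
      by (simp add: matrix_mul_assoc)
    then show "cadjoint U' ** (U ** D ** cadjoint U) ** U = T ** D"
      by (simp add: unitary_matrixD[OF U] T_def)
    have "cadjoint U' ** (U' ** D ** cadjoint U') ** U = (cadjoint U' ** U') ** D ** (cadjoint U' ** U)"
      by (simp add: matrix_mul_assoc)
    then show "cadjoint U' ** (U' ** D ** cadjoint U') ** U = D ** T"
      by (simp add: unitary_matrixD[OF U'] T_def)
  qed
  have TD: "T ** diag_matrix w = diag_matrix w' ** T"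
    using arg_cong[OF eq, of "\<lambda>A. cadjoint U' ** A ** U"] unfolding unT .
  have disj: "T $ i $ j = 0 \<or> w $ j = w' $ i" for i j
    using arg_cong[OF TD, of "\<lambda>A. A $ i $ j"]
    unfolding diag_matrix_eq_cdiag cdiag_mult_left cdiag_mult_right by auto
  have T: "T ** diag_matrix (\<chi> i. f (w $ i)) = diag_matrix (\<chi> i. f (w' $ i)) ** T"
    unfolding diag_matrix_eq_cdiag vec_eq_iff cdiag_mult_left cdiag_mult_right
  proof (intro allI)
    fix i j
    show "T $ i $ j * (\<chi> i. of_real ((\<chi> i. f (w $ i)) $ i)) $ j
        = (\<chi> i. of_real ((\<chi> i. f (w' $ i)) $ i)) $ i * T $ i $ j"
      using disj[of i j] by auto
  qed
  have "B = U' ** (diag_matrix (\<chi> i. f (w' $ i)) ** T) ** cadjoint U"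
    unfolding B T_def by (simp only: matrix_mul_assoc[symmetric] unitary_matrixD[OF U] matrix_mul_rid)
  also have "\<dots> = (U' ** cadjoint U') ** U ** diag_matrix (\<chi> i. f (w $ i)) ** cadjoint U"
    unfolding T[symmetric] by (simp only: T_def matrix_mul_assoc)
  finally show "B = U ** diag_matrix (\<chi> i. f (w $ i)) ** cadjoint U"
    by (simp add: unitary_matrixD[OF U'])
qed

text \<open>At \<open>g = 0\<close> a resolvent power is the power of exponent 2p, so the norms of
  the theorem belong to the same family of functionals as the regularized ones.\<close>

lemma ntrace_matrix_abs_powr:
  fixes x :: "complex ^ 'n ^ 'n"
  assumes x: "self_adjoint x" and p: "1 \<le> p"
  shows "Re (ntrace (matrix_abs_powr x (2 * real p))) = Re (trace (resolvent_pow 0 p x)) / CARD('n)"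
proof -
  obtain U w where U: "diagonalizes U w x"
    using self_adjoint_diagonalization[OF x] by (auto simp: diagonalizes_def)
  then have uU: "unitary_matrix U" and xU: "x = U ** diag_matrix w ** cadjoint U" by (simp_all add: diagonalizes_def)
  have "cadjoint x ** x = U ** (diag_matrix w ** diag_matrix w) ** cadjoint U"
    using x unfolding self_adjoint_def xU by (simp only: unitary_sandwich[OF uU])
  also have "diag_matrix w ** diag_matrix w = diag_matrix (\<chi> i. (w $ i)\<^sup>2)"
    by (simp add: diag_matrix_eq_cdiag cdiag_mult_cdiag power2_eq_square)
  finally have "matrix_abs x = U ** diag_matrix (\<chi> i. \<bar>w $ i\<bar>) ** cadjoint U"
    by (simp add: matrix_abs_def hermitian_fun_diagonal[OF uU])
  then have "matrix_abs_powr x (2 * real p) = U ** diag_matrix (\<chi> i. \<bar>w $ i\<bar> powr (2 * real p)) ** cadjoint U"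
    by (simp add: matrix_abs_powr_def hermitian_fun_diagonal[OF uU])
  also have "(\<chi> i. \<bar>w $ i\<bar> powr (2 * real p)) = (\<chi> i. ((w $ i)\<^sup>2 + 0\<^sup>2) ^ p)"
  proof -
    have "\<bar>r\<bar> powr (2 * real p) = (r\<^sup>2) ^ p" for r :: real
    proof (cases "r = 0")
      case False
      then have "\<bar>r\<bar> powr (2 * real p) = \<bar>r\<bar> ^ (2 * p)"
        using powr_realpow[of "\<bar>r\<bar>" "2 * p"] by simp
      then show ?thesis by (simp add: power_mult)
    qed (use p in simp)
    then show ?thesis by (simp add: vec_eq_iff)
  qed
  finally have "matrix_abs_powr x (2 * real p) = resolvent_pow 0 p x"
    by (simp add: resolvent_pow_diagonal[OF U] real_conj_def diag_matrix_eq_cdiag)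
  then show ?thesis by (simp add: ntrace_def)
qed

text \<open>The quotient of \<open>\<bar>w\<bar> + g\<close> by \<open>a + g\<close> is a convex
  combination of \<open>\<bar>w\<bar> / a\<close> and 1; convexity of the even power gives a
  pointwise form of Minkowski's inequality.\<close>

lemma square_add_power_convex:
  fixes a g w :: real
  assumes a: "0 < a" and g: "0 < g"
  shows "(w\<^sup>2 + g\<^sup>2) ^ p \<le> (a + g) ^ (2 * p) * (a / (a + g) * ((w\<^sup>2) ^ p / a ^ (2 * p)) + g / (a + g))"
proof -
  define u where "u = \<bar>w\<bar> / a"
  have eq: "a / (a + g) * u + g / (a + g) * 1 = (\<bar>w\<bar> + g) / (a + g)"
    using a g by (simp add: u_def add_divide_distrib)
  have "w\<^sup>2 + g\<^sup>2 \<le> (\<bar>w\<bar> + g)\<^sup>2" using g by (simp add: power2_sum)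
  then have "(w\<^sup>2 + g\<^sup>2) ^ p \<le> ((\<bar>w\<bar> + g)\<^sup>2) ^ p" by (intro power_mono) auto
  also have "\<dots> = (a + g) ^ (2 * p) * ((\<bar>w\<bar> + g) / (a + g)) ^ (2 * p)"
    using a g by (simp add: power_mult[symmetric] power_divide)
  also have "((\<bar>w\<bar> + g) / (a + g)) ^ (2 * p) \<le> a / (a + g) * u ^ (2 * p) + g / (a + g) * 1 ^ (2 * p)"
  proof -
    have "convex_on UNIV (\<lambda>x :: real. x ^ (2 * p))" by (rule convex_power_even) simp
    from convex_onD[OF this, of "g / (a + g)" u 1] show ?thesis
      unfolding eq[symmetric] using a g by (simp add: field_simps)
  qed
  also have "u ^ (2 * p) = (w\<^sup>2) ^ p / a ^ (2 * p)"
    by (simp add: u_def power_divide power_mult)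
  finally show ?thesis using a g by (simp add: mult_left_mono)
qed

text \<open>Monotonicity in g^2 gives the first bound. For the second, averaging the convexity
  estimate with \<open>a\<close> at least the norm for \<open>g = 0\<close> leaves at most
  \<open>(a + g) ^ (2 * p)\<close>, a triangle inequality for adding the constant
  \<open>g\<close>.\<close>

lemma (in prob_space) shifted_norm_bounds:
  fixes x :: "'a \<Rightarrow> complex ^ 'n ^ 'n"
  assumes am: "all_moments M x" and sa: "\<And>\<omega>. \<omega> \<in> space M \<Longrightarrow> self_adjoint (x \<omega>)"
    and p: "1 \<le> p" and g: "0 < g"
  defines "F \<equiv> \<lambda>g. (\<integral>\<omega>. Re (trace (resolvent_pow g p (x \<omega>))) \<partial>M) / CARD('n)"
  shows "F 0 powr (1 / (2 * real p)) \<le> F g powr (1 / (2 * real p))"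
    and "F g powr (1 / (2 * real p)) \<le> F 0 powr (1 / (2 * real p)) + g"
proof -
  define d where "d = real CARD('n)"
  have d: "0 < d" by (simp add: d_def)
  have fin: "finite_measure M" by unfold_locales
  have int: "integrable M (\<lambda>\<omega>. Re (trace (resolvent_pow g p (x \<omega>))))" for g
    by (intro all_moments_integrable all_moments_intros am fin)
  have F0: "0 \<le> F 0"
    unfolding F_def
  proof (intro divide_nonneg_nonneg integral_nonneg_AE AE_I2)
    show "0 \<le> Re (trace (resolvent_pow 0 p (x \<omega>)))" if "\<omega> \<in> space M" for \<omega>
      using trace_resolvent_ge[OF sa[OF that], of 0 p] p by (simp add: power_0_left)
  qed simp
  have tr: "\<exists>w :: real ^ 'n. \<forall>g. Re (trace (resolvent_pow g p (x \<omega>)))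
      = (\<Sum>i\<in>UNIV. ((w $ i)\<^sup>2 + g\<^sup>2) ^ p)" if \<omega>: "\<omega> \<in> space M" for \<omega>
  proof -
    obtain U w where U: "diagonalizes U w (x \<omega>)"
      using self_adjoint_diagonalization[OF sa[OF \<omega>]] by (auto simp: diagonalizes_def)
    then have "unitary_matrix U" by (simp add: diagonalizes_def)
    then show ?thesis
      by (intro exI[of _ w]) (simp add: resolvent_pow_diagonal[OF U] trace_real_conj)
  qed
  have "F 0 \<le> F g"
    unfolding F_def
  proof (intro divide_right_mono integral_mono int)
    fix \<omega> assume "\<omega> \<in> space M"
    from tr[OF this] obtain w :: "real ^ 'n" where w: "\<And>g. Re (trace (resolvent_pow g p (x \<omega>)))
        = (\<Sum>i\<in>UNIV. ((w $ i)\<^sup>2 + g\<^sup>2) ^ p)" by blast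
    show "Re (trace (resolvent_pow 0 p (x \<omega>))) \<le> Re (trace (resolvent_pow g p (x \<omega>)))"
      unfolding w by (intro sum_mono power_mono) auto
  qed simp
  with F0 show "F 0 powr (1 / (2 * real p)) \<le> F g powr (1 / (2 * real p))"
    by (intro powr_mono2) auto
  show "F g powr (1 / (2 * real p)) \<le> F 0 powr (1 / (2 * real p)) + g"
  proof (rule field_le_epsilon)
    fix e :: real assume e: "0 < e"
    \<comment> \<open>The margin \<open>e\<close> keeps \<open>a\<close> positive for the division,
      as \<open>F 0\<close> may vanish.\<close>
    define a where "a = F 0 powr (1 / (2 * real p)) + e"
    have a: "0 < a" using e by (simp add: a_def add_nonneg_pos)
    have "F 0 = (F 0 powr (1 / (2 * real p))) powr (2 * real p)"
      using F0 p by (simp add: powr_powr)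
    also have "\<dots> \<le> a powr (2 * real p)"
      using e by (intro powr_mono2) (auto simp: a_def)
    also have "\<dots> = a ^ (2 * p)" using a powr_realpow[of a "2 * p"] by simp
    finally have Fa: "F 0 \<le> a ^ (2 * p)" .
    have dF: "(\<integral>\<omega>. Re (trace (resolvent_pow g p (x \<omega>))) \<partial>M) = d * F g" for g
      by (simp add: F_def d_def)
    have "d * F g \<le> (\<integral>\<omega>. (a + g) ^ (2 * p) * (a / (a + g) * (Re (trace (resolvent_pow 0 p (x \<omega>))) / a ^ (2 * p))
        + g / (a + g) * d) \<partial>M)"
      unfolding dF[symmetric]
    proof (intro integral_mono int)
      show "integrable M (\<lambda>\<omega>. (a + g) ^ (2 * p) * (a / (a
          + g) * (Re (trace (resolvent_pow 0 p (x \<omega>))) / a ^ (2 * p)) + g / (a + g) * d))"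
        using int[of 0] by simp
      fix \<omega> assume "\<omega> \<in> space M"
      from tr[OF this] obtain w :: "real ^ 'n" where w: "\<And>g. Re (trace (resolvent_pow g p (x \<omega>)))
          = (\<Sum>i\<in>UNIV. ((w $ i)\<^sup>2 + g\<^sup>2) ^ p)" by blast
      have "Re (trace (resolvent_pow g p (x \<omega>))) \<le> (\<Sum>i\<in>UNIV. (a + g) ^ (2 * p) * (a / (a
          + g) * (((w $ i)\<^sup>2) ^ p / a ^ (2 * p)) + g / (a + g)))"
        unfolding w by (intro sum_mono square_add_power_convex a g)
      also have "\<dots> = (a + g) ^ (2 * p) * (a / (a + g) * (Re (trace (resolvent_pow 0 p (x \<omega>))) / a ^ (2 * p))
          + g / (a + g) * d)"
        unfolding w by (simp add: sum_distrib_left[symmetric] sum.distrib sum_divide_distrib[symmetric] d_def)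
      finally show "Re (trace (resolvent_pow g p (x \<omega>)))
          \<le> (a + g) ^ (2 * p) * (a / (a + g) * (Re (trace (resolvent_pow 0 p (x \<omega>))) / a ^ (2 * p)) + g / (a
              + g) * d)" .
    qed
    also have "\<dots> = d * ((a + g) ^ (2 * p) * (a / (a + g) * (F 0 / a ^ (2 * p)) + g / (a + g)))"
      using int[of 0] by (simp add: dF prob_space algebra_simps)
    finally have "F g \<le> (a + g) ^ (2 * p) * (a / (a + g) * (F 0 / a ^ (2 * p)) + g / (a + g))"
      using d by simp
    also have "\<dots> \<le> (a + g) ^ (2 * p) * (a / (a + g) * 1 + g / (a + g))"
      using a g Fa by (intro mult_left_mono add_mono) auto
    also have "\<dots> = (a + g) ^ (2 * p)" using a g by (simp add: add_divide_distrib[symmetric])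
    finally have "F g powr (1 / (2 * real p)) \<le> ((a + g) ^ (2 * p)) powr (1 / (2 * real p))"
      using \<open>F 0 \<le> F g\<close> F0 by (intro powr_mono2) auto
    also have "\<dots> = a + g"
      using a g p powr_realpow[of "a + g" "2 * p", symmetric] by (simp add: powr_powr)
    finally show "F g powr (1 / (2 * real p)) \<le> F 0 powr (1 / (2 * real p)) + g + e"
      by (simp add: a_def)
  qed
qed

subsection \<open>The comparison theorem\<close>

text \<open>Serves to make the truncation of the summands a Borel function.\<close>

lemma closed_op_le: "closed {A :: complex ^ 'n ^ 'n. op_le l A}"
proof -
  have "continuous_on UNIV (\<lambda>A :: complex ^ 'n ^ 'n. norm (A *v v))" for v
  proof -
    have "bounded_linear (\<lambda>A :: complex ^ 'n ^ 'n. A *v v)"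
      by (rule linear_conv_bounded_linear[THEN iffD1])
         (auto intro!: linearI simp: matrix_vector_mult_add_rdistrib vec_eq_iff matrix_vector_mult_def
             scaleR_sum_right
           sum.distrib distrib_right)
    then show ?thesis by (intro continuous_on_norm linear_continuous_on)
  qed
  then have "closed (\<Inter>v. {A :: complex ^ 'n ^ 'n. norm (A *v v) \<le> l * norm v})"
    by (intro closed_INT ballI closed_Collect_le continuous_on_const) auto
  moreover have "(\<Inter>v. {A :: complex ^ 'n ^ 'n. norm (A *v v) \<le> l * norm v}) = {A. op_le l A}"
    by (auto simp: op_le_def)
  ultimately show ?thesis by simp
qed

lemma cadjoint_integral:
  fixes f :: "'a \<Rightarrow> complex ^ 'n ^ 'n"
  assumes "integrable M f" "\<And>x. x \<in> space M \<Longrightarrow> self_adjoint (f x)"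
  shows "self_adjoint (\<integral>x. f x \<partial>M)"
proof -
  have "cadjoint (\<integral>x. f x \<partial>M) = (\<integral>x. cadjoint (f x) \<partial>M)"
    by (rule integral_bounded_linear[OF bounded_linear_cadjoint assms(1), symmetric])
  also have "\<dots> = (\<integral>x. f x \<partial>M)"
    using assms(2) by (intro Bochner_Integration.integral_cong) (auto simp: self_adjoint_def)
  finally show ?thesis by (simp add: self_adjoint_def)
qed

lemma (in prob_space) integral_entries_indep_sum:
  fixes Y :: "nat \<Rightarrow> 'a \<Rightarrow> complex ^ 'n ^ 'n"
  assumes ind: "indep_vars (\<lambda>_. borel) Y I" and I: "finite I"
    and am: "\<And>i. i \<in> I \<Longrightarrow> all_moments M (Y i)" and mean: "\<And>i. i \<in> I \<Longrightarrow> (\<integral>\<omega>. Y i \<omega> \<partial>M) = 0"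
  shows "(\<integral>\<omega>. (\<Sum>k\<in>I. Y k \<omega>) $ a $ b * (\<Sum>k\<in>I. Y k \<omega>) $ j $ i \<partial>M)
     = (\<Sum>k\<in>I. \<integral>\<omega>. Y k \<omega> $ a $ b * Y k \<omega> $ j $ i \<partial>M)"
proof -
  have int: "integrable M (\<lambda>\<omega>. Y k \<omega> $ a $ b * Y l \<omega> $ j $ i)" if "k \<in> I" "l \<in> I" for k l a b i j
    by (intro all_moments_integrable all_moments_mult all_moments_nth am that)
  have cross: "(\<integral>\<omega>. Y k \<omega> $ a $ b * Y l \<omega> $ j $ i \<partial>M) = 0" if kl: "k \<in> I" "l \<in> I" "k \<noteq> l" for k l
  proof -
    have "indep_var borel ((\<lambda>f. f k $ a $ b) \<circ> (\<lambda>\<omega>. restrict (\<lambda>i. Y i \<omega>) {k})) borel ((\<lambda>f. f l $ j $ i) \<circ> (\<lambda>\<omega>.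
        restrict (\<lambda>i. Y i \<omega>) {l}))"
      using kl by (intro indep_var_compose[OF indep_var_restrict[OF ind]]) (auto intro!: measurable_nth_nth)
    then have "indep_var borel (\<lambda>\<omega>. Y k \<omega> $ a $ b) borel (\<lambda>\<omega>. Y l \<omega> $ j $ i)"
      by (simp add: o_def)
    then have "(\<integral>\<omega>. Y k \<omega> $ a $ b * Y l \<omega> $ j $ i \<partial>M) = (\<integral>\<omega>. Y k \<omega> $ a $ b \<partial>M) * (\<integral>\<omega>. Y l \<omega> $ j $ i \<partial>M)"
      by (intro indep_var_lebesgue_integral all_moments_integrable all_moments_nth am kl)
    also have "(\<integral>\<omega>. Y k \<omega> $ a $ b \<partial>M) = 0"
      using integral_nth[OF all_moments_integrable[OF am[OF kl(1)]], of a b] mean[OF kl(1)] by simp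
    finally show ?thesis by simp
  qed
  have "(\<integral>\<omega>. (\<Sum>k\<in>I. Y k \<omega>) $ a $ b * (\<Sum>k\<in>I. Y k \<omega>) $ j $ i \<partial>M)
      = (\<integral>\<omega>. (\<Sum>k\<in>I. \<Sum>l\<in>I. Y k \<omega> $ a $ b * Y l \<omega> $ j $ i) \<partial>M)"
    by (simp add: sum_component sum_product)
  also have "\<dots> = (\<Sum>k\<in>I. \<Sum>l\<in>I. \<integral>\<omega>. Y k \<omega> $ a $ b * Y l \<omega> $ j $ i \<partial>M)"
    by (subst Bochner_Integration.integral_sum, (intro Bochner_Integration.integrable_sum int; assumption)[1],
        rule sum.cong[OF refl], rule Bochner_Integration.integral_sum, intro int; assumption)
  also have "\<dots> = (\<Sum>k\<in>I. \<Sum>l\<in>I. if l = k then \<integral>\<omega>. Y k \<omega> $ a $ b * Y k \<omega> $ j $ i \<partial>M else 0)"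
    by (intro sum.cong refl) (auto simp: cross)
  also have "\<dots> = (\<Sum>k\<in>I. \<integral>\<omega>. Y k \<omega> $ a $ b * Y k \<omega> $ j $ i \<partial>M)"
    using I by simp
  finally show ?thesis .
qed

lemma var_tensor_nth:
  fixes Y :: "'a \<Rightarrow> complex ^ 'n ^ 'n"
  assumes "integrable M (\<lambda>\<omega>. kronecker (Y \<omega> - (\<integral>\<eta>. Y \<eta> \<partial>M)) (Y \<omega> - (\<integral>\<eta>. Y \<eta> \<partial>M)))"
  shows "var_tensor M Y $ (a, j) $ (b, i) = (\<integral>\<omega>. (Y \<omega> - (\<integral>\<eta>. Y \<eta> \<partial>M)) $ a $ b * (Y \<omega> - (\<integral>\<eta>. Y \<eta> \<partial>M)) $ j $ i \<partial>M)"
  unfolding var_tensor_def integral_nth[OF assms] by (simp add: kronecker_def)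

lemma bounded_bilinear_kronecker:
  "bounded_bilinear (kronecker :: complex ^ 'n ^ 'n \<Rightarrow> complex ^ 'n ^ 'n \<Rightarrow> complex ^ ('n \<times> 'n) ^ ('n \<times> 'n))"
proof (rule bilinear_conv_bounded_bilinear[THEN iffD1])
  show "bilinear (kronecker :: complex ^ 'n ^ 'n \<Rightarrow> complex ^ 'n ^ 'n \<Rightarrow> complex ^ ('n \<times> 'n) ^ ('n \<times> 'n))"
    unfolding bilinear_def by (auto intro!: linearI simp: kronecker_def vec_eq_iff algebra_simps)
qed

lemma measurable_kronecker:
  fixes f g :: "'a \<Rightarrow> complex ^ 'n ^ 'n"
  assumes "f \<in> borel_measurable M" "g \<in> borel_measurable M"
  shows "(\<lambda>x. kronecker (f x) (g x)) \<in> borel_measurable M"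
  by (rule borel_measurable_continuous_Pair[OF assms])
     (auto intro!: bounded_bilinear.continuous_on[OF bounded_bilinear_kronecker] continuous_intros)

text \<open>The right side is polynomial in the matrix, so \<open>X\<close> may be replaced by any
  version that agrees with it almost surely, such as the truncated sum.\<close>

lemma random_matrix_norm_eq:
  fixes X :: "'a \<Rightarrow> complex ^ 'n ^ 'n"
  assumes X: "X \<in> borel_measurable M" "\<And>\<omega>. \<omega> \<in> space M \<Longrightarrow> self_adjoint (X \<omega>)"
    and X': "X' \<in> borel_measurable M" and eq: "AE \<omega> in M. X \<omega> = X' \<omega>" and p: "1 \<le> p"
  shows "random_matrix_norm M (2 * real p) X
     = ((\<integral>\<omega>. Re (trace (resolvent_pow 0 p (X' \<omega>))) \<partial>M) / CARD('n)) powr (1 / (2 * real p))"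
proof -
  have "(\<integral>\<omega>. Re (ntrace (matrix_abs_powr (X \<omega>) (2 * real p))) \<partial>M)
      = (\<integral>\<omega>. Re (trace (resolvent_pow 0 p (X \<omega>))) / CARD('n) \<partial>M)"
    using X p by (intro Bochner_Integration.integral_cong) (auto simp: ntrace_matrix_abs_powr)
  also have "\<dots> = (\<integral>\<omega>. Re (trace (resolvent_pow 0 p (X' \<omega>))) / CARD('n) \<partial>M)"
  proof (rule integral_cong_AE)
    have [measurable]: "X \<in> borel_measurable M" "X' \<in> borel_measurable M" using X X' by auto
    show "(\<lambda>\<omega>. Re (trace (resolvent_pow 0 p (X \<omega>))) / CARD('n)) \<in> borel_measurable M"
      "(\<lambda>\<omega>. Re (trace (resolvent_pow 0 p (X' \<omega>))) / CARD('n)) \<in> borel_measurable M"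
      by measurable
  qed (use eq in auto)
  finally show ?thesis by (simp add: random_matrix_norm_def)
qed

text \<open>The extended value \<open>uniform_bound\<close> is avoided here: any real
  \<open>l > 0\<close> that bounds the centred summands almost surely will do, which also keeps the
  regularization positive.\<close>

lemma moment_comparison:
  fixes M :: "'a measure" and N :: "'b measure"
    and S :: "nat \<Rightarrow> 'a \<Rightarrow> complex ^ 'd ^ 'd"
    and X :: "'a \<Rightarrow> complex ^ 'd ^ 'd"
    and Z :: "'b \<Rightarrow> complex ^ 'd ^ 'd"
    and n p :: nat and l :: real
  assumes M: "prob_space M" and N: "prob_space N" and p: "1 \<le> p"
    and ind: "prob_space.indep_vars M (\<lambda>_. borel) S {1..n}"
    and sa: "\<And>i \<omega>. i \<in> {1..n} \<Longrightarrow> \<omega> \<in> space M \<Longrightarrow> self_adjoint (S i \<omega>)"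
    and X: "X = (\<lambda>\<omega>. \<Sum>i = 1..n. S i \<omega>)"
    and int: "\<And>i. i \<in> {1..n} \<Longrightarrow> integrable M (S i)"
    and Z: "gaussian_matrix N Z" "\<And>\<omega>. \<omega> \<in> space N \<Longrightarrow> self_adjoint (Z \<omega>)"
    and mean: "(\<integral>\<omega>. Z \<omega> \<partial>N) = (\<integral>\<omega>. X \<omega> \<partial>M)" and var: "var_tensor N Z = var_tensor M X"
    and l: "0 < l" and bnd: "AE \<omega> in M. \<forall>i\<in>{1..n}. op_le l (S i \<omega> - (\<integral>\<eta>. S i \<eta> \<partial>M))"
  shows "\<bar>random_matrix_norm M (2 * real p) X - random_matrix_norm N (2 * real p) Z\<bar>
      \<le> (16 * (real p)\<^sup>2 * matrix_variance M X * l) powr (1 / 3) + 16 * real p * l" (is ?thesis1)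
    and "\<bar>random_matrix_norm M (2 * real p) X - random_matrix_norm N (2 * real p) Z\<bar>
        \<le> 32 * (real p)\<^sup>2 * l" (is ?thesis2)
proof -
  interpret M: prob_space M by fact
  interpret N: prob_space N by fact
  have finM: "finite_measure M" and finN: "finite_measure N" by unfold_locales
  define E where "E i = (\<integral>\<eta>. S i \<eta> \<partial>M)" for i
  \<comment> \<open>The bound is only almost sure, but the locale wants it everywhere. Truncating by
    a fixed Borel function of \<open>S i\<close> keeps independence, and the value 0 is self-adjoint
    and satisfies the bound.\<close>
  define t where "t i s = (if op_le l (s - E i) then s - E i else 0)" for i s
  define Y where "Y i \<omega> = t i (S i \<omega>)" for i \<omega>
  define A where "A = (\<integral>\<omega>. X \<omega> \<partial>M)"
  define G where "G \<eta> = Z \<eta> - (\<integral>\<omega>. Z \<omega> \<partial>N)" for \<eta>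
  have t_meas: "t i \<in> borel_measurable borel" for i
  proof -
    have "closed ((\<lambda>s. s - E i) -` {A. op_le l A})"
      by (intro closed_vimage closed_op_le continuous_intros)
    then have [measurable]: "{s. op_le l (s - E i)} \<in> sets borel" by (simp add: vimage_def)
    show ?thesis unfolding t_def by (rule measurable_If) auto
  qed
  have S_meas: "S i \<in> borel_measurable M" if "i \<in> {1..n}" for i using int[OF that] by auto
  have Y_meas: "Y i \<in> borel_measurable M" if "i \<in> {1..n}" for i
    unfolding Y_def by (rule measurable_compose[OF S_meas[OF that] t_meas])
  have Y_ind: "M.indep_vars (\<lambda>_. borel) Y {1..n}"
    unfolding Y_def using M.indep_vars_compose2[OF ind, of t "\<lambda>_. borel"] t_meas by simp
  have E_sa: "self_adjoint (E i)" if "i \<in> {1..n}" for i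
    unfolding E_def by (rule cadjoint_integral[OF int[OF that] sa[OF that]])
  have Y_sa: "self_adjoint (Y i \<omega>)" if "i \<in> {1..n}" "\<omega> \<in> space M" for i \<omega>
    using self_adjoint_diff[OF sa[OF that] E_sa[OF that(1)]] by (simp add: Y_def t_def self_adjoint_def)
  have Y_op: "op_le l (Y i \<omega>)" for i \<omega>
    using l by (auto simp: Y_def t_def op_le_def)
  have Y_eq: "AE \<omega> in M. \<forall>i\<in>{1..n}. Y i \<omega> = S i \<omega> - E i"
    using bnd by eventually_elim (auto simp: Y_def t_def E_def)
  have Y_mean: "(\<integral>\<omega>. Y i \<omega> \<partial>M) = 0" if "i \<in> {1..n}" for i
  proof -
    have "(\<integral>\<omega>. Y i \<omega> \<partial>M) = (\<integral>\<omega>. S i \<omega> - E i \<partial>M)"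
      using Y_eq that by (intro integral_cong_AE Y_meas borel_measurable_diff S_meas) auto
    also have "\<dots> = 0" using int[OF that] by (simp add: E_def M.prob_space)
    finally show ?thesis .
  qed
  have Y_am: "all_moments M (Y i)" if "i \<in> {1..n}" for i
  proof (rule all_moments_bounded[OF finM Y_meas[OF that]])
    show "norm (Y i \<omega>) \<le> l * norm (mat 1 :: complex ^ 'd ^ 'd)" for \<omega>
      using op_le_norm_mult[OF Y_op[of i \<omega>], of "mat 1"] l by simp
  qed
  define T where "T \<omega> = (\<Sum>i\<in>{1..n}. Y i \<omega>)" for \<omega>
  have T_am: "all_moments M T" unfolding T_def by (intro all_moments_sum finM Y_am)
  have X_meas: "X \<in> borel_measurable M" unfolding X by (intro borel_measurable_sum S_meas)
  have X_sa: "self_adjoint (X \<omega>)" if "\<omega> \<in> space M" for \<omega>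
    using sa that by (simp add: X self_adjoint_def cadjoint_sum)
  have A_eq: "A = (\<Sum>i\<in>{1..n}. E i)"
    unfolding A_def X E_def by (rule Bochner_Integration.integral_sum[OF int])
  have XT: "AE \<omega> in M. X \<omega> = A + T \<omega>"
    using Y_eq by eventually_elim (simp add: X A_eq T_def sum_subtractf)
  have X_int: "integrable M X" unfolding X by (intro Bochner_Integration.integrable_sum int)
  have A_sa: "self_adjoint A" unfolding A_def by (rule cadjoint_integral[OF X_int X_sa])
  have Z_am: "all_moments N Z" by (rule all_moments_gaussian_matrix[OF N Z(1)])
  have G_am: "all_moments N G" unfolding G_def by (intro all_moments_diff Z_am all_moments_const finN)
  have G_sa: "self_adjoint (G \<eta>)" if "\<eta> \<in> space N" for \<eta>
    unfolding G_def mean A_def[symmetric] by (intro self_adjoint_diff Z(2) A_sa that)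
  have G_mean: "(\<integral>\<eta>. G \<eta> \<partial>N) = 0"
    unfolding G_def using all_moments_integrable[OF Z_am] by (simp add: N.prob_space)
  have ZG: "Z \<eta> = A + G \<eta>" for \<eta> by (simp add: G_def mean A_def)
  have cov_X: "(\<integral>\<omega>. (X \<omega> - A) $ a $ b * (X \<omega> - A) $ j $ i \<partial>M)
      = (\<Sum>k\<in>{1..n}. \<integral>\<omega>. Y k \<omega> $ a $ b * Y k \<omega> $ j $ i \<partial>M)" for a b j i
  proof -
    have "(\<integral>\<omega>. (X \<omega> - A) $ a $ b * (X \<omega> - A) $ j $ i \<partial>M) = (\<integral>\<omega>. T \<omega> $ a $ b * T \<omega> $ j $ i \<partial>M)"
      using XT X_meas all_moments_measurable[OF T_am]
      by (intro integral_cong_AE borel_measurable_times measurable_nth_nth borel_measurable_diff) auto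
    also have "\<dots> = (\<Sum>k\<in>{1..n}. \<integral>\<omega>. Y k \<omega> $ a $ b * Y k \<omega> $ j $ i \<partial>M)"
      unfolding T_def by (rule M.integral_entries_indep_sum[OF Y_ind]) (auto intro: Y_am Y_mean)
    finally show ?thesis .
  qed
  \<comment> \<open>Entries of \<open>var_tensor M X\<close> are covariances only once this product
    is known to be integrable, since a nonintegrable function has integral 0.\<close>
  have X_kr: "integrable M (\<lambda>\<omega>. kronecker (X \<omega> - A) (X \<omega> - A))"
  proof -
    have m: "(\<lambda>\<omega>. kronecker (X \<omega> - A) (X \<omega> - A)) \<in> borel_measurable M"
      using X_meas by (intro measurable_kronecker borel_measurable_diff) auto
    have k: "all_moments M (\<lambda>\<omega>. kronecker (T \<omega>) (T \<omega>))"
      by (rule all_moments_bilinear[OF bounded_bilinear_kronecker T_am T_am])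
    have "AE \<omega> in M. kronecker (X \<omega> - A) (X \<omega> - A) = kronecker (T \<omega>) (T \<omega>)"
      using XT by eventually_elim simp
    with m k show ?thesis
      using integrable_cong_AE[of "\<lambda>\<omega>. kronecker (X \<omega> - A) (X \<omega> - A)" M "\<lambda>\<omega>. kronecker (T \<omega>) (T \<omega>)"]
      by (simp add: all_moments_measurable all_moments_integrable)
  qed
  have cov: "(\<integral>\<eta>. G \<eta> $ a $ b * G \<eta> $ j $ i \<partial>N) = (\<Sum>k\<in>{1..n}. \<integral>\<omega>. Y k \<omega> $ a $ b * Y k \<omega> $ j $ i \<partial>M)" for a b j i
  proof -
    have "all_moments N (\<lambda>\<eta>. kronecker (G \<eta>) (G \<eta>))"
      by (rule all_moments_bilinear[OF bounded_bilinear_kronecker G_am G_am])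
    from var_tensor_nth[of N Z a j b i, folded G_def, OF all_moments_integrable[OF this]]
    show ?thesis
      unfolding var var_tensor_nth[OF X_kr[unfolded A_def]] A_def[symmetric] cov_X by simp
  qed
  interpret C: comparison M N Y G A n p l
  proof unfold_locales
    show "(\<integral>\<eta>. trace (shift_prod cs (C + b *\<^sub>R G \<eta>) ** G \<eta>) \<partial>N)
       = b *\<^sub>R (\<integral>\<eta>. cov_form (\<lambda>a b j i. \<integral>\<eta>. G \<eta> $ a $ b * G \<eta> $ j $ i \<partial>N) cs (C + b *\<^sub>R G \<eta>) \<partial>N)" for cs C b
      unfolding G_def by (rule gaussian_matrix_ibp[OF N Z(1)])
  qed (fact p l Y_ind Y_sa Y_mean G_am G_sa G_mean cov A_sa | rule Y_op)+
  have V: "matrix_variance M X = spectral_norm C.V"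
  proof -
    have am1: "integrable M (\<lambda>\<omega>. (X \<omega> - A) ** (X \<omega> - A))"
    proof -
      have "AE \<omega> in M. (X \<omega> - A) ** (X \<omega> - A) = T \<omega> ** T \<omega>" using XT by eventually_elim simp
      moreover have "all_moments M (\<lambda>\<omega>. T \<omega> ** T \<omega>)" by (intro all_moments_matrix_mult T_am)
      ultimately show ?thesis
        using integrable_cong_AE[of "\<lambda>\<omega>. (X \<omega> - A) ** (X \<omega> - A)" M "\<lambda>\<omega>. T \<omega> ** T \<omega>"] X_meas
        by (simp add: all_moments_measurable all_moments_integrable measurable_matrix_mult)
    qed
    have YY: "integrable M (\<lambda>\<omega>. Y k \<omega> ** Y k \<omega>)" if "k \<in> {1..n}" for k
      by (intro all_moments_integrable all_moments_matrix_mult Y_am that)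
    have i1: "integrable M (\<lambda>\<omega>. (X \<omega> - A) $ a $ k * (X \<omega> - A) $ k $ b)" for a b k
    proof -
      have "AE \<omega> in M. (X \<omega> - A) $ a $ k * (X \<omega> - A) $ k $ b
          = T \<omega> $ a $ k * T \<omega> $ k $ b" using XT by eventually_elim simp
      moreover have "all_moments M (\<lambda>\<omega>. T \<omega> $ a $ k * T \<omega> $ k $ b)" by (intro all_moments_mult all_moments_nth T_am)
      moreover have "(\<lambda>\<omega>. (X \<omega> - A) $ a $ k * (X \<omega> - A) $ k $ b) \<in> borel_measurable M"
        using X_meas by (intro borel_measurable_times measurable_nth_nth borel_measurable_diff) auto
      ultimately show ?thesis
        using integrable_cong_AE[of "\<lambda>\<omega>. (X \<omega> - A) $ a $ k * (X \<omega> - A) $ k $ b" M "\<lambda>\<omega>. T \<omega> $ a $ k * T \<omega> $ k $ b"]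
        by (simp add: all_moments_measurable all_moments_integrable)
    qed
    have "(\<integral>\<omega>. (X \<omega> - A) ** (X \<omega> - A) \<partial>M) $ a $ b = C.V $ a $ b" for a b
    proof -
      have "(\<integral>\<omega>. (X \<omega> - A) ** (X \<omega> - A) \<partial>M) $ a $ b = (\<Sum>k\<in>UNIV. \<integral>\<omega>. (X \<omega> - A) $ a $ k * (X \<omega> - A) $ k $ b \<partial>M)"
        unfolding integral_nth[OF am1] unfolding matrix_matrix_mult_def vec_lambda_beta
        by (rule Bochner_Integration.integral_sum) (rule i1)
      also have "\<dots> = (\<Sum>i\<in>{1..n}. \<Sum>k\<in>UNIV. \<integral>\<omega>. Y i \<omega> $ a $ k * Y i \<omega> $ k $ b \<partial>M)"
        unfolding cov_X by (rule sum.swap)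
      also have "\<dots> = (\<Sum>i\<in>{1..n}. (\<integral>\<omega>. Y i \<omega> ** Y i \<omega> \<partial>M) $ a $ b)"
      proof (rule sum.cong[OF refl])
        fix i assume i: "i \<in> {1..n}"
        show "(\<Sum>k\<in>UNIV. \<integral>\<omega>. Y i \<omega> $ a $ k * Y i \<omega> $ k $ b \<partial>M) = (\<integral>\<omega>. Y i \<omega> ** Y i \<omega> \<partial>M) $ a $ b"
          unfolding integral_nth[OF YY[OF i]] unfolding matrix_matrix_mult_def vec_lambda_beta
          by (rule Bochner_Integration.integral_sum[symmetric]) (intro all_moments_integrable all_moments_mult
              all_moments_nth Y_am i)
      qed
      finally show ?thesis by (simp add: C.V_def sum_component)
    qed
    then have "(\<integral>\<omega>. (X \<omega> - A) ** (X \<omega> - A) \<partial>M) = C.V" by (simp add: vec_eq_iff)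
    then show ?thesis by (simp add: matrix_variance_def A_def)
  qed
  define a where "a = random_matrix_norm M (2 * real p) X"
  define b where "b = random_matrix_norm N (2 * real p) Z"
  have AT_am: "all_moments M (\<lambda>\<omega>. A + T \<omega>)" by (intro all_moments_add all_moments_const finM T_am)
  have AG_am: "all_moments N (\<lambda>\<eta>. A + G \<eta>)" by (intro all_moments_add all_moments_const finN G_am)
  have T_sa: "self_adjoint (T \<omega>)" if "\<omega> \<in> space M" for \<omega>
    using Y_sa that by (simp add: T_def self_adjoint_def cadjoint_sum)
  have a: "a = ((\<integral>\<omega>. Re (trace (resolvent_pow 0 p (A + T \<omega>))) \<partial>M) / CARD('d)) powr (1 / (2 * real p))"
    unfolding a_def by (rule random_matrix_norm_eq[OF X_meas X_sa all_moments_measurable[OF AT_am] XT p])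
  have b: "b = ((\<integral>\<eta>. Re (trace (resolvent_pow 0 p (A + G \<eta>))) \<partial>N) / CARD('d)) powr (1 / (2 * real p))"
    unfolding b_def
    by (rule random_matrix_norm_eq[OF all_moments_measurable[OF Z_am] Z(2) all_moments_measurable[OF AG_am] _
        p]) (simp_all add: ZG)
  have ST: "C.S = T" by (simp add: fun_eq_iff C.S_def T_def)
  have Ha: "C.H (pi / 2) = ((\<integral>\<omega>. Re (trace (resolvent_pow C.g p (A + T \<omega>))) \<partial>M) / CARD('d)) powr (1 / (2 * real p))"
    by (simp add: C.H_def C.f_pi_half ST)
  have Hb: "C.H 0 = ((\<integral>\<eta>. Re (trace (resolvent_pow C.g p (A + G \<eta>))) \<partial>N) / CARD('d)) powr (1 / (2 * real p))"
    by (simp add: C.H_def C.f_0)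
  have "a \<le> C.H (pi / 2)" "C.H (pi / 2) \<le> a + C.g" "b \<le> C.H 0" "C.H 0 \<le> b + C.g"
    unfolding a b Ha Hb
    by (intro M.shifted_norm_bounds N.shifted_norm_bounds AT_am AG_am self_adjoint_add A_sa T_sa G_sa p C.g;
        assumption)+
  \<comment> \<open>Regularization raises both norms, by at most \<open>C.g\<close> each, so the two
    errors do not add up.\<close>
  then have ab: "\<bar>a - b\<bar> \<le> \<bar>C.H (pi / 2) - C.H 0\<bar> + 16 * real p * l"
    unfolding C.g_def by linarith
  have "\<bar>C.H (pi / 2) - C.H 0\<bar> ^ 3 \<le> 16 * (real p)\<^sup>2 * matrix_variance M X * l"
    using C.H_diff_op[OF op_le_spectral_norm spectral_norm_nonneg] by (simp add: V mult_ac)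
  then have "(\<bar>C.H (pi / 2) - C.H 0\<bar> ^ 3) powr (1 / 3) \<le> (16 * (real p)\<^sup>2 * matrix_variance M X * l) powr (1 / 3)"
    by (intro powr_mono2) auto
  moreover have "(\<bar>C.H (pi / 2) - C.H 0\<bar> ^ 3) powr (1 / 3) = \<bar>C.H (pi / 2) - C.H 0\<bar>"
  proof -
    have "\<bar>C.H (pi / 2) - C.H 0\<bar> ^ 3 = \<bar>C.H (pi / 2) - C.H 0\<bar> powr 3" by (rule powr_numeral[symmetric]) simp
    then show ?thesis by (simp only: powr_powr) simp
  qed
  ultimately show ?thesis1 using ab by (simp add: a_def b_def)
  \<comment> \<open>Since \<open>p\<close> is at least 1, the cost of regularization is absorbed by
    doubling 16 to 32.\<close>
  have "16 * real p * l \<le> 16 * (real p)\<^sup>2 * l"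
    using p l by (simp add: power2_eq_square)
  then show ?thesis2 using ab C.H_diff_gauss by (simp add: a_def b_def)
qed

text \<open>A finite positive \<open>U\<close> is itself an admissible \<open>l\<close>; for
  \<open>U = 0\<close> arbitrarily small \<open>l\<close> force \<open>x\<close> to be at most
  0.\<close>

lemma ennreal_le_if_finite_bound:
  fixes x :: real and U :: ennreal
  assumes le: "\<And>l. 0 < l \<Longrightarrow> U \<le> ennreal l \<Longrightarrow> x \<le> c * l" and c: "0 < c"
  shows "ennreal x \<le> ennreal c * U"
proof (cases U)
  case (real L)
  show ?thesis
  proof (cases "L = 0")
    case True
    have "x \<le> 0"
    proof (rule field_le_epsilon)
      show "x \<le> 0 + e" if "0 < e" for e
        using le[of "e / c"] c that True real by simp
    qed
    then show ?thesis by (simp add: ennreal_neg)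
  next
    case False
    then have "x \<le> c * L" using real by (intro le) auto
    then show ?thesis using real c by (simp add: ennreal_mult[symmetric] ennreal_leI)
  qed
qed (use c in \<open>simp add: ennreal_mult_top\<close>)

theorem theorem1:
  fixes M :: "'a measure" and N :: "'b measure"
    and S :: "nat \<Rightarrow> 'a \<Rightarrow> complex ^ 'd ^ 'd"
    and X :: "'a \<Rightarrow> complex ^ 'd ^ 'd"
    and Z :: "'b \<Rightarrow> complex ^ 'd ^ 'd"
    and n p :: nat
  assumes "prob_space M" and "prob_space N"
    and "n \<ge> 1" and "p \<ge> 1"
    and "prob_space.indep_vars M (\<lambda>_. borel) S {1..n}"
    and "\<And>i \<omega>. i \<in> {1..n} \<Longrightarrow> \<omega> \<in> space M \<Longrightarrow> self_adjoint (S i \<omega>)"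
    and "X = (\<lambda>\<omega>. \<Sum>i = 1..n. S i \<omega>)"
    and "\<And>i. i \<in> {1..n} \<Longrightarrow> integrable M (S i)"
    and "\<And>i. i \<in> {1..n} \<Longrightarrow> integrable M (\<lambda>\<omega>. S i \<omega> ** S i \<omega>)"
    and "integrable M (\<lambda>\<omega>. ntrace (matrix_abs_powr (X \<omega>) (2 * real p)))"
    and "gaussian_matrix N Z"
    and "\<And>\<omega>. \<omega> \<in> space N \<Longrightarrow> self_adjoint (Z \<omega>)"
    and "(\<integral>\<omega>. Z \<omega> \<partial>N) = (\<integral>\<omega>. X \<omega> \<partial>M)"
    and "var_tensor N Z = var_tensor M X"
  shows "(ennreal \<bar>random_matrix_norm M (2 * real p) X - random_matrix_norm N (2 * real p) Z\<bar>
            \<le> ennreal_powr (16 * of_nat p ^ 2 * ennreal (matrix_variance M X) * uniform_bound M n S) (1 / 3)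
              + 16 * of_nat p * uniform_bound M n S)
       \<and> (of_nat p * uniform_bound M n S ^ 2 \<le> ennreal (matrix_variance M X) \<longrightarrow>
            ennreal \<bar>random_matrix_norm M (2 * real p) X - random_matrix_norm N (2 * real p) Z\<bar>
              \<le> 32 * of_nat p ^ 2 * uniform_bound M n S)"
proof -
  define U where "U = uniform_bound M n S"
  define x where "x = \<bar>random_matrix_norm M (2 * real p) X - random_matrix_norm N (2 * real p) Z\<bar>"
  define v where "v = matrix_variance M X"
  have v0: "0 \<le> v" by (simp add: v_def matrix_variance_def spectral_norm_nonneg)
  have bnd: "AE \<omega> in M. \<forall>i\<in>{1..n}. op_le l (S i \<omega> - (\<integral>\<eta>. S i \<eta> \<partial>M))" if l: "0 < l" "U \<le> ennreal l" for l
    using esssup_AE[of "\<lambda>\<omega>. MAX i\<in>{1..n}. ennreal (spectral_norm (S i \<omega> - (\<integral>\<eta>. S i \<eta> \<partial>M)))" M]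
  proof eventually_elim
    case (elim \<omega>)
    show ?case
    proof
      fix i assume i: "i \<in> {1..n}"
      have "ennreal (spectral_norm (S i \<omega> - (\<integral>\<eta>. S i \<eta> \<partial>M))) \<le> (MAX i\<in>{1..n}. ennreal (spectral_norm (S i \<omega> - (\<integral>\<eta>. S i \<eta> \<partial>M))))"
        using i by (intro Max_ge) auto
      also have "\<dots> \<le> U" using elim by (simp add: U_def uniform_bound_def)
      also have "\<dots> \<le> ennreal l" by fact
      finally have "spectral_norm (S i \<omega> - (\<integral>\<eta>. S i \<eta> \<partial>M)) \<le> l" using l by simp
      then show "op_le l (S i \<omega> - (\<integral>\<eta>. S i \<eta> \<partial>M))"
        by (rule op_le_mono[OF op_le_spectral_norm])
    qed
  qed
  have cmp: "x \<le> (16 * (real p)\<^sup>2 * v * l) powr (1 / 3) + 16 * real p * l" "x \<le> 32 * (real p)\<^sup>2 * l"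
    if l: "0 < l" "U \<le> ennreal l" for l
    unfolding x_def v_def
    by (rule moment_comparison[OF assms(1,2,4,5,6,7,8,11,12,13,14) l(1) bnd[OF l]]; assumption)+
  have x2: "ennreal x \<le> ennreal (32 * (real p)\<^sup>2) * U"
    using assms(4) by (intro ennreal_le_if_finite_bound cmp(2)) auto
  have "ennreal x \<le> ennreal_powr (16 * of_nat p ^ 2 * ennreal v * U) (1 / 3) + 16 * of_nat p * U"
  proof (cases U)
    case (real L)
    show ?thesis
    proof (cases "L = 0")
      case True
      \<comment> \<open>With \<open>U = 0\<close> the estimate \<open>x2\<close> already gives 0,
        while 0 itself is not an admissible \<open>l\<close>.\<close>
      then show ?thesis using x2 real by (auto intro: order_trans)
    next
      case False
      then have L: "0 < L" using real by simp
      have "x \<le> (16 * (real p)\<^sup>2 * v * L) powr (1 / 3) + 16 * real p * L"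
        by (rule cmp(1)[OF L]) (simp add: real)
      moreover have "16 * of_nat p ^ 2 * ennreal v * U = ennreal (16 * (real p)\<^sup>2 * v * L)"
        using L v0 by (simp add: real ennreal_mult ennreal_power ennreal_of_nat_eq_real_of_nat)
      moreover have "16 * of_nat p * U = ennreal (16 * real p * L)"
        using L by (simp add: real ennreal_mult ennreal_of_nat_eq_real_of_nat)
      ultimately show ?thesis
        using L v0 by (simp add: ennreal_powr_def ennreal_plus[symmetric] ennreal_leI del: ennreal_plus)
    qed
  next
    case top
    \<comment> \<open>Even if \<open>v = 0\<close> turns the product under the cube root into 0, the
      second summand is infinite.\<close>
    then show ?thesis using assms(4) by (simp add: ennreal_mult_top)
  qed
  moreover have "ennreal (32 * (real p)\<^sup>2) * U = 32 * of_nat p ^ 2 * U"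
    by (simp add: ennreal_mult ennreal_power ennreal_of_nat_eq_real_of_nat)
  ultimately show ?thesis using x2 by (simp add: U_def x_def v_def)
qed

end
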